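(* There is an algorithm that, given a hypergraph $H$ of rank $r=r(H)$ and integers $k$ and $w$, decides whether there exist a set cover $S$ of $H$ with $|S|\le k$ and a bijection $\pi:S\to\{1,\dots,|S|\}$ whose cost $\sum_{e\in E(H)}\min_{v\in e\cap S}\pi(v)$ is at most $w$, in time $O\!\left(r^{r+k}k^{r}|E(H)| + (rk)^{rk}\right)$.
   Context: A hypergraph $H$ consists of a finite vertex set $V(H)$ and a set $E(H)$ of hyperedges, each a nonempty subset of $V(H)$ (no repeated hyperedges). Its rank $r(H)$ is the maximum cardinality of a hyperedge. A set cover of $H$ is a set of vertices intersecting every hyperedge. *)

theory Defs
  imports Main
begin

section \<open>Hypergraphs and min-sum set covers\<close>

definition hypergraph :: "'a set \<Rightarrow> 'a set set \<Rightarrow> bool" where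
  "hypergraph V E \<longleftrightarrow> finite V \<and> (\<forall>e\<in>E. e \<noteq> {} \<and> e \<subseteq> V)"

text \<open>The edgeless hypergraph gets rank 0.\<close>

definition rank :: "'a set set \<Rightarrow> nat" where
  "rank E = (if E = {} then 0 else Max (card ` E))"

definition set_cover :: "'a set \<Rightarrow> 'a set set \<Rightarrow> 'a set \<Rightarrow> bool" where
  "set_cover V E S \<longleftrightarrow> S \<subseteq> V \<and> (\<forall>e\<in>E. e \<inter> S \<noteq> {})"

definition ordering_cost :: "'a set set \<Rightarrow> 'a set \<Rightarrow> ('a \<Rightarrow> nat) \<Rightarrow> nat" where
  "ordering_cost E S \<pi> = (\<Sum>e\<in>E. Min (\<pi> ` (e \<inter> S)))"

definition has_cheap_cover :: "'a set \<Rightarrow> 'a set set \<Rightarrow> int \<Rightarrow> int \<Rightarrow> bool" where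
  "has_cheap_cover V E k w \<longleftrightarrow>
     (\<exists>S \<pi>. set_cover V E S \<and> int (card S) \<le> k \<and> bij_betw \<pi> S {1..card S} \<and>
            int (ordering_cost E S \<pi>) \<le> w)"


section \<open>A unit-cost random access machine\<close>

text \<open>
  Structured programs over finitely many named registers and an unbounded integer-addressed
  memory of integers with indirect addressing. Every evaluated constant, register access, memory
  access, operation and test costs one time unit. The only arithmetic is addition and subtraction:
  unit-cost multiplication of unbounded integers would make the model unreasonably strong.
\<close>

datatype aexp = Const int | Reg string | Load aexp | Add aexp aexp | Sub aexp aexp

datatype bexp = Less aexp aexp | Not bexp | And bexp bexp

datatype com =
    Skip
  | Assign string aexp
  | Store aexp aexp
  | Seq com com
  | If bexp com com
  | While bexp com

record state =
  reg :: "string \<Rightarrow> int"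
  mem :: "int \<Rightarrow> int"

fun aval :: "aexp \<Rightarrow> state \<Rightarrow> int" where
  "aval (Const n) s = n"
| "aval (Reg x) s = reg s x"
| "aval (Load a) s = mem s (aval a s)"
| "aval (Add a b) s = aval a s + aval b s"
| "aval (Sub a b) s = aval a s - aval b s"

fun bval :: "bexp \<Rightarrow> state \<Rightarrow> bool" where
  "bval (Less a b) s \<longleftrightarrow> aval a s < aval b s"
| "bval (Not b) s \<longleftrightarrow> \<not> bval b s"
| "bval (And b c) s \<longleftrightarrow> bval b s \<and> bval c s"

fun atime :: "aexp \<Rightarrow> nat" where
  "atime (Const n) = 1"
| "atime (Reg x) = 1"
| "atime (Load a) = 1 + atime a"
| "atime (Add a b) = 1 + atime a + atime b"
| "atime (Sub a b) = 1 + atime a + atime b"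

fun btime :: "bexp \<Rightarrow> nat" where
  "btime (Less a b) = 1 + atime a + atime b"
| "btime (Not b) = 1 + btime b"
| "btime (And b c) = 1 + btime b + btime c"

text \<open>\<open>exec c s t s'\<close>: started in \<open>s\<close>, program \<open>c\<close> halts in \<open>s'\<close> after exactly \<open>t\<close> time units.\<close>

inductive exec :: "com \<Rightarrow> state \<Rightarrow> nat \<Rightarrow> state \<Rightarrow> bool" where
  Skip: "exec Skip s 1 s"
| Assign: "exec (Assign x a) s (1 + atime a) (s\<lparr>reg := (reg s)(x := aval a s)\<rparr>)"
| Store: "exec (Store a b) s (1 + atime a + atime b) (s\<lparr>mem := (mem s)(aval a s := aval b s)\<rparr>)"
| Seq: "exec c s t s' \<Longrightarrow> exec d s' t' s'' \<Longrightarrow> exec (Seq c d) s (t + t') s''"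
| IfTrue: "bval b s \<Longrightarrow> exec c s t s' \<Longrightarrow> exec (If b c d) s (btime b + t) s'"
| IfFalse: "\<not> bval b s \<Longrightarrow> exec d s t s' \<Longrightarrow> exec (If b c d) s (btime b + t) s'"
| WhileFalse: "\<not> bval b s \<Longrightarrow> exec (While b c) s (btime b) s"
| WhileTrue: "bval b s \<Longrightarrow> exec c s t s' \<Longrightarrow> exec (While b c) s' t' s'' \<Longrightarrow>
    exec (While b c) s (btime b + t + t') s''"

inductive_cases exec_SkipE: "exec Skip s t s'"
inductive_cases exec_AssignE: "exec (Assign x a) s t s'"
inductive_cases exec_StoreE: "exec (Store a b) s t s'"
inductive_cases exec_SeqE: "exec (Seq c d) s t s'"
inductive_cases exec_IfE: "exec (If b c d) s t s'"
inductive_cases exec_WhileE: "exec (While b c) s t s'"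

lemma exec_deterministic: "exec c s t s' \<Longrightarrow> exec c s u s'' \<Longrightarrow> u = t \<and> s'' = s'"
proof (induction arbitrary: u s'' rule: exec.induct)
  case (Skip s)
  then show ?case by (auto elim: exec_SkipE)
next
  case (Assign x a s)
  then show ?case by (auto elim: exec_AssignE)
next
  case (Store a b s)
  then show ?case by (auto elim: exec_StoreE)
next
  case (Seq c s t s' d t' s'')
  from Seq.prems show ?case by (rule exec_SeqE) (use Seq.IH in blast)
next
  case (IfTrue b s c t s' d)
  from IfTrue.prems show ?case by (rule exec_IfE) (use IfTrue in blast)+
next
  case (IfFalse b s d t s' c)
  from IfFalse.prems show ?case by (rule exec_IfE) (use IfFalse in blast)+
next
  case (WhileFalse b s c)
  from WhileFalse.prems show ?case by (rule exec_WhileE) (use WhileFalse in auto)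
next
  case (WhileTrue b s c t s' t' s'')
  from WhileTrue.prems show ?case by (rule exec_WhileE) (use WhileTrue in blast)+
qed


section \<open>Input format\<close>

text \<open>
  Vertices are named by arbitrary natural numbers. A hypergraph is presented by any
  duplicate-free enumeration of its vertices and of its hyperedges.
\<close>

definition enumerates :: "nat list \<Rightarrow> nat list list \<Rightarrow> nat set \<Rightarrow> nat set set \<Rightarrow> bool" where
  "enumerates vs es V E \<longleftrightarrow>
     distinct vs \<and> set vs = V \<and>
     (\<forall>e\<in>set es. distinct e) \<and> distinct (map set es) \<and> set (map set es) = E"

text \<open>
  The numbers \<open>k\<close>, \<open>w\<close>, the number of vertices and the number of hyperedges come first, then the
  vertices, then every hyperedge as its length followed by its elements.
\<close>

definition input_word :: "int \<Rightarrow> int \<Rightarrow> nat list \<Rightarrow> nat list list \<Rightarrow> int list" where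
  "input_word k w vs es =
     [k, w, int (length vs), int (length es)] @ map int vs @
     concat (map (\<lambda>e. int (length e) # map int e) es)"

definition initial_state :: "int list \<Rightarrow> state" where
  "initial_state xs =
     \<lparr>reg = (\<lambda>_. 0),
      mem = (\<lambda>i. if 0 \<le> i \<and> i < int (length xs) then xs ! nat i else 0)\<rparr>"

text \<open>
  The natural-number power with \<open>0 ^ 0 = 1\<close> keeps the bound positive, so it can be used with a
  single multiplicative constant on all inputs. A negative budget \<open>k\<close> is measured as \<open>nat k = 0\<close>.
\<close>

definition time_bound :: "nat \<Rightarrow> nat \<Rightarrow> nat \<Rightarrow> nat" where
  "time_bound r k m = r ^ (r + k) * k ^ r * m + (r * k) ^ (r * k)"

end

theory Submission
  imports Defs "HOL-Library.Nat_Bijection"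
begin

text \<open>
  List a cover in the order of its positions; its cost is the sum, over all prefixes, of the number of
  edges the prefix leaves uncovered. In a cheapest order the numbers of newly covered edges never
  increase, so each vertex covers at least a \<open>1 / (k - i)\<close> fraction of what the first \<open>i\<close> vertices left
  uncovered. Only \<open>r * (k - i)\<close> vertices can do that, and a search tree with at most
  \<open>(k + 1) * r ^ k * k!\<close> nodes finds the optimum.

  To avoid reading all edges at every node, the candidate vertices are restricted beforehand.
  Starting from a single class, \<open>k\<close> rounds split every class of edges according to the trace on
  its heavy vertices, those lying in at least a \<open>1 / (2 k)\<close> fraction of the class. Every vertex the
  search can pick is heavy in one of these classes: along the classes of an uncovered edge, each round
  either meets a new chosen vertex or has all chosen vertices light, in which case at most half of the
  class is covered. There are at most \<open>(2 r k^2 + 1) ^ (r + 1)\<close> heavy vertices, and merging the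
  edges with equal trace on them leaves at most \<open>(2 r k^2 + 1) ^ (r (r + 1))\<close> weighted edges. If
  \<open>k \<le> 2 r + 9\<close>, the search is affordable on all \<open>m\<close> edges, because \<open>k! \<le> k ^ r * (k - r)!\<close>;
  otherwise it fits into \<open>(r k) ^ (r k)\<close> on the merged ones.
\<close>

section \<open>Classes of edges and heavy vertices\<close>

text \<open>Why \<open>1 / (2 k)\<close>: fewer than \<open>k\<close> chosen vertices, all light in
  a class, leave at least half of it uncovered, so a further light vertex covers less than a
  \<open>1 / k\<close> fraction of the rest, too little to be picked. Why the counts stay
  polynomial: a vertex in the trace of an edge lies in every edge of its new class, so it is heavy
  there and stays in all later traces. A class is thus described by at most \<open>r\<close>
  vertices and the rounds in which they entered; counting each round separately would be exponential
  in the number of rounds. What shapes the program: the time bound has no term for the number of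
  vertices, so the vertex list is skipped and the vertices are gathered from the edges. It also
  leaves no room for sorting, and the machine cannot multiply. Classes and traces are therefore
  named by sums of powers of two and used directly as addresses of an unbounded memory that starts
  as zero. Distinct rounds use disjoint address ranges, so nothing has to be cleared between
  them.\<close>

lemma set_encode_less: "A \<subseteq> {..<n} \<Longrightarrow> set_encode A < 2 ^ n"
proof (induction n arbitrary: A)
  case (Suc n)
  have fin: "finite A" using Suc.prems finite_subset by blast
  have le: "set_encode (A - {n}) < 2 ^ n" using Suc.prems by (intro Suc.IH) auto
  show ?case
  proof (cases "n \<in> A")
    case True
    then have "set_encode A = 2 ^ n + set_encode (A - {n})"
      using fin set_encode_insert[of "A - {n}" n] by (simp add: insert_absorb)
    then show ?thesis using le by simp
  next
    case False
    then show ?thesis using le by simp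
  qed
qed simp

lemma add_mult_cancel_less:
  fixes a b c d M :: nat
  assumes "a < M" "b < M" "a + M * c = b + M * d"
  shows "a = b \<and> c = d"
proof -
  have "a = (a + M * c) mod M" "b = (b + M * d) mod M" using assms(1,2) by simp_all
  then have "a = b" using assms(3) by simp
  then show ?thesis using assms by simp
qed

definition edge_class :: "nat set set \<Rightarrow> (nat set \<Rightarrow> nat) \<Rightarrow> nat \<Rightarrow> nat set set" where
  "edge_class E g c = {e\<in>E. g e = c}"

text \<open>The fraction is multiplied out, which is also the comparison that the program makes. In
  an empty class it would hold of every vertex, hence the nonemptiness.\<close>

definition heavy :: "nat \<Rightarrow> nat set set \<Rightarrow> (nat set \<Rightarrow> nat) \<Rightarrow> nat \<Rightarrow> nat set" where
  "heavy k E g c = {v. edge_class E g c \<noteq> {} \<and>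
     card (edge_class E g c) \<le> 2 * k * card {e\<in>edge_class E g c. v \<in> e}}"

text \<open>Round \<open>t\<close> owns the binary digits \<open>t * W, \<dots>, t * W + W - 1\<close>, so a code determines the traces of all
  earlier rounds.\<close>

primrec code :: "nat \<Rightarrow> nat set set \<Rightarrow> (nat \<Rightarrow> nat) \<Rightarrow> nat \<Rightarrow> nat \<Rightarrow> nat set \<Rightarrow> nat" where
  "code k E idx W 0 = (\<lambda>e. 0)"
| "code k E idx W (Suc t) = (\<lambda>e. code k E idx W t e + 2 ^ (t * W) *
     set_encode (idx ` (e \<inter> heavy k E (code k E idx W t) (code k E idx W t e))))"

definition residual :: "nat set set \<Rightarrow> nat set \<Rightarrow> nat" where
  "residual E A = card {e\<in>E. e \<inter> A = {}}"

definition gain :: "nat set set \<Rightarrow> nat set \<Rightarrow> nat \<Rightarrow> nat" where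
  "gain E A v = card {e\<in>E. e \<inter> A = {} \<and> v \<in> e}"

locale refinement =
  fixes E :: "nat set set" and k r W :: nat and idx :: "nat \<Rightarrow> nat"
  assumes finE: "finite E" and fine: "\<And>e. e \<in> E \<Longrightarrow> finite e"
    and card_le: "\<And>e. e \<in> E \<Longrightarrow> card e \<le> r"
    and inj: "inj_on idx (\<Union>E)" and idx_less: "\<And>v. v \<in> \<Union>E \<Longrightarrow> idx v < W"
    and k_pos: "1 \<le> k"
begin

abbreviation "g \<equiv> code k E idx W"
abbreviation "cls t e \<equiv> edge_class E (g t) (g t e)"
abbreviation "hv t e \<equiv> heavy k E (g t) (g t e)"

text \<open>Only heavy vertices met inside an edge are collected, as the program does when it walks
  through the edges. None is lost, because a heavy vertex lies in some edge of its class
  (\<open>frequent_heavy\<close>).\<close>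

definition frequent :: "nat set" where
  "frequent = (\<Union>t<k. \<Union>e\<in>E. e \<inter> hv t e)"

lemma fin_cls: "finite (edge_class E f c)"
  using finE by (simp add: edge_class_def)

lemma enc_less: "e \<in> E \<Longrightarrow> set_encode (idx ` (e \<inter> X)) < 2 ^ W"
  using idx_less by (intro set_encode_less) auto

lemma code_less: "e \<in> E \<Longrightarrow> g t e < 2 ^ (t * W)"
proof (induction t)
  case (Suc t)
  let ?s = "set_encode (idx ` (e \<inter> hv t e))"
  have "g (Suc t) e < 2 ^ (t * W) * (1 + ?s)" using Suc by simp
  also have "\<dots> \<le> 2 ^ (t * W) * 2 ^ W"
    using enc_less[OF Suc.prems, of "hv t e"] by (intro mult_le_mono2) simp
  also have "\<dots> = 2 ^ (Suc t * W)" by (simp add: power_add mult.commute)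
  finally show ?case .
qed simp

lemma enc_inj:
  assumes "X \<subseteq> \<Union>E" "Y \<subseteq> \<Union>E" "set_encode (idx ` X) = set_encode (idx ` Y)"
  shows "X = Y"
proof -
  have "finite (\<Union>E)" using finE fine by auto
  then have "finite X" "finite Y" using assms finite_subset by blast+
  then have "idx ` X = idx ` Y" using assms(3) by (simp add: set_encode_eq)
  then show ?thesis using inj assms(1,2) by (simp add: inj_on_image_eq_iff)
qed

text \<open>The digits of round \<open>t\<close> start above all earlier ones, so both summands can
  be read off the sum. The two heavy sets agree because they depend on the earlier code
  only.\<close>

lemma code_Suc_eq:
  assumes "e \<in> E" "e' \<in> E" "g (Suc t) e = g (Suc t) e'"
  shows "g t e = g t e' \<and> e \<inter> hv t e = e' \<inter> hv t e"
proof -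
  have *: "g t e = g t e' \<and> set_encode (idx ` (e \<inter> hv t e)) = set_encode (idx ` (e' \<inter> hv t e'))"
    using assms code_less[of e t] code_less[of e' t]
    by (intro add_mult_cancel_less[of _ "2 ^ (t * W)"]) auto
  then have "e \<inter> hv t e = e' \<inter> hv t e'"
    using assms by (intro enc_inj) auto
  then show ?thesis using * by auto
qed

lemma code_eq_mono:
  assumes "e \<in> E" "e' \<in> E" "s \<le> t" "g t e = g t e'"
  shows "g s e = g s e'"
  using assms(3,4)
proof (induction t)
  case (Suc t)
  show ?case
  proof (cases "s = Suc t")
    case False
    have "g t e = g t e'" using code_Suc_eq[OF assms(1,2) Suc.prems(2)] by blast
    with False Suc show ?thesis by simp
  qed (use Suc in simp)
qed simp

lemma code_less_trace_eq:
  assumes "e \<in> E" "e' \<in> E" "s < t" "g t e = g t e'"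
  shows "e \<inter> hv s e = e' \<inter> hv s e"
proof -
  have "g (Suc s) e = g (Suc s) e'" using code_eq_mono[OF assms(1,2), of "Suc s" t] assms by simp
  then show ?thesis using code_Suc_eq[OF assms(1,2)] by blast
qed

lemma cls_self: "e \<in> E \<Longrightarrow> e \<in> cls t e"
  by (simp add: edge_class_def)

lemma heavy_member:
  assumes "v \<in> heavy k E f c"
  obtains e where "e \<in> edge_class E f c" "v \<in> e"
proof -
  have "edge_class E f c \<noteq> {}" "card (edge_class E f c) \<le> 2 * k * card {e\<in>edge_class E f c. v \<in> e}"
    using assms by (auto simp: heavy_def)
  moreover have "0 < card (edge_class E f c)" using calculation(1) fin_cls by (simp add: card_gt_0_iff)
  ultimately have "card {e\<in>edge_class E f c. v \<in> e} \<noteq> 0" by (metis mult_is_0 not_le)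
  then have "{e\<in>edge_class E f c. v \<in> e} \<noteq> {}" by (metis card.empty)
  then show ?thesis using that by blast
qed

lemma frequent_heavy: "\<lbrakk>t < k; e \<in> E; v \<in> hv t e\<rbrakk> \<Longrightarrow> v \<in> frequent"
proof -
  assume "t < k" "e \<in> E" and v: "v \<in> hv t e"
  obtain e' where e': "e' \<in> cls t e" "v \<in> e'" using heavy_member[OF v] .
  then have "e' \<in> E" "g t e' = g t e" by (auto simp: edge_class_def)
  then have "v \<in> e' \<inter> hv t e'" using e' v by simp
  then show ?thesis using \<open>e' \<in> E\<close> \<open>t < k\<close> unfolding frequent_def by blast
qed

text \<open>While \<open>A\<close> meets the heavy vertices of the class of \<open>e\<close>, each such round contributes a
  different element of \<open>A\<close>: a heavy vertex outside \<open>e\<close> lies in no edge of the next class.\<close>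

lemma ex_disjoint_round:
  assumes "finite A" "e \<in> E" "e \<inter> A = {}"
  shows "\<exists>t\<le>card A. A \<inter> hv t e = {}"
proof (rule ccontr)
  assume "\<not> ?thesis"
  then have "\<forall>t\<in>{..card A}. \<exists>a. a \<in> A \<inter> hv t e" by blast
  then obtain a where a: "\<And>t. t \<le> card A \<Longrightarrow> a t \<in> A \<inter> hv t e"
    by (metis atMost_iff)
  have "a s \<noteq> a t" if "s < t" "t \<le> card A" for s t
  proof
    assume eq: "a s = a t"
    have "a s \<in> A" "a s \<in> hv s e" using a[of s] that by auto
    then have "a s \<notin> e" using assms by blast
    have "a t \<in> hv t e" using a[of t] that by blast
    then obtain e' where e': "e' \<in> cls t e" "a t \<in> e'" by (rule heavy_member)
    then have "e \<inter> hv s e = e' \<inter> hv s e"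
      using assms that by (intro code_less_trace_eq) (auto simp: edge_class_def)
    moreover have "a s \<in> e' \<inter> hv s e" using e' eq \<open>a s \<in> hv s e\<close> by simp
    ultimately have "a s \<in> e \<inter> hv s e" by (simp only:)
    then show False using \<open>a s \<notin> e\<close> by simp
  qed
  then have "inj_on a {..card A}" by (intro linorder_inj_onI) auto
  then have "card {..card A} \<le> card A" using a assms(1) by (intro card_inj_on_le) auto
  then show False by simp
qed

text \<open>Each of the fewer than \<open>k\<close> vertices of \<open>A\<close> is light and meets
  less than a \<open>1 / (2 k)\<close> fraction of the class, so together they cover at most half of
  it.\<close>

lemma card_fibre:
  assumes A: "finite A" "card A < k" and e: "e \<in> E" "A \<inter> hv t e = {}"
    and S: "{e' \<in> cls t e. e' \<inter> A = {}} \<subseteq> S" and finS: "finite S"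
  shows "card (cls t e) \<le> 2 * card S"
proof -
  let ?C = "cls t e" and ?h = "\<lambda>a. {e'\<in>cls t e. a \<in> e'}"
  have ne: "?C \<noteq> {}" using e cls_self by blast
  have "?C \<subseteq> S \<union> (\<Union>a\<in>A. ?h a)" using S by blast
  then have "card ?C \<le> card (S \<union> (\<Union>a\<in>A. ?h a))"
    using finS A fin_cls by (intro card_mono) auto
  also have "\<dots> \<le> card S + (\<Sum>a\<in>A. card (?h a))"
    using card_Un_le[of S "\<Union>a\<in>A. ?h a"] card_UN_le[OF A(1), of ?h] by linarith
  finally have 1: "card ?C \<le> card S + (\<Sum>a\<in>A. card (?h a))" .
  have "2 * k * (\<Sum>a\<in>A. card (?h a)) = (\<Sum>a\<in>A. 2 * k * card (?h a))" by (rule sum_distrib_left)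
  also have "\<dots> \<le> (\<Sum>a\<in>A. card ?C)"
    using e ne by (intro sum_mono) (auto simp: heavy_def)
  also have "\<dots> \<le> k * card ?C" using A by simp
  finally have "k * (2 * (\<Sum>a\<in>A. card (?h a))) \<le> k * card ?C" by (simp only: ac_simps)
  then have "2 * (\<Sum>a\<in>A. card (?h a)) \<le> card ?C" using k_pos by simp
  then show ?thesis using 1 by linarith
qed

text \<open>Suppose \<open>v\<close> is never heavy. Group the uncovered edges by the first round in
  which \<open>A\<close> avoids the heavy vertices of their class, and by that class. A group holds
  at least half of its class, and \<open>v\<close> meets less than a \<open>1 / (2 k)\<close>
  fraction of the class, so less than a \<open>1 / k\<close> fraction of the group. Summing over the
  groups contradicts the assumed gain.\<close>

theorem large_gain_frequent:
  assumes A: "finite A" "card A < k" and ne: "residual E A > 0"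
    and le: "residual E A \<le> k * gain E A v"
  shows "v \<in> frequent"
proof (rule ccontr)
  assume v: "v \<notin> frequent"
  define R where "R = {e\<in>E. e \<inter> A = {}}"
  define \<tau> where "\<tau> e = (LEAST t. A \<inter> hv t e = {})" for e
  define \<kappa> where "\<kappa> e = (\<tau> e, g (\<tau> e) e)" for e
  have finR: "finite R" using finE by (simp add: R_def)
  have \<tau>: "\<tau> e < k \<and> A \<inter> hv (\<tau> e) e = {}" if "e \<in> R" for e
  proof -
    have "e \<in> E" "e \<inter> A = {}" using that by (simp_all add: R_def)
    from ex_disjoint_round[OF A(1) this] obtain t where t: "t \<le> card A" "A \<inter> hv t e = {}"
      by (elim exE conjE)
    have "A \<inter> hv (\<tau> e) e = {}" unfolding \<tau>_def using t(2) by (rule LeastI)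
    moreover have "\<tau> e \<le> t" unfolding \<tau>_def using t(2) by (rule Least_le)
    ultimately show ?thesis using t(1) A(2) by simp
  qed
  have fib: "k * card {e'\<in>{e'\<in>R. \<kappa> e' = y}. v \<in> e'} < card {e'\<in>R. \<kappa> e' = y}" if y: "y \<in> \<kappa> ` R" for y
  proof -
    obtain e where e: "e \<in> R" "y = \<kappa> e" using y by blast
    let ?t = "\<tau> e" and ?S = "{e'\<in>R. \<kappa> e' = y}"
    have eE: "e \<in> E" using e by (simp add: R_def)
    have "v \<notin> hv ?t e" using frequent_heavy[of ?t e v] v \<tau>[OF e(1)] eE by blast
    then have 1: "2 * k * card {e'\<in>cls ?t e. v \<in> e'} < card (cls ?t e)"
      using cls_self[OF eE, of ?t] by (auto simp: heavy_def)
    have "{e' \<in> cls ?t e. e' \<inter> A = {}} \<subseteq> ?S"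
    proof
      fix e' assume "e' \<in> {e' \<in> cls ?t e. e' \<inter> A = {}}"
      then have e': "e' \<in> R" "g ?t e' = g ?t e" by (auto simp: edge_class_def R_def)
      then have "g s e' = g s e" if "s \<le> ?t" for s
        using code_eq_mono[of e' e s ?t] that eE by (simp add: R_def)
      then have eq: "(A \<inter> hv s e' = {}) = (A \<inter> hv s e = {})" if "s \<le> ?t" for s using that by simp
      \<comment> \<open>Edges of one class share the codes of all earlier rounds, hence the heavy
        sets there and the first round that avoids \<open>A\<close>. So the group contains every
        uncovered edge of the class.\<close>
      have "\<tau> e' = ?t" unfolding \<tau>_def[of e']
      proof (rule Least_equality)
        show "A \<inter> hv ?t e' = {}" using \<tau>[OF e(1)] eq[of ?t] by simp
      next
        fix s assume s: "A \<inter> hv s e' = {}"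
        show "?t \<le> s"
        proof (rule ccontr)
          assume "\<not> ?t \<le> s"
          then have "s < ?t" by simp
          moreover from this have "A \<inter> hv s e = {}" using s eq[of s] by simp
          ultimately show False unfolding \<tau>_def using not_less_Least by blast
        qed
      qed
      then show "e' \<in> ?S" using e e' by (simp add: \<kappa>_def)
    qed
    then have 2: "card (cls ?t e) \<le> 2 * card ?S"
      using \<tau>[OF e(1)] eE A finR by (intro card_fibre[of A]) auto
    have "card {e'\<in>?S. v \<in> e'} \<le> card {e'\<in>cls ?t e. v \<in> e'}"
      using e fin_cls[of "g ?t" "g ?t e"]
      by (intro card_mono) (auto simp: \<kappa>_def edge_class_def R_def intro: finite_subset[OF _ finE])
    then have "2 * k * card {e'\<in>?S. v \<in> e'} \<le> 2 * k * card {e'\<in>cls ?t e. v \<in> e'}" by simp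
    then show ?thesis using 1 2 by linarith
  qed
  have split: "card {e\<in>R. P e} = (\<Sum>y\<in>\<kappa> ` R. card {e'\<in>{e'\<in>R. \<kappa> e' = y}. P e'})" for P
  proof -
    have "{e\<in>R. P e} = (\<Union>y\<in>\<kappa> ` R. {e'\<in>{e'\<in>R. \<kappa> e' = y}. P e'})" by blast
    also have "card \<dots> = (\<Sum>y\<in>\<kappa> ` R. card {e'\<in>{e'\<in>R. \<kappa> e' = y}. P e'})"
      using finR by (intro card_UN_disjoint) auto
    finally show ?thesis .
  qed
  have Rne: "R \<noteq> {}" using ne finR by (auto simp: residual_def R_def card_gt_0_iff)
  have "k * card {e\<in>R. v \<in> e} = (\<Sum>y\<in>\<kappa> ` R. k * card {e'\<in>{e'\<in>R. \<kappa> e' = y}. v \<in> e'})"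
    unfolding split[of "\<lambda>e. v \<in> e"] by (rule sum_distrib_left)
  also have "\<dots> < (\<Sum>y\<in>\<kappa> ` R. card {e'\<in>R. \<kappa> e' = y})"
    using fib finR Rne by (intro sum_strict_mono) auto
  also have "\<dots> = card R" using split[of "\<lambda>_. True"] by simp
  finally have "k * card {e\<in>R. v \<in> e} < card R" .
  moreover have "{e\<in>R. v \<in> e} = {e\<in>E. e \<inter> A = {} \<and> v \<in> e}" by (auto simp: R_def)
  ultimately show False using le by (simp add: residual_def gain_def R_def)
qed

end

section \<open>Counting classes and traces\<close>

lemma sum_power_le: "(\<Sum>i\<le>j. (t::nat) ^ i) \<le> (t + 1) ^ j"
proof (induction j)
  case (Suc j)
  have "t ^ j \<le> (t + 1) ^ j" by (intro power_mono) auto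
  then show ?case using Suc by (simp add: add_mono mult_le_mono2)
qed simp

lemma card_subsets_size_le:
  assumes "finite H" "card H \<le> q"
  shows "card {D. D \<subseteq> H \<and> card D = d} \<le> q ^ d"
  using n_subsets[OF assms(1), of d] binomial_le_pow2[of "card H" d]
    power_mono[OF assms(2), of d] assms
  by (metis binomial_eq_0 binomial_le_pow le_trans le0 not_le)

lemma card_bounded_subsets_le:
  assumes "finite H" "card H \<le> q"
  shows "card {D. D \<subseteq> H \<and> card D \<le> d} \<le> (q + 1) ^ d"
proof -
  have "{D. D \<subseteq> H \<and> card D \<le> d} = (\<Union>i\<le>d. {D. D \<subseteq> H \<and> card D = i})" by auto
  then have "card {D. D \<subseteq> H \<and> card D \<le> d} \<le> (\<Sum>i\<le>d. card {D. D \<subseteq> H \<and> card D = i})"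
    using card_UN_le[of "{..d}" "\<lambda>i. {D. D \<subseteq> H \<and> card D = i}"] by simp
  also have "\<dots> \<le> (\<Sum>i\<le>d. q ^ i)" using assms by (intro sum_mono card_subsets_size_le)
  also have "\<dots> \<le> (q + 1) ^ d" by (rule sum_power_le)
  finally show ?thesis .
qed

lemma sum_incidence_le:
  assumes "finite C" "finite H" "\<And>e. e \<in> C \<Longrightarrow> finite e \<and> card e \<le> r"
  shows "(\<Sum>v\<in>H. card {e\<in>C. v \<in> e}) \<le> r * card C"
proof -
  have "(\<Sum>v\<in>H. card {e\<in>C. v \<in> e}) = (\<Sum>v\<in>H. \<Sum>e\<in>C. if v \<in> e then 1 else 0)"
    by (intro sum.cong refl) (simp only: card_eq_sum sum.inter_filter[OF assms(1)])
  also have "\<dots> = (\<Sum>e\<in>C. \<Sum>v\<in>H. if v \<in> e then 1 else 0)" by (rule sum.swap)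
  also have "\<dots> = (\<Sum>e\<in>C. card (e \<inter> H))"
    by (intro sum.cong refl) (simp only: card_eq_sum Int_commute[of _ H] sum.inter_restrict[OF assms(2)])
  also have "\<dots> \<le> (\<Sum>e\<in>C. r)"
  proof (rule sum_mono)
    fix e assume "e \<in> C"
    then show "card (e \<inter> H) \<le> r" using assms(3)[of e] card_mono[of e "e \<inter> H"] by simp
  qed
  finally show ?thesis by (simp add: mult.commute)
qed

context refinement
begin

lemma finite_heavy: "finite (heavy k E f c)"
proof (rule finite_subset)
  show "heavy k E f c \<subseteq> \<Union>E"
  proof
    fix v assume "v \<in> heavy k E f c"
    then obtain e where "e \<in> edge_class E f c" "v \<in> e" by (rule heavy_member)
    then show "v \<in> \<Union>E" by (auto simp: edge_class_def)
  qed
  show "finite (\<Union>E)" using finE fine by auto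
qed

lemma card_heavy_le: "card (heavy k E f c) \<le> 2 * r * k"
proof (cases "edge_class E f c = {}")
  case False
  let ?C = "edge_class E f c"
  have pos: "0 < card ?C" using False fin_cls by (simp add: card_gt_0_iff)
  have "card (heavy k E f c) * card ?C = (\<Sum>v\<in>heavy k E f c. card ?C)" by simp
  also have "\<dots> \<le> (\<Sum>v\<in>heavy k E f c. 2 * k * card {e\<in>?C. v \<in> e})"
    by (intro sum_mono) (simp add: heavy_def)
  also have "\<dots> = 2 * k * (\<Sum>v\<in>heavy k E f c. card {e\<in>?C. v \<in> e})" by (rule sum_distrib_left[symmetric])
  also have "\<dots> \<le> 2 * k * (r * card ?C)"
    using finite_heavy fin_cls fine card_le
    by (intro mult_le_mono2 sum_incidence_le) (auto simp: edge_class_def)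
  finally have "card (heavy k E f c) * card ?C \<le> (2 * r * k) * card ?C" by (simp add: ac_simps)
  then show ?thesis using pos by simp
qed (simp add: heavy_def)

text \<open>Only the preceding round is recorded: by \<open>trace_mono\<close> its trace contains
  those of all earlier rounds, so its size controls the whole history.\<close>

definition trace :: "nat \<Rightarrow> nat set \<Rightarrow> nat set" where
  "trace t e = (case t of 0 \<Rightarrow> {} | Suc s \<Rightarrow> e \<inter> hv s e)"

lemma trace_subset: "trace t e \<subseteq> e"
  by (auto simp: trace_def split: nat.split)

text \<open>Refinement puts a traced vertex into every edge of the new class, and a vertex common to
  a whole class is heavy in it.\<close>

lemma trace_subset_heavy:
  assumes "e \<in> E" shows "trace t e \<subseteq> hv t e"
proof
  fix v assume v: "v \<in> trace t e"
  then obtain s where s: "t = Suc s" "v \<in> e" "v \<in> hv s e"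
    by (auto simp: trace_def split: nat.splits)
  have "v \<in> e'" if "e' \<in> cls t e" for e'
  proof -
    have "e \<inter> hv s e = e' \<inter> hv s e" using that assms s(1)
      by (intro code_less_trace_eq[of _ _ _ t]) (simp_all add: edge_class_def del: code.simps)
    then show ?thesis using s by blast
  qed
  then have "{e'\<in>cls t e. v \<in> e'} = cls t e" by blast
  then show "v \<in> hv t e" using cls_self[OF assms, of t] k_pos by (auto simp: heavy_def)
qed

lemma trace_eq:
  assumes "e \<in> E" "e' \<in> E" "g t e = g t e'" shows "trace t e = trace t e'"
proof (cases t)
  case (Suc s)
  have "g s e = g s e'" using code_Suc_eq assms Suc by blast
  then show ?thesis using code_Suc_eq[of e e' s] assms Suc by (simp add: trace_def del: code.simps)
qed (simp add: trace_def)

lemma trace_mono: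
  assumes "e \<in> E" shows "trace t e \<subseteq> trace (Suc t) e"
  using trace_subset[of t e] trace_subset_heavy[OF assms, of t] by (auto simp: trace_def[of "Suc t"])

text \<open>A code of round \<open>Suc t\<close> is fixed by the previous code, with a trace of some
  size \<open>i\<close>, and by \<open>j - i\<close> further vertices among at most
  \<open>2 * r * k\<close> heavy ones. Keeping the trace size \<open>j\<close> as a parameter makes
  the sum over \<open>i\<close> collapse by \<open>sum_power_le\<close>.\<close>

lemma card_codes_size:
  "card (g t ` {e\<in>E. card (trace t e) = j}) \<le> (t * (2 * r * k)) ^ j"
proof (induction t arbitrary: j)
  case 0
  show ?case
  proof (cases j)
    case 0
    have "g 0 ` {e\<in>E. card (trace 0 e) = j} \<subseteq> {0}" by auto
    then show ?thesis using 0 card_mono[of "{0::nat}"] by fastforce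
  qed (simp add: trace_def)
next
  case (Suc t)
  let ?q = "2 * r * k"
  let ?P = "\<lambda>t j. {e\<in>E. card (trace t e) = j}"
  \<comment> \<open>A code determines the trace, so any edge with code \<open>c\<close> recovers it,
    and \<open>F\<close> depends on \<open>c\<close> and \<open>D\<close> alone.\<close>
  define pick where "pick c = (SOME e. e \<in> E \<and> g t e = c)" for c
  define F where "F c D = c + 2 ^ (t * W) * set_encode (idx ` (trace t (pick c) \<union> D))" for c D
  define Ds where "Ds c i = {D. D \<subseteq> heavy k E (g t) c \<and> card D = j - i}" for c i
  have fin: "finite (?P t i)" for i t using finE by simp
  have finDs: "finite (Ds c i)" for c i
    using finite_heavy by (auto simp: Ds_def intro: finite_subset[of _ "Pow (heavy k E (g t) c)"])
  have "g (Suc t) ` ?P (Suc t) j \<subseteq> (\<Union>i\<le>j. \<Union>c\<in>g t ` ?P t i. F c ` Ds c i)"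
  proof (rule image_subsetI)
    fix e assume "e \<in> ?P (Suc t) j"
    then have e: "e \<in> E" "card (trace (Suc t) e) = j" by auto
    define D where "D = trace (Suc t) e - trace t e"
    have fT: "finite (trace (Suc t) e)" using trace_subset fine[OF e(1)] finite_subset by blast
    have un: "trace t e \<union> D = trace (Suc t) e" using trace_mono[OF e(1)] by (auto simp: D_def)
    have ci: "card (trace t e) \<le> j" using trace_mono[OF e(1)] fT e(2) card_mono by blast
    have cD: "card D = j - card (trace t e)"
      using e(2) card_Diff_subset[OF finite_subset[OF trace_mono[OF e(1)] fT] trace_mono[OF e(1)]]
      by (simp add: D_def)
    have "pick (g t e) \<in> E \<and> g t (pick (g t e)) = g t e"
      unfolding pick_def by (rule someI[of _ e]) (use e in simp)
    then have tp: "trace t (pick (g t e)) = trace t e" using trace_eq e(1) by blast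
    have "g (Suc t) e = F (g t e) D" unfolding F_def tp un by (simp add: trace_def)
    moreover have "D \<in> Ds (g t e) (card (trace t e))"
      using cD by (auto simp: Ds_def D_def trace_def)
    ultimately show "g (Suc t) e \<in> (\<Union>i\<le>j. \<Union>c\<in>g t ` ?P t i. F c ` Ds c i)"
      using e ci by (intro UN_I[of "card (trace t e)"] UN_I[of "g t e"]) auto
  qed
  then have "card (g (Suc t) ` ?P (Suc t) j) \<le> card (\<Union>i\<le>j. \<Union>c\<in>g t ` ?P t i. F c ` Ds c i)"
    using finDs fin by (intro card_mono) auto
  also have "\<dots> \<le> (\<Sum>i\<le>j. card (\<Union>c\<in>g t ` ?P t i. F c ` Ds c i))" by (rule card_UN_le) simp
  also have "\<dots> \<le> (\<Sum>i\<le>j. (t * ?q) ^ i * ?q ^ (j - i))"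
  proof (rule sum_mono)
    fix i
    have "card (\<Union>c\<in>g t ` ?P t i. F c ` Ds c i) \<le> (\<Sum>c\<in>g t ` ?P t i. card (F c ` Ds c i))"
      using fin by (intro card_UN_le) simp
    also have "\<dots> \<le> (\<Sum>c\<in>g t ` ?P t i. ?q ^ (j - i))"
    proof (rule sum_mono)
      fix c
      have "card (F c ` Ds c i) \<le> card (Ds c i)" using finDs by (rule card_image_le)
      also have "\<dots> \<le> ?q ^ (j - i)" unfolding Ds_def
        using finite_heavy card_heavy_le by (rule card_subsets_size_le)
      finally show "card (F c ` Ds c i) \<le> ?q ^ (j - i)" .
    qed
    also have "\<dots> \<le> (t * ?q) ^ i * ?q ^ (j - i)" using Suc by simp
    finally show "card (\<Union>c\<in>g t ` ?P t i. F c ` Ds c i) \<le> (t * ?q) ^ i * ?q ^ (j - i)" .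
  qed
  also have "\<dots> = (\<Sum>i\<le>j. t ^ i * ?q ^ j)"
  proof (rule sum.cong)
    fix i assume "i \<in> {..j}"
    then have "?q ^ i * ?q ^ (j - i) = ?q ^ j" by (simp flip: power_add)
    then show "(t * ?q) ^ i * ?q ^ (j - i) = t ^ i * ?q ^ j"
      by (simp only: power_mult_distrib mult.assoc)
  qed simp
  also have "\<dots> = (\<Sum>i\<le>j. t ^ i) * ?q ^ j" by (rule sum_distrib_right[symmetric])
  also have "\<dots> \<le> (t + 1) ^ j * ?q ^ j" by (intro mult_le_mono1 sum_power_le)
  also have "\<dots> = (Suc t * ?q) ^ j" by (simp only: power_mult_distrib Suc_eq_plus1)
  finally show ?case .
qed

lemma card_codes: "card (g t ` E) \<le> (t * (2 * r * k) + 1) ^ r"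
proof -
  have "card (trace t e) \<le> r" if "e \<in> E" for e
    using card_mono[OF fine[OF that] trace_subset] card_le[OF that] le_trans by blast
  then have "g t ` E = (\<Union>j\<le>r. g t ` {e\<in>E. card (trace t e) = j})" by auto
  then have "card (g t ` E) \<le> (\<Sum>j\<le>r. card (g t ` {e\<in>E. card (trace t e) = j}))"
    using card_UN_le[of "{..r}" "\<lambda>j. g t ` {e\<in>E. card (trace t e) = j}"] by simp
  also have "\<dots> \<le> (\<Sum>j\<le>r. (t * (2 * r * k)) ^ j)" by (intro sum_mono card_codes_size)
  also have "\<dots> \<le> (t * (2 * r * k) + 1) ^ r" by (rule sum_power_le)
  finally show ?thesis .
qed

lemma finite_frequent: "finite frequent"
  unfolding frequent_def using finE fine by auto

lemma frequent_subset: "frequent \<subseteq> \<Union>E"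
  unfolding frequent_def by auto

text \<open>The \<open>+ 1\<close> makes the left side the base that counts bounded subsets in
  \<open>card_traces\<close>. It is free: with \<open>x = k * (2 * r * k)\<close>, adding
  \<open>(x + 1) ^ r\<close> to \<open>(x + 1) ^ r * x\<close> gives the next power.\<close>

lemma card_frequent: "card frequent + 1 \<le> (2 * r * k * k + 1) ^ (r + 1)"
proof -
  let ?q = "2 * r * k"
  have "frequent \<subseteq> (\<Union>t<k. \<Union>c\<in>g t ` E. heavy k E (g t) c)" unfolding frequent_def by blast
  then have "card frequent \<le> card (\<Union>t<k. \<Union>c\<in>g t ` E. heavy k E (g t) c)"
    using finE finite_heavy by (intro card_mono) auto
  also have "\<dots> \<le> (\<Sum>t<k. card (\<Union>c\<in>g t ` E. heavy k E (g t) c))" by (rule card_UN_le) simp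
  also have "\<dots> \<le> (\<Sum>t<k. (k * ?q + 1) ^ r * ?q)"
  proof (rule sum_mono)
    fix t assume "t \<in> {..<k}"
    have "card (\<Union>c\<in>g t ` E. heavy k E (g t) c) \<le> (\<Sum>c\<in>g t ` E. card (heavy k E (g t) c))"
      using finE by (intro card_UN_le) simp
    also have "\<dots> \<le> (\<Sum>c\<in>g t ` E. ?q)" by (intro sum_mono card_heavy_le)
    also have "\<dots> = card (g t ` E) * ?q" by simp
    also have "\<dots> \<le> (t * ?q + 1) ^ r * ?q" by (intro mult_le_mono1 card_codes)
    also have "\<dots> \<le> (k * ?q + 1) ^ r * ?q"
      using \<open>t \<in> {..<k}\<close> by (intro mult_le_mono1 power_mono add_mono mult_le_mono1) auto
    finally show "card (\<Union>c\<in>g t ` E. heavy k E (g t) c) \<le> (k * ?q + 1) ^ r * ?q" .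
  qed
  also have "\<dots> = (k * ?q + 1) ^ r * (k * ?q)" by (simp add: ac_simps)
  finally have "card frequent + 1 \<le> (k * ?q + 1) ^ r * (k * ?q) + (k * ?q + 1) ^ r"
    using one_le_power[of "k * ?q + 1" r] by linarith
  also have "\<dots> = (k * ?q + 1) ^ (r + 1)" by (simp add: algebra_simps)
  finally show ?thesis by (simp only: ac_simps)
qed

lemma card_traces:
  "card ((\<lambda>e. e \<inter> frequent) ` E) \<le> (2 * r * k * k + 1) ^ ((r + 1) * r)"
proof -
  have "(\<lambda>e. e \<inter> frequent) ` E \<subseteq> {D. D \<subseteq> frequent \<and> card D \<le> r}"
  proof (rule image_subsetI)
    fix e assume "e \<in> E"
    then have "card (e \<inter> frequent) \<le> r"
      using card_mono[OF fine, of e "e \<inter> frequent"] card_le[of e] by simp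
    then show "e \<inter> frequent \<in> {D. D \<subseteq> frequent \<and> card D \<le> r}" by simp
  qed
  then have "card ((\<lambda>e. e \<inter> frequent) ` E) \<le> card {D. D \<subseteq> frequent \<and> card D \<le> r}"
    using finite_frequent by (intro card_mono) auto
  also have "\<dots> \<le> (card frequent + 1) ^ r"
    using finite_frequent by (intro card_bounded_subsets_le) auto
  also have "\<dots> \<le> ((2 * r * k * k + 1) ^ (r + 1)) ^ r" using card_frequent by (intro power_mono) auto
  finally show ?thesis by (simp only: power_mult)
qed

end

section \<open>The search tree\<close>

definition prefix_cost :: "nat set set \<Rightarrow> nat list \<Rightarrow> nat" where
  "prefix_cost E A = (\<Sum>j<length A. residual E (set (take j A)))"

lemma residual_0_iff: "finite E \<Longrightarrow> residual E A = 0 \<longleftrightarrow> (\<forall>e\<in>E. e \<inter> A \<noteq> {})"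
  by (auto simp: residual_def)

lemma gain_mono: "finite E \<Longrightarrow> A \<subseteq> B \<Longrightarrow> gain E B v \<le> gain E A v"
  unfolding gain_def by (intro card_mono) auto

lemma residual_insert: "finite E \<Longrightarrow> residual E A = residual E (insert v A) + gain E A v"
proof -
  assume fin: "finite E"
  have "{e\<in>E. e \<inter> A = {}} = {e\<in>E. e \<inter> insert v A = {}} \<union> {e\<in>E. e \<inter> A = {} \<and> v \<in> e}" by auto
  moreover have "card ({e\<in>E. e \<inter> insert v A = {}} \<union> {e\<in>E. e \<inter> A = {} \<and> v \<in> e}) =
      card {e\<in>E. e \<inter> insert v A = {}} + card {e\<in>E. e \<inter> A = {} \<and> v \<in> e}"
    using fin by (intro card_Un_disjoint) auto
  ultimately show ?thesis by (simp add: residual_def gain_def)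
qed

text \<open>An edge first hit at index \<open>i\<close> is missed exactly by the prefixes of lengths
  \<open>0, \<dots>, i\<close>. Their number \<open>Suc i\<close> is its position counted from 1,
  and exchanging the two sums gives the prefix cost.\<close>

lemma ordering_cost_enumeration:
  assumes fin: "finite E" and dist: "distinct A" and cov: "\<forall>e\<in>E. e \<inter> set A \<noteq> {}"
    and \<pi>: "\<And>i. i < length A \<Longrightarrow> \<pi> (A ! i) = Suc i"
  shows "ordering_cost E (set A) \<pi> = prefix_cost E A"
proof -
  have Min_eq: "Min (\<pi> ` (e \<inter> set A)) = (\<Sum>j<length A. if e \<inter> set (take j A) = {} then 1 else 0)"
    if e: "e \<in> E" for e
  proof -
    define i where "i = (LEAST i. i < length A \<and> A ! i \<in> e)"
    have "\<exists>i. i < length A \<and> A ! i \<in> e" using cov e by (fastforce simp: in_set_conv_nth)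
    then have i: "i < length A" "A ! i \<in> e" unfolding i_def by (metis (mono_tags, lifting) LeastI)+
    have least: "i \<le> j" if "j < length A" "A ! j \<in> e" for j
      unfolding i_def using that by (intro Least_le) simp
    have "{j. j < length A \<and> e \<inter> set (take j A) = {}} = {..i}"
    proof safe
      fix j assume "j < length A" and d: "e \<inter> set (take j A) = {}"
      show "j \<le> i"
      proof (rule ccontr)
        assume "\<not> j \<le> i"
        then have "A ! i \<in> set (take j A)" using i(1) by (auto simp: in_set_conv_nth intro!: exI[of _ i])
        then show False using d i(2) by blast
      qed
    next
      fix j v assume "j \<le> i" "v \<in> e" "v \<in> set (take j A)"
      then obtain l where "l < j" "l < length A" "v = A ! l" by (auto simp: in_set_conv_nth)
      then show "v \<in> {}" using least[of l] \<open>j \<le> i\<close> \<open>v \<in> e\<close> by simp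
    qed (use i in simp)
    then have "(\<Sum>j<length A. if e \<inter> set (take j A) = {} then 1 else 0) = Suc i"
      by (simp add: sum.If_cases lessThan_def Collect_conj_eq[symmetric])
    moreover have "Min (\<pi> ` (e \<inter> set A)) = Suc i"
    proof (rule Min_eqI)
      show "Suc i \<in> \<pi> ` (e \<inter> set A)" using i \<pi> by (intro image_eqI[of _ _ "A ! i"]) auto
      fix y assume "y \<in> \<pi> ` (e \<inter> set A)"
      then obtain l where "l < length A" "A ! l \<in> e" "y = \<pi> (A ! l)" by (auto simp: in_set_conv_nth)
      then show "Suc i \<le> y" using least \<pi> by auto
    qed simp
    ultimately show ?thesis by simp
  qed
  have "ordering_cost E (set A) \<pi> = (\<Sum>e\<in>E. \<Sum>j<length A. if e \<inter> set (take j A) = {} then 1 else 0)"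
    unfolding ordering_cost_def by (intro sum.cong refl Min_eq)
  also have "\<dots> = (\<Sum>j<length A. \<Sum>e\<in>E. if e \<inter> set (take j A) = {} then 1 else 0)" by (rule sum.swap)
  also have "\<dots> = prefix_cost E A"
    unfolding prefix_cost_def residual_def
    by (intro sum.cong refl) (simp only: card_eq_sum sum.inter_filter[OF fin])
  finally show ?thesis .
qed

section \<open>Ordered covers as lists, and the search tree\<close>

lemma has_cheap_cover_iff_list:
  assumes "hypergraph V E" "finite E"
  shows "has_cheap_cover V E k w \<longleftrightarrow>
    (\<exists>A. distinct A \<and> set A \<subseteq> V \<and> residual E (set A) = 0 \<and> int (length A) \<le> k \<and>
         int (prefix_cost E A) \<le> w)"
proof
  assume "has_cheap_cover V E k w"
  then obtain S \<pi> where S: "S \<subseteq> V" "\<forall>e\<in>E. e \<inter> S \<noteq> {}" "int (card S) \<le> k"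
      "bij_betw \<pi> S {1..card S}" "int (ordering_cost E S \<pi>) \<le> w"
    by (auto simp: has_cheap_cover_def set_cover_def)
  define \<rho> where "\<rho> = inv_into S \<pi>"
  have \<rho>: "bij_betw \<rho> {1..card S} S" unfolding \<rho>_def using S(4) by (rule bij_betw_inv_into)
  define A where "A = map \<rho> [1..<Suc (card S)]"
  have set_A: "set A = S"
  proof -
    have "{1..<Suc (card S)} = {1..card S}" by auto
    then show ?thesis using bij_betw_imp_surj_on[OF \<rho>] by (simp add: A_def del: upt_Suc)
  qed
  moreover have "{Suc 0..<Suc (card S)} = {1..card S}" by auto
  then have dist: "distinct A" using bij_betw_imp_inj_on[OF \<rho>] by (simp add: A_def distinct_map del: upt_Suc)
  moreover have len: "length A = card S" by (simp add: A_def)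
  moreover have "\<pi> (A ! i) = Suc i" if "i < length A" for i
  proof -
    have "A ! i = \<rho> (Suc i)" using that by (simp add: A_def del: upt_Suc)
    then show ?thesis
      using bij_betw_inv_into_right[OF S(4), of "Suc i"] that len by (simp add: \<rho>_def)
  qed
  then have "ordering_cost E (set A) \<pi> = prefix_cost E A"
    using dist S(2) set_A assms(2) by (intro ordering_cost_enumeration) auto
  ultimately show "\<exists>A. distinct A \<and> set A \<subseteq> V \<and> residual E (set A) = 0 \<and> int (length A) \<le> k \<and>
         int (prefix_cost E A) \<le> w"
    using S residual_0_iff[OF assms(2)] by (intro exI[of _ A]) auto
next
  assume "\<exists>A. distinct A \<and> set A \<subseteq> V \<and> residual E (set A) = 0 \<and> int (length A) \<le> k \<and>
         int (prefix_cost E A) \<le> w"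
  then obtain A where A: "distinct A" "set A \<subseteq> V" "\<forall>e\<in>E. e \<inter> set A \<noteq> {}" "int (length A) \<le> k"
         "int (prefix_cost E A) \<le> w" using residual_0_iff[OF assms(2)] by auto
  define \<pi> where "\<pi> = (\<lambda>v. Suc (inv_into {..<length A} ((!) A) v))"
  have inj: "inj_on ((!) A) {..<length A}" using A(1) by (simp add: inj_on_nth)
  have \<pi>: "\<pi> (A ! i) = Suc i" if "i < length A" for i
    using inv_into_f_f[OF inj, of i] that by (simp add: \<pi>_def)
  have "inj_on \<pi> (set A)" using \<pi> by (intro inj_onI) (metis in_set_conv_nth nat.inject)
  moreover have "\<pi> ` set A = {1..card (set A)}"
  proof -
    have "set A = (!) A ` {..<length A}" by (auto simp: set_conv_nth)
    then have "\<pi> ` set A = Suc ` {..<length A}" using \<pi> by (simp add: image_image)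
    then show ?thesis using A(1) by (simp add: distinct_card image_Suc_lessThan)
  qed
  ultimately have "bij_betw \<pi> (set A) {1..card (set A)}" by (simp add: bij_betw_def)
  moreover have "ordering_cost E (set A) \<pi> = prefix_cost E A"
    using A assms(2) \<pi> by (intro ordering_cost_enumeration) auto
  ultimately show "has_cheap_cover V E k w"
    using A unfolding has_cheap_cover_def set_cover_def
    by (intro exI[of _ "set A"] exI[of _ \<pi>]) (simp add: distinct_card)
qed

text \<open>The fraction \<open>1 / (k - length A)\<close> is multiplied out. Truncated subtraction
  then leaves lists of length \<open>k\<close> without children, and covers are leaves because their
  residual is 0.\<close>

definition expand :: "nat \<Rightarrow> nat set set \<Rightarrow> nat list \<Rightarrow> nat list \<Rightarrow> nat list list" where
  "expand k E us A = map (\<lambda>v. A @ [v]) (filter (\<lambda>v. 0 < residual E (set A) \<and>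
     residual E (set A) \<le> gain E (set A) v * (k - length A)) us)"

inductive_set search_tree :: "nat \<Rightarrow> nat set set \<Rightarrow> nat list \<Rightarrow> nat list set"
  for k :: nat and E :: "nat set set" and us :: "nat list" where
  root: "[] \<in> search_tree k E us"
| child: "A \<in> search_tree k E us \<Longrightarrow> B \<in> set (expand k E us A) \<Longrightarrow> B \<in> search_tree k E us"

lemma search_tree_props:
  assumes "A \<in> search_tree k E us"
  shows "distinct A \<and> set A \<subseteq> set us \<and> length A \<le> k"
  using assms
proof induction
  case (child A B)
  then obtain v where v: "B = A @ [v]" "v \<in> set us" "0 < residual E (set A)"
      "residual E (set A) \<le> gain E (set A) v * (k - length A)"
    by (auto simp: expand_def)
  have "gain E (set A) v * (k - length A) \<noteq> 0" using v(3,4) by linarith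
  then have "gain E (set A) v \<noteq> 0" "length A < k" by simp_all
  have "v \<notin> set A"
  proof
    assume "v \<in> set A"
    then have "{e\<in>E. e \<inter> set A = {} \<and> v \<in> e} = {}" by auto
    then have "gain E (set A) v = 0" unfolding gain_def by (simp only: card.empty)
    then show False using \<open>gain E (set A) v \<noteq> 0\<close> by simp
  qed
  then show ?case using child v \<open>length A < k\<close> by simp
qed simp

section \<open>Exchange argument for a cheapest order\<close>

lemma swap_nth_set_take:
  fixes A :: "'a list"
  assumes "Suc i < length A"
  defines "B \<equiv> A[i := A ! Suc i, Suc i := A ! i]"
  shows "j \<noteq> Suc i \<Longrightarrow> set (take j B) = set (take j A)"
    and "set (take (Suc i) B) = insert (A ! Suc i) (set (take i A))"
    and "set B = set A" "distinct B = distinct A"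
proof -
  show "set B = set A" "distinct B = distinct A"
    using assms by (simp_all add: set_swap distinct_swap)
  show "set (take (Suc i) B) = insert (A ! Suc i) (set (take i A))"
    using assms by (simp add: take_Suc_conv_app_nth)
  show "set (take j B) = set (take j A)" if "j \<noteq> Suc i"
  proof (cases "j \<le> i")
    case False
    then have "take j B = (take j A)[i := take j A ! Suc i, Suc i := take j A ! i]"
      using that assms by (simp add: take_update_swap)
    moreover have "Suc i < length (take j A)" using False that assms by simp
    ultimately show ?thesis by (simp only: set_swap Suc_lessD)
  qed (simp add: B_def)
qed

text \<open>Swapping two neighbours changes a single summand of the cost, so in a cheapest order the gains
  never increase.\<close>

lemma cheapest_gain_step:
  assumes fin: "finite E" and i: "Suc i < length A"
    and min: "\<And>B. set B = set A \<Longrightarrow> distinct B = distinct A \<Longrightarrow> length B = length A \<Longrightarrow>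
      prefix_cost E A \<le> prefix_cost E B"
  shows "gain E (set (take (Suc i) A)) (A ! Suc i) \<le> gain E (set (take i A)) (A ! i)"
proof -
  define B where "B = A[i := A ! Suc i, Suc i := A ! i]"
  note sw = swap_nth_set_take[OF i, folded B_def]
  have lenB: "length B = length A" by (simp add: B_def)
  have rest: "(\<Sum>j\<in>{..<length A} - {Suc i}. residual E (set (take j B))) =
      (\<Sum>j\<in>{..<length A} - {Suc i}. residual E (set (take j A)))"
    by (intro sum.cong refl) (simp add: sw(1))
  have "prefix_cost E X = residual E (set (take (Suc i) X)) +
      (\<Sum>j\<in>{..<length A} - {Suc i}. residual E (set (take j X)))" if "length X = length A" for X
    unfolding prefix_cost_def that by (rule sum.remove) (use i in auto)
  from this[of A] this[of B] min[of B] sw(3,4) lenB rest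
  have "residual E (set (take (Suc i) A)) \<le> residual E (set (take (Suc i) B))" by simp
  moreover have "set (take (Suc i) A) = insert (A ! i) (set (take i A))"
    using i by (simp add: take_Suc_conv_app_nth)
  moreover have "residual E (set (take i A)) = residual E (insert (A ! i) (set (take i A))) + gain E (set (take i A)) (A ! i)"
    "residual E (set (take i A)) = residual E (insert (A ! Suc i) (set (take i A))) + gain E (set (take i A)) (A ! Suc i)"
    using residual_insert[OF fin] by blast+
  moreover have "gain E (set (take (Suc i) A)) (A ! Suc i) \<le> gain E (set (take i A)) (A ! Suc i)"
    by (intro gain_mono fin) (simp add: set_take_subset_set_take)
  ultimately show ?thesis using sw(2) by simp
qed

text \<open>The residual is the sum of the \<open>length A - i\<close> gains still to come, none of
  which exceeds the current one. The induction therefore runs from the end of the list.\<close>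

lemma residual_le_remaining_gain:
  assumes fin: "finite E"
    and step: "\<And>i. Suc i < length A \<Longrightarrow>
      gain E (set (take (Suc i) A)) (A ! Suc i) \<le> gain E (set (take i A)) (A ! i)"
    and "residual E (set A) = 0" "i < length A"
  shows "residual E (set (take i A)) \<le> (length A - i) * gain E (set (take i A)) (A ! i)"
  using assms(4)
proof (induction "length A - Suc i" arbitrary: i)
  case 0
  then have "take (Suc i) A = A" by simp
  then have "set A = insert (A ! i) (set (take i A))"
    using 0 by (metis take_Suc_conv_app_nth set_append list.simps(15) Un_insert_right sup_bot_right empty_set)
  then show ?case
    using 0 residual_insert[OF fin, of "set (take i A)" "A ! i"] assms(3) by (simp add: Suc_le_eq)
next
  case (Suc n)
  then have i: "Suc i < length A" by simp
  have "residual E (set (take i A)) =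
      residual E (set (take (Suc i) A)) + gain E (set (take i A)) (A ! i)"
    using residual_insert[OF fin, of "set (take i A)" "A ! i"] i by (simp add: take_Suc_conv_app_nth)
  also have "\<dots> \<le> (length A - Suc i) * gain E (set (take (Suc i) A)) (A ! Suc i) + gain E (set (take i A)) (A ! i)"
    using Suc.hyps i by simp
  also have "\<dots> \<le> (length A - Suc i) * gain E (set (take i A)) (A ! i) + gain E (set (take i A)) (A ! i)"
    using step[OF i] by simp
  also have "\<dots> = (length A - i) * gain E (set (take i A)) (A ! i)"
    using i by (metis Suc_diff_Suc Suc_lessD add.commute mult_Suc)
  finally show ?case .
qed

context refinement
begin

text \<open>A cover that is cheapest among all covers of at most \<open>k\<close> vertices has
  decreasing gains, whatever \<open>w\<close> is, so its vertices pass the test of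
  \<open>expand\<close>, and by \<open>large_gain_frequent\<close> they are listed in
  \<open>us\<close>.\<close>

theorem has_cheap_cover_iff_search_tree:
  assumes H: "hypergraph V E" and us: "set us = frequent"
  shows "has_cheap_cover V E (int k) w \<longleftrightarrow>
    (\<exists>A\<in>search_tree k E us. residual E (set A) = 0 \<and> int (prefix_cost E A) \<le> w)"
proof
  assume "\<exists>A\<in>search_tree k E us. residual E (set A) = 0 \<and> int (prefix_cost E A) \<le> w"
  then obtain A where A: "A \<in> search_tree k E us" "residual E (set A) = 0" "int (prefix_cost E A) \<le> w"
    by blast
  moreover have "\<Union>E \<subseteq> V" using H by (auto simp: hypergraph_def)
  ultimately show "has_cheap_cover V E (int k) w"
    using search_tree_props[OF A(1)] us frequent_subset
    unfolding has_cheap_cover_iff_list[OF H finE] by (intro exI[of _ A] conjI) (simp_all, blast)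
next
  assume "has_cheap_cover V E (int k) w"
  define Q where "Q A \<longleftrightarrow> distinct A \<and> set A \<subseteq> V \<and> residual E (set A) = 0 \<and> length A \<le> k" for A
  obtain A0 where A0: "Q A0" "int (prefix_cost E A0) \<le> w"
    using \<open>has_cheap_cover V E (int k) w\<close> unfolding has_cheap_cover_iff_list[OF H finE] Q_def by auto
  obtain A where A: "Q A" and min: "\<And>B. Q B \<Longrightarrow> prefix_cost E A \<le> prefix_cost E B"
    using ex_has_least_nat[of Q A0 "prefix_cost E"] A0(1) by blast
  have "prefix_cost E A \<le> prefix_cost E B"
    if "set B = set A" "distinct B = distinct A" "length B = length A" for B
    using min[of B] that A by (simp add: Q_def)
  note step = cheapest_gain_step[OF finE _ this]
  \<comment> \<open>Covers have no children, so the list is cut at its first covering prefix. This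
    does not raise the cost.\<close>
  define i0 where "i0 = (LEAST i. residual E (set (take i A)) = 0)"
  have z: "residual E (set (take (length A) A)) = 0" using A by (simp add: Q_def)
  have i0: "residual E (set (take i0 A)) = 0" "i0 \<le> length A"
    unfolding i0_def using LeastI[of "\<lambda>i. residual E (set (take i A)) = 0", OF z]
      Least_le[of "\<lambda>i. residual E (set (take i A)) = 0", OF z] by blast+
  have pos: "0 < residual E (set (take i A))" if "i < i0" for i
    using not_less_Least[of i "\<lambda>i. residual E (set (take i A)) = 0"] that by (simp add: i0_def)
  have "take i A \<in> search_tree k E us" if "i \<le> i0" for i
    using that
  proof (induction i)
    case (Suc i)
    let ?S = "set (take i A)" and ?v = "A ! i"
    have i: "i < length A" using Suc i0 by simp
    have len: "length A \<le> k" "distinct A" "residual E (set A) = 0" using A by (auto simp: Q_def)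
    have "residual E ?S \<le> (length A - i) * gain E ?S ?v"
    proof (rule residual_le_remaining_gain[OF finE _ len(3) i])
      show "gain E (set (take (Suc j) A)) (A ! Suc j) \<le> gain E (set (take j A)) (A ! j)"
        if "Suc j < length A" for j using that by (rule step)
    qed
    also have "\<dots> \<le> (k - i) * gain E ?S ?v" using len by (intro mult_le_mono1) simp
    finally have le: "residual E ?S \<le> (k - i) * gain E ?S ?v" .
    have "card ?S < k" using card_length[of "take i A"] i len by simp
    moreover have "residual E ?S \<le> k * gain E ?S ?v"
      using le_trans[OF le mult_le_mono1[OF diff_le_self]] .
    ultimately have "?v \<in> frequent" using pos[of i] Suc by (intro large_gain_frequent[of ?S]) auto
    then have "take i A @ [?v] \<in> set (expand k E us (take i A))"
      using us le pos[of i] Suc i by (simp add: expand_def mult.commute)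
    then show ?case using search_tree.child[OF Suc.IH] Suc i by (simp add: take_Suc_conv_app_nth)
  qed (simp add: search_tree.root)
  moreover have "prefix_cost E (take i0 A) \<le> prefix_cost E A"
  proof -
    have "prefix_cost E (take i0 A) = (\<Sum>j<i0. residual E (set (take j A)))"
      using i0 by (simp add: prefix_cost_def min_def)
    also have "\<dots> \<le> prefix_cost E A" unfolding prefix_cost_def using i0 by (intro sum_mono2) auto
    finally show ?thesis .
  qed
  ultimately show "\<exists>A\<in>search_tree k E us. residual E (set A) = 0 \<and> int (prefix_cost E A) \<le> w"
    using i0(1) A0 min[OF A0(1)] by (intro bexI[of _ "take i0 A"]) auto
qed

text \<open>Double counting: the vertex of a child lies in at least a
  \<open>1 / (k - length A)\<close> fraction of the uncovered edges, while an edge has at most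
  \<open>r\<close> vertices.\<close>

lemma length_expand_le:
  assumes "distinct us"
  shows "length (expand k E us A) \<le> r * (k - length A)"
proof (cases "0 < residual E (set A)")
  case True
  define fs where "fs = filter (\<lambda>v. residual E (set A) \<le> gain E (set A) v * (k - length A)) us"
  let ?R = "{e\<in>E. e \<inter> set A = {}}" and ?M = "residual E (set A)"
  have len: "length (expand k E us A) = length fs" using True by (simp add: expand_def fs_def)
  have "?M * length fs = (\<Sum>v\<in>set fs. ?M)" using assms distinct_card[of fs] by (simp add: fs_def)
  also have "\<dots> \<le> (\<Sum>v\<in>set fs. gain E (set A) v * (k - length A))"
    by (intro sum_mono) (simp add: fs_def)
  also have "\<dots> = (\<Sum>v\<in>set fs. card {e\<in>?R. v \<in> e}) * (k - length A)"
    by (simp add: sum_distrib_right gain_def conj_assoc)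
  also have "\<dots> \<le> r * card ?R * (k - length A)"
    using finE fine card_le by (intro mult_le_mono1 sum_incidence_le) auto
  also have "\<dots> = ?M * (r * (k - length A))" by (simp add: residual_def ac_simps)
  finally show ?thesis using True len by simp
qed (simp add: expand_def)

lemma card_search_tree:
  assumes "distinct us" "1 \<le> r"
  shows "finite (search_tree k E us) \<and> card (search_tree k E us) \<le> (k + 1) * (r ^ k * fact k)"
proof -
  let ?L = "\<lambda>d. {A \<in> search_tree k E us. length A = d}"
  \<comment> \<open>Level \<open>d\<close> has at most \<open>r ^ d * k! / (k - d)!\<close> nodes,
    stated without division.\<close>
  have lev: "finite (?L d) \<and> card (?L d) * fact (k - d) \<le> r ^ d * fact k" if "d \<le> k" for d
    using that
  proof (induction d)
    case 0
    have "?L 0 = {[]}" by (auto intro: search_tree.root)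
    then show ?case by simp
  next
    case (Suc d)
    then have IH: "finite (?L d)" "card (?L d) * fact (k - d) \<le> r ^ d * fact k" by auto
    have sub: "?L (Suc d) \<subseteq> (\<Union>A\<in>?L d. set (expand k E us A))"
    proof
      fix B assume "B \<in> ?L (Suc d)"
      then have "B \<in> search_tree k E us" "length B = Suc d" by auto
      then show "B \<in> (\<Union>A\<in>?L d. set (expand k E us A))"
        by (cases rule: search_tree.cases) (auto simp: expand_def)
    qed
    have fin: "finite (?L (Suc d))" using sub IH(1) finite_subset by blast
    have "card (?L (Suc d)) \<le> card (\<Union>A\<in>?L d. set (expand k E us A))"
      using sub IH(1) by (intro card_mono) auto
    also have "\<dots> \<le> (\<Sum>A\<in>?L d. card (set (expand k E us A)))" using IH(1) by (rule card_UN_le)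
    also have "\<dots> \<le> (\<Sum>A\<in>?L d. r * (k - d))"
      using length_expand_le[OF assms(1)] by (intro sum_mono) (fastforce intro: order.trans[OF card_length])
    also have "\<dots> = card (?L d) * (r * (k - d))" by simp
    finally have c: "card (?L (Suc d)) \<le> card (?L d) * (r * (k - d))" .
    have f: "(k - d) * fact (k - Suc d) = (fact (k - d) :: nat)"
      using Suc.prems by (metis Suc_diff_Suc Suc_le_eq fact_Suc of_nat_id)
    have "card (?L (Suc d)) * fact (k - Suc d) \<le> card (?L d) * (r * (k - d)) * fact (k - Suc d)"
      using c by (rule mult_le_mono1)
    also have "\<dots> = r * (card (?L d) * ((k - d) * fact (k - Suc d)))" by (simp only: ac_simps)
    also have "\<dots> \<le> r * (r ^ d * fact k)" unfolding f using IH(2) by (rule mult_le_mono2)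
    finally show ?case using fin by simp
  qed
  have "A \<in> (\<Union>d\<in>{..k}. ?L d)" if "A \<in> search_tree k E us" for A
    using search_tree_props[OF that] that by auto
  then have eq: "search_tree k E us = (\<Union>d\<in>{..k}. ?L d)" by auto
  have "card (?L d) \<le> r ^ k * fact k" if "d \<le> k" for d
  proof -
    have "card (?L d) * 1 \<le> card (?L d) * fact (k - d)" by (intro mult_le_mono2) simp
    also have "\<dots> \<le> r ^ d * fact k" using lev[OF that] by simp
    also have "\<dots> \<le> r ^ k * fact k" using assms(2) that by (intro mult_le_mono1 power_increasing) auto
    finally show ?thesis by simp
  qed
  then have "(\<Sum>d\<le>k. card (?L d)) \<le> (\<Sum>d\<le>k. r ^ k * fact k)" by (intro sum_mono) simp
  moreover have "card (\<Union>d\<in>{..k}. ?L d) \<le> (\<Sum>d\<le>k. card (?L d))" by (rule card_UN_le) simp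
  ultimately have "card (search_tree k E us) \<le> (k + 1) * (r ^ k * fact k)"
    unfolding eq[symmetric] by simp
  moreover have "finite (\<Union>d\<in>{..k}. ?L d)" using lev by (intro finite_UN_I) auto
  then have "finite (search_tree k E us)" unfolding eq[symmetric] .
  ultimately show ?thesis by blast
qed

end

section \<open>Arithmetic of the running time\<close>

text \<open>\<open>n + 1 \<le> d * 2 ^ (n div d)\<close>, and the \<open>d\<close>-th power of
  \<open>2 ^ (n div d)\<close> is at most \<open>2 ^ n\<close>.\<close>

lemma poly_le_exp: "\<exists>C. \<forall>n. (a * n + b) ^ d \<le> C * (2::nat) ^ n"
proof (cases "d = 0")
  case False
  have "(a * n + b) ^ d \<le> ((a + b) * d) ^ d * 2 ^ n" for n
  proof -
    have "n + 1 \<le> d * (n div d + 1)" using False dividend_less_times_div[of d n] by (simp add: algebra_simps)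
    also have "\<dots> \<le> d * 2 ^ (n div d)" using Suc_leI[OF less_exp[of "n div d"]] by (intro mult_le_mono2) simp
    finally have "(a + b) * (n + 1) \<le> (a + b) * (d * 2 ^ (n div d))" by (rule mult_le_mono2)
    then have "a * n + b \<le> ((a + b) * d) * 2 ^ (n div d)" by (simp add: algebra_simps)
    then have "(a * n + b) ^ d \<le> (((a + b) * d) * 2 ^ (n div d)) ^ d" by (rule power_mono) simp
    also have "\<dots> = ((a + b) * d) ^ d * 2 ^ (n div d * d)" by (simp only: power_mult_distrib power_mult)
    also have "\<dots> \<le> ((a + b) * d) ^ d * 2 ^ n" by (intro mult_le_mono2 power_increasing) auto
    finally show ?thesis .
  qed
  then show ?thesis by blast
qed auto

text \<open>The two top terms of the binomial expansion, \<open>n ^ n\<close> and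
  \<open>n * n ^ (n - 1)\<close>, are equal.\<close>

lemma double_power_le: "1 \<le> (n::nat) \<Longrightarrow> 2 * n ^ n \<le> (n + 1) ^ n"
proof -
  assume n: "1 \<le> n"
  then obtain l where l: "n = Suc l" by (cases n) auto
  have "(n + 1) ^ n = (\<Sum>j\<le>n. (n choose j) * n ^ j)" by (simp add: binomial_ring[of n 1 n] del: One_nat_def)
  also have "\<dots> \<ge> (\<Sum>j\<in>{l, n}. (n choose j) * n ^ j)" using l by (intro sum_mono2) auto
  also have "(\<Sum>j\<in>{l, n}. (n choose j) * n ^ j) = 2 * n ^ n" using l by simp
  finally show ?thesis .
qed

lemma fact_double_power: "1 \<le> n \<Longrightarrow> fact n * 2 ^ n \<le> 2 * (n::nat) ^ n"
proof (induction n rule: nat_induct_at_least)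
  case (Suc n)
  have "fact (Suc n) * 2 ^ Suc n = 2 * (Suc n * (fact n * (2::nat) ^ n))"
    by (simp only: fact_Suc of_nat_id power_Suc ac_simps)
  also have "\<dots> \<le> 2 * (Suc n * (2 * n ^ n))" using Suc by (intro mult_le_mono2)
  also have "\<dots> \<le> 2 * (Suc n * (n + 1) ^ n)" using double_power_le[OF Suc.hyps] by (intro mult_le_mono2)
  finally show ?case by simp
qed simp

text \<open>The gap of order \<open>2 ^ n\<close> between \<open>fact n\<close> and
  \<open>n ^ n\<close> absorbs any polynomial. This is what hides the polynomial work per search
  node.\<close>

lemma fact_poly_le: "\<exists>C. \<forall>n\<ge>1. fact n * (a * n + b) ^ d \<le> C * (n::nat) ^ n"
proof -
  obtain C where C: "\<And>n. (a * n + b) ^ d \<le> C * (2::nat) ^ n" using poly_le_exp by blast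
  have "fact n * (a * n + b) ^ d \<le> (2 * C) * n ^ n" if "1 \<le> n" for n
  proof -
    have "fact n * (a * n + b) ^ d \<le> fact n * (C * 2 ^ n)" using C by (intro mult_le_mono2)
    also have "\<dots> = C * (fact n * 2 ^ n)" by simp
    also have "\<dots> \<le> C * (2 * n ^ n)" using fact_double_power[OF that] by (intro mult_le_mono2)
    finally show ?thesis by simp
  qed
  then show ?thesis by blast
qed

text \<open>The quotient of the two factorials is a product of \<open>r\<close> factors of size at
  most \<open>k\<close>. For \<open>r > k\<close> the truncated \<open>k - r\<close> is 0 and
  \<open>k ^ k \<le> k ^ r\<close> suffices.\<close>

lemma fact_le_power_mult_fact: "1 \<le> k \<Longrightarrow> fact k \<le> (k::nat) ^ r * fact (k - r)"
proof (cases "r \<le> k")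
  assume k: "1 \<le> k"
  case True
  have "fact k = (\<Prod>{k - r + 1..k}) * (fact (k - r)::nat)"
    using True fact_eq_fact_times[of "k - r" k] by (simp add: mult.commute)
  moreover have "\<Prod>{k - r + 1..k} \<le> k ^ card {k - r + 1..k}" by (intro prod_le_power) (use k in auto)
  ultimately show ?thesis using True by simp
next
  assume "1 \<le> k"
  case False
  have "fact k \<le> k ^ k" using fact_le_power[of k, where 'a = nat] by simp
  also have "\<dots> \<le> k ^ r" using False \<open>1 \<le> k\<close> by (intro power_increasing) auto
  finally show ?thesis using False by simp
qed

lemma fact_add_le: "fact (n + c) \<le> fact n * (n + c) ^ c" for n :: nat
proof (induction c)
  case (Suc c)
  have "fact (n + Suc c) = (n + Suc c) * fact (n + c)" by simp
  also have "\<dots> \<le> (n + Suc c) * (fact n * (n + c) ^ c)" using Suc by (intro mult_le_mono2)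
  also have "\<dots> \<le> (n + Suc c) * (fact n * (n + Suc c) ^ c)"
    by (intro mult_le_mono2 power_mono) auto
  finally show ?case by (simp only: ac_simps power_Suc)
qed simp

text \<open>\<open>N\<close> stands for the number of merged edges; the left side is the number of
  nodes times the work per node. For small \<open>k\<close> the bound \<open>N \<le> m\<close> leads
  to the first summand of \<open>time_bound\<close>, otherwise the bound by the power leads to the
  second.\<close>

theorem search_time_le:
  "\<exists>C. \<forall>r k m N. 1 \<le> r \<longrightarrow> 1 \<le> k \<longrightarrow> N \<le> m \<longrightarrow> N \<le> (2 * r * k * k + 1) ^ ((r + 1) * r) \<longrightarrow>
     (k + 1) * (r ^ k * fact k) * (r * k * N) \<le> C * time_bound r k m"
proof -
  \<comment> \<open>\<open>12 = 3 + 9\<close>: degree 3 for \<open>(k + 1) * r * k\<close> and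
    degree 9 for passing from \<open>fact (r + 9)\<close> to \<open>fact r\<close>.\<close>
  obtain C1 where C1: "\<And>n. 1 \<le> n \<Longrightarrow> fact n * (2 * n + 10) ^ 12 \<le> C1 * n ^ n"
    using fact_poly_le[of 2 10 12] by auto
  \<comment> \<open>For \<open>r = 1\<close>: degree 2 for \<open>(k + 1) * k\<close> and degree 4
    for \<open>N\<close>.\<close>
  obtain C2 where C2: "\<And>n. 1 \<le> n \<Longrightarrow> fact n * (3 * n + 1) ^ 6 \<le> C2 * n ^ n"
    using fact_poly_le[of 3 1 6] by auto
  define C where "C = C1 + C2 + 64"
  show ?thesis
  proof (rule exI[of _ C], intro allI impI)
    fix r k m N :: nat
    assume r: "1 \<le> r" and k: "1 \<le> k" and Nm: "N \<le> m" and N: "N \<le> (2 * r * k * k + 1) ^ ((r + 1) * r)"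
    let ?T = "(k + 1) * (r ^ k * fact k) * (r * k * N)"
    let ?x = "r * k"
    have NX: "N \<le> X ^ ((r + 1) * r)" if "2 * r * k * k + 1 \<le> X" for X
      using N power_mono[OF that, of "(r + 1) * r"] by linarith
    have TB: "r ^ (r + k) * k ^ r * m \<le> time_bound r k m" "?x ^ ?x \<le> time_bound r k m"
      by (auto simp: time_bound_def)
    \<comment> \<open>With the merged edges the exponents must satisfy
      \<open>2 + k + 2 * ((r + 1) * r) \<le> r * k\<close>. This is impossible for
      \<open>r = 1\<close>. For \<open>r = 2\<close> it says \<open>k \<ge> 14 = 2 * r + 10\<close>,
      and \<open>k \<ge> 2 * r + 10\<close> also suffices for larger \<open>r\<close>.\<close>
    consider (small) "k \<le> 2 * r + 9" | (one) "r = 1" | (large) "2 \<le> r" "2 * r + 10 \<le> k"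
      using r by linarith
    then show "?T \<le> C * time_bound r k m"
    proof cases
      case small
      have "(k + 1) * r * k \<le> (2 * r + 10) * (2 * r + 10) * (2 * r + 10)"
        using small by (intro mult_le_mono) auto
      also have "\<dots> = (2 * r + 10) ^ 3" by (simp only: power3_eq_cube)
      finally have p: "(k + 1) * r * k \<le> (2 * r + 10) ^ 3" .
      have "fact (k - r) \<le> (fact (r + 9) :: nat)" using small by (intro fact_mono) auto
      also have "\<dots> \<le> fact r * (r + 9) ^ 9" by (rule fact_add_le)
      also have "\<dots> \<le> fact r * (2 * r + 10) ^ 9" by (intro mult_le_mono2 power_mono) auto
      finally have f: "fact (k - r) \<le> fact r * (2 * r + 10) ^ 9" .
      have "fact k * ((k + 1) * r * k) \<le> (k ^ r * (fact r * (2 * r + 10) ^ 9)) * (2 * r + 10) ^ 3"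
        using fact_le_power_mult_fact[OF k, of r] f p
        by (intro mult_le_mono) (auto intro: order.trans mult_le_mono2)
      also have "\<dots> = k ^ r * (fact r * (2 * r + 10) ^ 12)"
        using power_add[of "2 * r + 10" 9 3] by simp
      also have "\<dots> \<le> k ^ r * (C1 * r ^ r)" using C1[OF r] by (intro mult_le_mono2)
      finally have a: "fact k * ((k + 1) * r * k) \<le> k ^ r * (C1 * r ^ r)" .
      have "?T = r ^ k * N * (fact k * ((k + 1) * r * k))" by (simp only: ac_simps)
      also have "\<dots> \<le> r ^ k * m * (k ^ r * (C1 * r ^ r))" using mult_le_mono[OF mult_le_mono2[OF Nm] a] .
      also have "\<dots> = C1 * (r ^ (r + k) * k ^ r * m)" by (simp only: power_add ac_simps)
      also have "\<dots> \<le> C1 * time_bound r k m" using TB(1) by (rule mult_le_mono2)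
      also have "\<dots> \<le> C * time_bound r k m" by (intro mult_le_mono1) (simp add: C_def)
      finally show ?thesis .
    next
      case one
      have "2 * k * k + 1 \<le> (3 * k + 1) ^ 2" by (simp add: power2_eq_square algebra_simps)
      then have "N \<le> ((3 * k + 1) ^ 2) ^ 2" using NX[of "(3 * k + 1) ^ 2"] unfolding one by simp
      then have "(k + 1) * k * N \<le> (3 * k + 1) * (3 * k + 1) * ((3 * k + 1) ^ 2) ^ 2"
        by (intro mult_le_mono) auto
      also have "y * y * (y ^ 2) ^ 2 = y ^ 6" for y :: nat by (simp add: power2_eq_square eval_nat_numeral)
      finally have "fact k * ((k + 1) * k * N) \<le> fact k * (3 * k + 1) ^ 6" by (rule mult_le_mono2)
      also have "\<dots> \<le> C2 * k ^ k" by (rule C2[OF k])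
      also have "\<dots> \<le> C2 * time_bound r k m" using TB(2) one by simp
      also have "\<dots> \<le> C * time_bound r k m" by (intro mult_le_mono1) (simp add: C_def)
      finally show ?thesis using one by (simp add: algebra_simps)
    next
      case large
      have x2: "2 \<le> ?x" using large k mult_le_mono[of 2 r 1 k] by simp
      have "1 \<le> r * k * k" using r k by simp
      then have b: "2 * r * k * k + 1 \<le> 3 * r * k * k" by simp
      \<comment> \<open>\<open>3 * r * k * k \<le> (r * k) ^ 2\<close> needs
        \<open>3 \<le> r\<close>. For \<open>r = 2\<close> a factor 2 is left over, and its power
        with exponent \<open>(r + 1) * r = 6\<close> is the 64.\<close>
      have N': "N \<le> 64 * ?x ^ (2 * ((r + 1) * r))"
      proof (cases "r = 2")
        case True
        have "2 * r * k * k + 1 \<le> 2 * ?x ^ 2" using b True k by (simp add: power2_eq_square)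
        then have "N \<le> (2 * ?x ^ 2) ^ ((r + 1) * r)" by (rule NX)
        also have "\<dots> = 64 * ?x ^ (2 * ((r + 1) * r))"
          by (simp only: power_mult_distrib power_mult[symmetric]) (simp add: True)
        finally show ?thesis .
      next
        case False
        then have "3 * (r * k * k) \<le> r * (r * k * k)" using large by (intro mult_le_mono1) simp
        also have "\<dots> = ?x ^ 2" by (simp add: power2_eq_square)
        finally have "2 * r * k * k + 1 \<le> ?x ^ 2" using b by (simp only: mult.assoc)
        then have "N \<le> (?x ^ 2) ^ ((r + 1) * r)" by (rule NX)
        then show ?thesis by (simp add: power_mult[symmetric])
      qed
      have "(k + 1) * k * r \<le> (r * k) * k * r" using large k by (intro mult_le_mono1) (use mult_le_mono1[of 2 r k] in linarith)
      then have p: "(k + 1) * k * r \<le> ?x ^ 2" by (simp only: power2_eq_square ac_simps)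
      have q: "r ^ k * fact k \<le> ?x ^ k"
        unfolding power_mult_distrib using fact_le_power[of k, where 'a = nat] by (intro mult_le_mono2) simp
      have "?T = ((k + 1) * k * r) * (r ^ k * fact k) * N" by (simp only: ac_simps)
      also have "\<dots> \<le> ?x ^ 2 * ?x ^ k * (64 * ?x ^ (2 * ((r + 1) * r)))"
        using p q N' by (intro mult_le_mono)
      also have "\<dots> = 64 * ?x ^ (2 + k + 2 * ((r + 1) * r))" by (simp only: power_add ac_simps)
      also have "\<dots> \<le> 64 * ?x ^ ?x"
      proof (intro mult_le_mono2 power_increasing)
        obtain s l where s: "r = s + 2" and l: "k = 2 * r + 10 + l"
          using large by (metis le_add_diff_inverse add.commute)
        show "2 + k + 2 * ((r + 1) * r) \<le> ?x" unfolding l s by (simp add: algebra_simps)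
      qed (use r k in simp)
      also have "\<dots> \<le> 64 * time_bound r k m" using TB(2) by (rule mult_le_mono2)
      also have "\<dots> \<le> C * time_bound r k m" by (intro mult_le_mono1) (simp add: C_def)
      finally show ?thesis .
    qed
  qed
qed

text \<open>This lets the preprocessing, at most \<open>k\<close> rounds over all incidences, fit
  into the first summand.\<close>

lemma linear_le_time_bound:
  assumes "1 \<le> r" "1 \<le> k" shows "k * r * m \<le> time_bound r k m"
proof -
  have "k * r \<le> k ^ r * r ^ (r + k)"
    using assms self_le_power[of k r] self_le_power[of r "r + k"] by (intro mult_le_mono) auto
  then have "k * r * m \<le> k ^ r * r ^ (r + k) * m" by (rule mult_le_mono1)
  also have "\<dots> = r ^ (r + k) * k ^ r * m" by (simp only: ac_simps)
  finally show ?thesis unfolding time_bound_def by linarith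
qed

lemma time_bound_pos: "1 \<le> time_bound r k m"
  by (cases "r * k = 0") (auto simp: time_bound_def Suc_le_eq)

section \<open>Reasoning about programs\<close>

text \<open>A weakest precondition that passes the exact time to the postcondition. The rules for
  loop-free commands are equivalences, so the simplifier executes such code symbolically and adds up
  its cost.\<close>

definition run :: "com \<Rightarrow> state \<Rightarrow> (nat \<Rightarrow> state \<Rightarrow> bool) \<Rightarrow> bool" where
  "run c s Q \<longleftrightarrow> (\<exists>t s'. exec c s t s' \<and> Q t s')"

definition upd :: "state \<Rightarrow> string \<Rightarrow> int \<Rightarrow> state" where
  "upd s x v = s\<lparr>reg := (reg s)(x := v)\<rparr>"

text \<open>The negative addresses hold sixteen interleaved arrays, so no array needs a size bound and the
  input is never overwritten.\<close>

definition loc :: "nat \<Rightarrow> int \<Rightarrow> int" where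
  "loc i a = - 1 - int i - 16 * a"

definition arr :: "state \<Rightarrow> nat \<Rightarrow> int \<Rightarrow> int" where
  "arr s i a = mem s (loc i a)"

definition put :: "state \<Rightarrow> nat \<Rightarrow> int \<Rightarrow> int \<Rightarrow> state" where
  "put s i a v = s\<lparr>mem := (mem s)(loc i a := v)\<rparr>"

text \<open>Without multiplication, \<open>16 * a\<close> takes four doublings. Each evaluates its
  operand twice, whence the factor 16 in \<open>atime_Loc\<close>.\<close>

definition twice :: "aexp \<Rightarrow> aexp" where
  "twice a = Add a a"

definition Loc :: "nat \<Rightarrow> aexp \<Rightarrow> aexp" where
  "Loc i a = Sub (Const (- 1 - int i)) (twice (twice (twice (twice a))))"

definition Arr :: "nat \<Rightarrow> aexp \<Rightarrow> aexp" where
  "Arr i a = Load (Loc i a)"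

definition Put :: "nat \<Rightarrow> aexp \<Rightarrow> aexp \<Rightarrow> com" where
  "Put i a b = Store (Loc i a) b"

lemma aval_Arr [simp]: "aval (Arr i a) s = arr s i (aval a s)"
  by (simp add: Arr_def Loc_def twice_def arr_def loc_def)

lemma atime_Loc [simp]: "atime (Loc i a) = 17 + 16 * atime a"
  by (simp add: Loc_def twice_def)

lemma atime_Arr [simp]: "atime (Arr i a) = 18 + 16 * atime a"
  by (simp add: Arr_def)

lemma loc_eq_iff [simp]: "i < 16 \<Longrightarrow> j < 16 \<Longrightarrow> loc i a = loc j b \<longleftrightarrow> i = j \<and> a = b"
  unfolding loc_def by presburger

lemma arr_put [simp]:
  "i < 16 \<Longrightarrow> j < 16 \<Longrightarrow> arr (put s i a v) j b = (if j = i \<and> b = a then v else arr s j b)"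
  by (auto simp: arr_def put_def)

lemma reg_put [simp]: "reg (put s i a v) = reg s"
  by (simp add: put_def)

lemma reg_upd [simp]: "reg (upd s x v) y = (if y = x then v else reg s y)"
  by (simp add: upd_def)

lemma mem_upd [simp]: "mem (upd s x v) = mem s"
  by (simp add: upd_def)

lemma arr_upd [simp]: "arr (upd s x v) = arr s"
  by (simp add: arr_def fun_eq_iff)

lemma mem_put [simp]: "0 \<le> a \<Longrightarrow> 0 \<le> b \<Longrightarrow> mem (put s i a v) b = mem s b"
  by (simp add: put_def loc_def)

lemma run_Skip [simp]: "run Skip s Q \<longleftrightarrow> Q 1 s"
  unfolding run_def by (metis exec.Skip exec_SkipE)

lemma run_Assign [simp]: "run (Assign x a) s Q \<longleftrightarrow> Q (1 + atime a) (upd s x (aval a s))"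
  unfolding run_def upd_def by (metis exec.Assign exec_AssignE)

lemma run_Put [simp]:
  "run (Put i a b) s Q \<longleftrightarrow> Q (18 + 16 * atime a + atime b) (put s i (aval a s) (aval b s))"
proof -
  have "aval (Loc i a) s = loc i (aval a s)" by (simp add: Loc_def twice_def loc_def)
  then have *: "put s i (aval a s) (aval b s) = s\<lparr>mem := (mem s)(aval (Loc i a) s := aval b s)\<rparr>"
    by (simp add: put_def)
  have t: "18 + 16 * atime a + atime b = 1 + atime (Loc i a) + atime b" by simp
  show ?thesis unfolding run_def Put_def * t by (metis exec.Store exec_StoreE)
qed

lemma run_Seq [simp]: "run (Seq c d) s Q \<longleftrightarrow> run c s (\<lambda>t s'. run d s' (\<lambda>t'. Q (t + t')))"
  unfolding run_def by (blast elim: exec_SeqE intro: exec.Seq)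

lemma run_If [simp]:
  "run (com.If b c d) s Q \<longleftrightarrow> (if bval b s then run c s (\<lambda>t. Q (btime b + t)) else run d s (\<lambda>t. Q (btime b + t)))"
  unfolding run_def by (auto elim!: exec_IfE) (blast intro: exec.IfTrue exec.IfFalse)+

lemma run_mono: "run c s P \<Longrightarrow> (\<And>t s'. P t s' \<Longrightarrow> Q t s') \<Longrightarrow> run c s Q"
  unfolding run_def by blast

lemma run_While_unfold:
  "run (While b c) s Q \<longleftrightarrow> (if bval b s
     then run c s (\<lambda>t s'. run (While b c) s' (\<lambda>t'. Q (btime b + t + t')))
     else Q (btime b) s)"
proof (cases "bval b s")
  case True
  have "exec (While b c) s u s'' \<longleftrightarrow>
      (\<exists>t t' s'. u = btime b + t + t' \<and> exec c s t s' \<and> exec (While b c) s' t' s'')" for u s''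
    using True by (metis exec.WhileTrue exec_WhileE)
  then show ?thesis using True by (simp only: run_def if_True) blast
next
  case False
  then show ?thesis unfolding run_def if_not_P[OF False] by (metis exec.WhileFalse exec_WhileE)
qed

text \<open>The index of the invariant counts the completed iterations. As the invariant and the
  guard together force it below \<open>N\<close>, there are at most \<open>N\<close> iterations and
  one failing test.\<close>

lemma run_While:
  assumes body: "\<And>n s. I n s \<Longrightarrow> bval b s \<Longrightarrow> n < N \<and> run c s (\<lambda>t s'. t \<le> T \<and> I (Suc n) s')"
    and start: "I 0 s"
  shows "run (While b c) s (\<lambda>t s'. t \<le> N * (T + btime b) + btime b \<and> (\<exists>n. I n s' \<and> \<not> bval b s'))"
proof -
  have "run (While b c) s (\<lambda>t s'. t \<le> (N - n) * (T + btime b) + btime b \<and> (\<exists>n. I n s' \<and> \<not> bval b s'))"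
    if "I n s" for n s
    using that
  proof (induction "N - n" arbitrary: n s)
    case 0
    then have "\<not> bval b s" using body by fastforce
    then show ?case using 0 by (subst run_While_unfold) auto
  next
    case (Suc d)
    show ?case
    proof (cases "bval b s")
      case True
      have n: "n < N" and r: "run c s (\<lambda>t s'. t \<le> T \<and> I (Suc n) s')"
        using body[OF Suc.prems True] by auto
      have e: "N - n = Suc (N - Suc n)" using n by simp
      show ?thesis
        unfolding run_While_unfold[of b c s] if_P[OF True]
      proof (rule run_mono[OF r])
        fix t s' assume *: "t \<le> T \<and> I (Suc n) s'"
        show "run (While b c) s' (\<lambda>t' s'. btime b + t + t' \<le> (N - n) * (T + btime b) + btime b \<and>
            (\<exists>n. I n s' \<and> \<not> bval b s'))"
          by (rule run_mono[OF Suc.hyps(1)[of "Suc n" s']]) (use * Suc.hyps(2) e in auto)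
      qed
    next
      case False
      then show ?thesis using Suc.prems by (subst run_While_unfold) auto
    qed
  qed
  from this[OF start] show ?thesis by simp
qed

definition for_upto :: "string \<Rightarrow> aexp \<Rightarrow> com \<Rightarrow> com" where
  "for_upto x n c = Seq (Assign x (Const 0))
     (While (Less (Reg x) n) (Seq c (Assign x (Add (Reg x) (Const 1)))))"

text \<open>The 6 consists of 4 for the increment and 2 for the test apart from the limit, which is
  evaluated anew each time. \<open>stable\<close> is required because the counter is assigned
  outside the body.\<close>

lemma run_for_upto:
  assumes body: "\<And>i s. i < N \<Longrightarrow> I i s \<Longrightarrow> reg s x = int i \<Longrightarrow>
      run c s (\<lambda>t s'. t \<le> T \<and> I (Suc i) s' \<and> reg s' x = int i)"
    and stable: "\<And>i s v. I i s \<Longrightarrow> I i (upd s x v)"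
    and limit: "\<And>i s. I i s \<Longrightarrow> aval n s = int N"
    and start: "I 0 s"
  shows "run (for_upto x n c) s (\<lambda>t s'. t \<le> N * (T + atime n + 6) + atime n + 4 \<and> I N s')"
proof -
  let ?J = "\<lambda>i s. I i s \<and> reg s x = int i \<and> i \<le> N"
  have "run (While (Less (Reg x) n) (Seq c (Assign x (Add (Reg x) (Const 1))))) (upd s x 0)
     (\<lambda>t s'. t \<le> N * ((T + 4) + btime (Less (Reg x) n)) + btime (Less (Reg x) n) \<and>
        (\<exists>i. ?J i s' \<and> \<not> bval (Less (Reg x) n) s'))"
  proof (rule run_While)
    fix i s assume J: "?J i s" and b: "bval (Less (Reg x) n) s"
    then have "i < N" using limit[of i s] by simp
    moreover have "run (Seq c (Assign x (Add (Reg x) (Const 1)))) s (\<lambda>t s'. t \<le> T + 4 \<and> ?J (Suc i) s')"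
      unfolding run_Seq run_Assign
      by (rule run_mono[OF body[of i s]]) (use J \<open>i < N\<close> stable in auto)
    ultimately show "i < N \<and> run (Seq c (Assign x (Add (Reg x) (Const 1)))) s (\<lambda>t s'. t \<le> T + 4 \<and> ?J (Suc i) s')"
      by blast
  qed (use start stable in auto)
  then show ?thesis unfolding for_upto_def run_Seq run_Assign aval.simps
  proof (rule run_mono)
    fix t s'
    assume *: "t \<le> N * ((T + 4) + btime (Less (Reg x) n)) + btime (Less (Reg x) n) \<and>
        (\<exists>i. ?J i s' \<and> \<not> bval (Less (Reg x) n) s')"
    then obtain i where i: "?J i s'" "\<not> bval (Less (Reg x) n) s'" by blast
    then have "i = N" using limit[of i s'] by simp
    moreover have "N * ((T + 4) + btime (Less (Reg x) n)) + btime (Less (Reg x) n)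
       = N * (T + atime n + 6) + atime n + 2" by (simp add: algebra_simps)
    ultimately show "1 + atime (Const 0) + t \<le> N * (T + atime n + 6) + atime n + 4 \<and> I N s'"
      using * i by (simp add: ac_simps)
  qed
qed

section \<open>Layout of the input and loops over the hyperedges\<close>

locale input =
  fixes k w :: int and vs :: "nat list" and es :: "nat list list"
begin

definition eaddr :: "nat \<Rightarrow> int" where
  "eaddr i = 4 + int (length vs) + (\<Sum>j<i. int (length (es ! j)) + 1)"

lemma eaddr_nonneg [simp]: "0 \<le> eaddr i"
  unfolding eaddr_def by (intro add_nonneg_nonneg sum_nonneg) auto

lemma eaddr_Suc: "eaddr (Suc i) = eaddr i + int (length (es ! i)) + 1"
  by (simp add: eaddr_def)

text \<open>Of the vertex list only its length is recorded, since it is needed to jump to the first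
  hyperedge. Reading the names would cost time that the bound does not grant, and a vertex in no
  hyperedge cannot improve a cover.\<close>

definition inp :: "state \<Rightarrow> bool" where
  "inp s \<longleftrightarrow> mem s 0 = k \<and> mem s 1 = w \<and> mem s 2 = int (length vs) \<and> mem s 3 = int (length es) \<and>
     (\<forall>i<length es. mem s (eaddr i) = int (length (es ! i)) \<and>
       (\<forall>l<length (es ! i). mem s (eaddr i + 1 + int l) = int (es ! i ! l)))"

lemma inp_upd [simp]: "inp (upd s x v) = inp s"
  by (simp add: inp_def)

lemma inp_put [simp]: "0 \<le> a \<Longrightarrow> inp (put s i a v) = inp s"
  by (simp add: inp_def)

lemma inp_initial: "inp (initial_state (input_word k w vs es))"
proof -
  let ?f = "\<lambda>e. int (length e) # map int e"
  let ?x = "input_word k w vs es"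
  have nth: "mem (initial_state ?x) (int i) = ?x ! i" if "i < length ?x" for i
    using that by (simp add: initial_state_def)
  have edge: "mem (initial_state ?x) (eaddr i + int l) = ?f (es ! i) ! l"
    if i: "i < length es" and l: "l < length (?f (es ! i))" for i l
  proof -
    let ?p = "\<Sum>j<i. length (es ! j) + 1"
    have es: "es = take i es @ es ! i # drop (Suc i) es" using i by (rule id_take_nth_drop)
    have len: "length (concat (map ?f (take i es))) = ?p" using i
    proof (induction i)
      case (Suc i)
      then show ?case by (simp add: take_Suc_conv_app_nth)
    qed simp
    have c: "concat (map ?f es) = concat (map ?f (take i es)) @ ?f (es ! i) @ concat (map ?f (drop (Suc i) es))"
      by (subst es) (simp only: map_append concat_append list.map concat.simps append_Cons)
    have ltc: "?p + l < length (concat (map ?f es))"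
      using l unfolding c length_append len by simp
    have "concat (map ?f es) ! (?p + l) = ?f (es ! i) ! l"
      unfolding c using l by (simp only: nth_append len not_add_less1 add_diff_cancel_left' if_False if_True)
    moreover have "?x ! (4 + length vs + (?p + l)) = concat (map ?f es) ! (?p + l)"
      by (simp add: input_word_def nth_append numeral_eq_Suc)
    moreover have "4 + length vs + (?p + l) < length ?x" using ltc by (simp add: input_word_def)
    moreover have "eaddr i + int l = int (4 + length vs + (?p + l))"
      by (simp add: eaddr_def sum.distrib)
    ultimately show ?thesis using nth by metis
  qed
  have "mem (initial_state ?x) (eaddr i) = int (length (es ! i))" if "i < length es" for i
    using edge[OF that, of 0] by simp
  moreover have "mem (initial_state ?x) (eaddr i + 1 + int l) = int (es ! i ! l)"
    if "i < length es" "l < length (es ! i)" for i l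
    using edge[OF that(1), of "Suc l"] that(2) by (simp add: add.assoc)
  moreover have "mem (initial_state ?x) 0 = k" "mem (initial_state ?x) 1 = w"
    "mem (initial_state ?x) 2 = int (length vs)" "mem (initial_state ?x) 3 = int (length es)"
    by (simp_all add: initial_state_def input_word_def)
  ultimately show ?thesis by (simp add: inp_def)
qed

end

text \<open>On entry \<open>p\<close> is at the length cell and \<open>q\<close> at the last entry.
  Incrementing before the body lets the body see \<open>p\<close> at an entry and leaves
  \<open>p\<close> just before the next hyperedge.\<close>

definition scan :: "com \<Rightarrow> com" where
  "scan c = While (Less (Reg ''p'') (Reg ''q'')) (Seq (Assign ''p'' (Add (Reg ''p'') (Const 1))) c)"

definition for_edges :: "com \<Rightarrow> com \<Rightarrow> com \<Rightarrow> com" where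
  "for_edges pre c post = Seq (Assign ''p'' (Add (Const 4) (Load (Const 2))))
     (for_upto ''j'' (Load (Const 3))
       (Seq pre (Seq (Assign ''q'' (Add (Reg ''p'') (Load (Reg ''p''))))
         (Seq (scan c) (Seq post (Assign ''p'' (Add (Reg ''p'') (Const 1))))))))"

context input
begin

lemma run_scan:
  assumes body: "\<And>l s. l < length (es ! i) \<Longrightarrow> inp s \<Longrightarrow> 0 \<le> reg s ''p'' \<Longrightarrow>
      mem s (reg s ''p'') = int (es ! i ! l) \<Longrightarrow> J l s \<Longrightarrow>
      run c s (\<lambda>t s'. t \<le> T \<and> inp s' \<and> J (Suc l) s' \<and>
        reg s' ''p'' = reg s ''p'' \<and> reg s' ''q'' = reg s ''q'')"
    and stable: "\<And>l s v. J l s \<Longrightarrow> J l (upd s ''p'' v)"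
    and start: "J 0 s" "inp s" "i < length es" "reg s ''p'' = eaddr i" "reg s ''q'' = eaddr i + int (length (es ! i))"
  shows "run (scan c) s (\<lambda>t s'. t \<le> length (es ! i) * (T + 7) + 3 \<and> inp s' \<and> J (length (es ! i)) s' \<and>
     reg s' ''p'' = eaddr i + int (length (es ! i)))"
proof -
  let ?K = "\<lambda>l s. inp s \<and> J l s \<and> reg s ''p'' = eaddr i + int l \<and>
     reg s ''q'' = eaddr i + int (length (es ! i)) \<and> l \<le> length (es ! i)"
  have "run (scan c) s (\<lambda>t s'. t \<le> length (es ! i) * ((T + 4) + btime (Less (Reg ''p'') (Reg ''q''))) +
      btime (Less (Reg ''p'') (Reg ''q'')) \<and> (\<exists>l. ?K l s' \<and> \<not> bval (Less (Reg ''p'') (Reg ''q'')) s'))"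
    unfolding scan_def
  proof (rule run_While)
    fix l s assume K: "?K l s" and b: "bval (Less (Reg ''p'') (Reg ''q'')) s"
    then have l: "l < length (es ! i)" by simp
    let ?s = "upd s ''p'' (eaddr i + int l + 1)"
    have "mem s (eaddr i + 1 + int l) = int (es ! i ! l)" using K l start(3) by (simp add: inp_def)
    then have m: "mem ?s (reg ?s ''p'') = int (es ! i ! l)" by (simp add: ac_simps)
    have "0 \<le> reg ?s ''p''" using eaddr_nonneg[of i] by simp
    then have "run c ?s (\<lambda>t s'. t \<le> T \<and> inp s' \<and> J (Suc l) s' \<and>
        reg s' ''p'' = reg ?s ''p'' \<and> reg s' ''q'' = reg ?s ''q'')"
      using K l m stable by (intro body) auto
    then have "run c ?s (\<lambda>t s'. 4 + t \<le> T + 4 \<and> ?K (Suc l) s')"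
      by (rule run_mono) (use K l in auto)
    then show "l < length (es ! i) \<and> run (Seq (Assign ''p'' (Add (Reg ''p'') (Const 1))) c) s
       (\<lambda>t s'. t \<le> T + 4 \<and> ?K (Suc l) s')"
      using K l by simp
  qed (use start in auto)
  then show ?thesis by (rule run_mono) (auto simp: algebra_simps)
qed

text \<open>\<open>I i\<close> holds between hyperedges and \<open>J i l\<close> inside hyperedge
  \<open>i\<close> after \<open>l\<close> entries. The loops themselves assign \<open>p\<close>,
  \<open>q\<close> and \<open>j\<close>, hence the stability assumptions.\<close>

lemma run_for_edges:
  assumes pre: "\<And>i s. i < length es \<Longrightarrow> inp s \<Longrightarrow> reg s ''j'' = int i \<Longrightarrow> reg s ''p'' = eaddr i \<Longrightarrow> I i s \<Longrightarrow>
      run pre s (\<lambda>t s'. t \<le> T1 \<and> inp s' \<and> reg s' ''j'' = int i \<and> reg s' ''p'' = eaddr i \<and> J i 0 s')"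
    and body: "\<And>i l s. i < length es \<Longrightarrow> l < length (es ! i) \<Longrightarrow> inp s \<Longrightarrow> reg s ''j'' = int i \<Longrightarrow>
      0 \<le> reg s ''p'' \<Longrightarrow> mem s (reg s ''p'') = int (es ! i ! l) \<Longrightarrow> J i l s \<Longrightarrow>
      run c s (\<lambda>t s'. t \<le> T2 \<and> inp s' \<and> reg s' ''j'' = int i \<and> J i (Suc l) s' \<and>
        reg s' ''p'' = reg s ''p'' \<and> reg s' ''q'' = reg s ''q'')"
    and post: "\<And>i s. i < length es \<Longrightarrow> inp s \<Longrightarrow> reg s ''j'' = int i \<Longrightarrow> J i (length (es ! i)) s \<Longrightarrow>
      run post s (\<lambda>t s'. t \<le> T3 \<and> inp s' \<and> reg s' ''j'' = int i \<and> reg s' ''p'' = reg s ''p'' \<and> I (Suc i) s')"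
    and stable: "\<And>i s v. I i s \<Longrightarrow> I i (upd s ''p'' v)" "\<And>i s v. I i s \<Longrightarrow> I i (upd s ''j'' v)"
      "\<And>i l s v. J i l s \<Longrightarrow> J i l (upd s ''p'' v)" "\<And>i l s v. J i l s \<Longrightarrow> J i l (upd s ''q'' v)"
    and r: "\<And>e. e \<in> set es \<Longrightarrow> length e \<le> r"
    and start: "inp s" "I 0 s"
  shows "run (for_edges pre c post) s (\<lambda>t s'. t \<le> length es * (T1 + r * (T2 + 7) + T3 + 20) + 11 \<and>
     inp s' \<and> I (length es) s')"
proof -
  let ?I = "\<lambda>i s. inp s \<and> I i s \<and> reg s ''p'' = eaddr i"
  let ?T = "T1 + (5 + (r * (T2 + 7) + 3 + (T3 + 4)))"
  let ?s = "upd s ''p'' (eaddr 0)"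
  have "run (for_upto ''j'' (Load (Const 3))
       (Seq pre (Seq (Assign ''q'' (Add (Reg ''p'') (Load (Reg ''p''))))
         (Seq (scan c) (Seq post (Assign ''p'' (Add (Reg ''p'') (Const 1)))))))) ?s
     (\<lambda>t s'. t \<le> length es * (?T + atime (Load (Const 3)) + 6) + atime (Load (Const 3)) + 4 \<and>
        ?I (length es) s')"
  proof (rule run_for_upto)
    fix i s assume i: "i < length es" and I: "?I i s" and j: "reg s ''j'' = int i"
    show "run (Seq pre (Seq (Assign ''q'' (Add (Reg ''p'') (Load (Reg ''p''))))
         (Seq (scan c) (Seq post (Assign ''p'' (Add (Reg ''p'') (Const 1))))))) s
       (\<lambda>t s'. t \<le> ?T \<and> ?I (Suc i) s' \<and> reg s' ''j'' = int i)"
      unfolding run_Seq run_Assign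
    proof (rule run_mono[OF pre[of i s]], goal_cases)
      case (6 t1 s1)
      let ?s2 = "upd s1 ''q'' (eaddr i + int (length (es ! i)))"
      have q: "aval (Add (Reg ''p'') (Load (Reg ''p''))) s1 = eaddr i + int (length (es ! i))"
        using 6 i by (simp add: inp_def)
      have "run (scan c) ?s2 (\<lambda>t s'. t \<le> length (es ! i) * (T2 + 7) + 3 \<and> inp s' \<and>
         (reg s' ''j'' = int i \<and> J i (length (es ! i)) s') \<and> reg s' ''p'' = eaddr i + int (length (es ! i)))"
      proof (rule run_scan)
        fix l s assume "l < length (es ! i)" "inp s" "0 \<le> reg s ''p''" "mem s (reg s ''p'') = int (es ! i ! l)"
          "reg s ''j'' = int i \<and> J i l s"
        then show "run c s (\<lambda>t s'. t \<le> T2 \<and> inp s' \<and> (reg s' ''j'' = int i \<and> J i (Suc l) s') \<and>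
            reg s' ''p'' = reg s ''p'' \<and> reg s' ''q'' = reg s ''q'')"
          by (intro run_mono[OF body[of i l s]]) (use i in auto)
      qed (use 6 i stable in auto)
      then show ?case unfolding q
      proof (rule run_mono, goal_cases)
        case (1 t3 s3)
        have "length (es ! i) \<le> r" using r i by simp
        then have le: "length (es ! i) * (T2 + 7) \<le> r * (T2 + 7)" by (rule mult_le_mono1)
        show ?case
        proof (rule run_mono[OF post[of i s3]], goal_cases)
          case (5 t4 s4)
          then have "t1 + (5 + (t3 + (t4 + 4))) \<le> ?T" using 1 6 le by linarith
          then show ?case using 1 5 stable by (simp add: eaddr_Suc)
        qed (use 1 i in auto)
      qed
    qed (use i I j in auto)
  qed (use start stable in \<open>auto simp: inp_def eaddr_def\<close>)
  moreover have "aval (Add (Const 4) (Load (Const 2))) s = eaddr 0"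
    using start by (simp add: inp_def eaddr_def)
  ultimately show ?thesis
    unfolding for_edges_def run_Seq run_Assign
    by (auto elim!: run_mono simp: algebra_simps)
qed

end

section \<open>Reading the input\<close>

text \<open>
  \<open>PW\<close>, \<open>INU\<close> and \<open>SEEN\<close> are indexed by vertex names: the power of two encoding the vertex in the
  current round, and marks for the heavy and for the already listed vertices. \<open>VL\<close> and \<open>UL\<close> list all
  vertices and the heavy ones. \<open>GE\<close> holds the class code of every edge and later, with \<open>HE\<close>, the
  address of a representative and the code of every trace. \<open>DICT\<close> is addressed by codes: it counts
  class sizes, incidences and trace multiplicities. \<open>HIT\<close> and \<open>DEG\<close> hold the covered traces and the
  gains of a search node, and \<open>QV\<close>, \<open>QB\<close>, \<open>QD\<close>, \<open>QC\<close> the search queue: last vertex, offset of the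
  parent's block in \<open>HIT\<close>, depth and cost.
\<close>

abbreviation (input) "PW \<equiv> 0 :: nat"
abbreviation (input) "INU \<equiv> 1 :: nat"
abbreviation (input) "VL \<equiv> 2 :: nat"
abbreviation (input) "GE \<equiv> 3 :: nat"
abbreviation (input) "HE \<equiv> 4 :: nat"
abbreviation (input) "DICT \<equiv> 5 :: nat"
abbreviation (input) "HIT \<equiv> 6 :: nat"
abbreviation (input) "DEG \<equiv> 7 :: nat"
abbreviation (input) "QV \<equiv> 8 :: nat"
abbreviation (input) "QB \<equiv> 9 :: nat"
abbreviation (input) "QD \<equiv> 10 :: nat"
abbreviation (input) "QC \<equiv> 11 :: nat"
abbreviation (input) "SEEN \<equiv> 12 :: nat"
abbreviation (input) "UL \<equiv> 13 :: nat"

abbreviation "Vtx \<equiv> Load (Reg ''p'')"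
abbreviation "Inc x \<equiv> Assign x (Add (Reg x) (Const 1))"

definition collect_vertex :: com where
  "collect_vertex = com.If (Less (Arr SEEN Vtx) (Const 1))
     (Seq (Put SEEN Vtx (Const 1)) (Seq (Put VL (Reg ''n'') Vtx) (Inc ''n''))) Skip"

definition collect_vertices :: com where
  "collect_vertices = for_edges Skip collect_vertex Skip"

definition assign_power :: com where
  "assign_power = Seq (Put PW (Arr VL (Reg ''i'')) (Reg ''cur'')) (Assign ''cur'' (Add (Reg ''cur'') (Reg ''cur'')))"

definition assign_powers :: com where
  "assign_powers = for_upto ''i'' (Reg ''n'') assign_power"

text \<open>Each incidence adds \<open>2 k\<close>, so that heaviness becomes a comparison of two
  cells without multiplication. Class sizes are kept at the digit \<open>sz\<close>, which belongs
  to no vertex.\<close>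

definition count_classes :: com where
  "count_classes = for_edges
     (Seq (Assign ''c'' (Arr GE (Reg ''j'')))
       (Put DICT (Add (Reg ''c'') (Reg ''sz'')) (Add (Arr DICT (Add (Reg ''c'') (Reg ''sz''))) (Const 1))))
     (Put DICT (Add (Reg ''c'') (Arr PW Vtx))
       (Add (Arr DICT (Add (Reg ''c'') (Arr PW Vtx))) (Add (Load (Const 0)) (Load (Const 0)))))
     Skip"

definition refine_vertex :: com where
  "refine_vertex = com.If (Less (Arr DICT (Add (Reg ''c'') (Arr PW Vtx))) (Arr DICT (Add (Reg ''c'') (Reg ''sz'')))) Skip
     (Seq (Assign ''g'' (Add (Reg ''g'') (Arr PW Vtx))) (Put INU Vtx (Const 1)))"

definition refine_classes :: com where
  "refine_classes = for_edges
     (Seq (Assign ''c'' (Arr GE (Reg ''j''))) (Assign ''g'' (Reg ''c'')))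
     refine_vertex
     (Put GE (Reg ''j'') (Reg ''g''))"

text \<open>One doubling of \<open>cur\<close> per vertex yields the vertex digits, the value
  reached is the size digit \<open>sz\<close>, and a further doubling gives the lowest digit of the
  next round.\<close>

definition refinement_round :: com where
  "refinement_round = Seq assign_powers (Seq (Assign ''sz'' (Reg ''cur''))
     (Seq (Assign ''cur'' (Add (Reg ''cur'') (Reg ''cur''))) (Seq count_classes refine_classes)))"

definition refinement_rounds :: com where
  "refinement_rounds = Seq (Assign ''cur'' (Const 1)) (for_upto ''t'' (Load (Const 0)) refinement_round)"

context input
begin

definition fresh :: "state \<Rightarrow> bool" where
  "fresh s \<longleftrightarrow> (\<forall>i<16. i \<noteq> VL \<longrightarrow> i \<noteq> SEEN \<longrightarrow> (\<forall>a\<ge>0. arr s i a = 0)) \<and>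
     reg s ''nt'' = 0 \<and> reg s ''nu'' = 0 \<and> reg s ''answer'' = 0"

definition collected :: "nat set \<Rightarrow> state \<Rightarrow> bool" where
  "collected X s \<longleftrightarrow> fresh s \<and> (\<exists>L. distinct L \<and> set L = X \<and> reg s ''n'' = int (length L) \<and>
       (\<forall>a<length L. arr s VL (int a) = int (L ! a)) \<and>
       (\<forall>v. arr s SEEN (int v) = (if v \<in> X then 1 else 0)))"

lemma collected_upd [simp]:
  "x \<notin> {''n'', ''nt'', ''nu'', ''answer''} \<Longrightarrow> collected X (upd s x v) = collected X s"
  unfolding collected_def fresh_def by auto

lemma run_collect_vertex:
  assumes "inp s" "mem s (reg s ''p'') = int v" "0 \<le> reg s ''p''" "collected X s"
  shows "run collect_vertex s
     (\<lambda>t s'. t \<le> 193 \<and> inp s' \<and> reg s' ''j'' = reg s ''j'' \<and> collected (insert v X) s' \<and>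
        reg s' ''p'' = reg s ''p'' \<and> reg s' ''q'' = reg s ''q'')"
proof -
  from assms(4) obtain L where L: "fresh s" "distinct L" "set L = X" "reg s ''n'' = int (length L)"
      "\<And>a. a < length L \<Longrightarrow> arr s VL (int a) = int (L ! a)"
      "\<And>v. arr s SEEN (int v) = (if v \<in> X then 1 else 0)" unfolding collected_def by blast
  show ?thesis
  proof (cases "v \<in> X")
    case True
    then have "insert v X = X" by auto
    then show ?thesis using True assms L(6)[of v] by (simp add: collect_vertex_def)
  next
    case False
    let ?s = "upd (put (put s SEEN (int v) 1) VL (int (length L)) (int v)) ''n'' (int (length L) + 1)"
    have "collected (insert v X) ?s"
      unfolding collected_def
    proof (intro conjI exI[of _ "L @ [v]"])
      show "fresh ?s" using L(1) by (simp add: fresh_def)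
    qed (use L False in \<open>auto simp: nth_append less_Suc_eq\<close>)
    then show ?thesis using False assms L(4) L(6)[of v] by (simp add: collect_vertex_def)
  qed
qed

lemma run_collect_vertices:
  assumes s: "inp s" "fresh s" "\<And>a. 0 \<le> a \<Longrightarrow> arr s SEEN a = 0" "reg s ''n'' = 0"
    and r: "\<And>e. e \<in> set es \<Longrightarrow> length e \<le> r"
  shows "run collect_vertices s (\<lambda>t s'. t \<le> length es * (r * 200 + 30) + 11 \<and> inp s' \<and> fresh s' \<and>
     (\<exists>L. distinct L \<and> set L = (\<Union>e\<in>set es. set e) \<and> reg s' ''n'' = int (length L) \<and>
       (\<forall>a<length L. arr s' VL (int a) = int (L ! a))))"
proof -
  let ?J = "\<lambda>i l. collected ((\<Union>e\<in>set (take i es). set e) \<union> set (take l (es ! i)))"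
  let ?I = "\<lambda>i. collected (\<Union>e\<in>set (take i es). set e)"
  have "run collect_vertices s (\<lambda>t s'. t \<le> length es * (1 + r * (193 + 7) + 1 + 20) + 11 \<and> inp s' \<and>
     ?I (length es) s')"
    unfolding collect_vertices_def
  proof (rule run_for_edges[where J = ?J], goal_cases)
    case (2 i l s)
    have eq: "(\<Union>e\<in>set (take i es). set e) \<union> set (take (Suc l) (es ! i)) =
       insert (es ! i ! l) ((\<Union>e\<in>set (take i es). set e) \<union> set (take l (es ! i)))"
      using 2 by (simp add: take_Suc_conv_app_nth)
    show ?case unfolding eq
      by (rule run_mono[OF run_collect_vertex[of s "es ! i ! l"]]) (use 2 in simp_all)
  next
    case (3 i s)
    have "(\<Union>e\<in>set (take (Suc i) es). set e) = (\<Union>e\<in>set (take i es). set e) \<union> set (es ! i)"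
      using 3 by (auto simp: take_Suc_conv_app_nth)
    then show ?case using 3 by simp
  next
    case 10
    show ?case unfolding collected_def using s by (auto intro!: exI[of _ "[]"])
  qed (use s r in simp_all)
  then show ?thesis by (rule run_mono) (auto simp: algebra_simps collected_def)
qed

end

section \<open>Computing the heavy vertices\<close>

lemma card_filter_take_Suc:
  assumes "distinct xs" "i < length xs"
  shows "card {x\<in>set (take (Suc i) xs). P x} = card {x\<in>set (take i xs). P x} + of_bool (P (xs ! i))"
proof -
  have "xs ! i \<notin> set (take i xs)" using assms by (auto simp: in_set_conv_nth nth_eq_iff_index_eq)
  moreover have "{x\<in>set (take (Suc i) xs). P x} =
      (if P (xs ! i) then insert (xs ! i) {x\<in>set (take i xs). P x} else {x\<in>set (take i xs). P x})"
    using assms by (auto simp: take_Suc_conv_app_nth)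
  ultimately show ?thesis by simp
qed

section \<open>Numbering of the vertices and invariants of a refinement round\<close>

locale program = input "int K" w vs es for K :: nat and w vs es +
  fixes V :: "nat set" and E :: "nat set set" and L :: "nat list"
  assumes hyper: "hypergraph V E" and enum: "enumerates vs es V E" and K_pos: "1 \<le> K"
    and dist_L: "distinct L" and set_L: "set L = \<Union>E"
begin

definition idx :: "nat \<Rightarrow> nat" where
  "idx = inv_into {..<length L} ((!) L)"

lemma idx_nth [simp]: "i < length L \<Longrightarrow> idx (L ! i) = i"
  unfolding idx_def by (rule inv_into_f_f) (auto simp: inj_on_nth dist_L)

lemma idx_less_length [simp]: "v \<in> set L \<Longrightarrow> idx v < length L"
  by (metis idx_nth in_set_conv_nth)

lemma nth_idx [simp]: "v \<in> set L \<Longrightarrow> L ! idx v = v"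
  by (metis idx_nth in_set_conv_nth)

lemma set_es: "set (map set es) = E" and dist_es: "distinct (map set es)"
  and dist_edge: "i < length es \<Longrightarrow> distinct (es ! i)"
  using enum by (auto simp: enumerates_def)

lemma edge_in_E [simp]: "i < length es \<Longrightarrow> set (es ! i) \<in> E"
  using set_es by auto

lemma edge_subset_L: "i < length es \<Longrightarrow> l < length (es ! i) \<Longrightarrow> es ! i ! l \<in> set L"
  unfolding set_L using edge_in_E by (meson UnionI nth_mem)

lemma card_E: "card E = length es"
  using distinct_card[OF dist_es] unfolding set_es by simp

lemma finite_E: "finite E"
  using set_es by (metis List.finite_set)

text \<open>\<open>Suc (length L)\<close> digits per round: one for each vertex and one for the
  class size.\<close>

sublocale refinement E K "rank E" "Suc (length L)" idx
proof
  show "finite E" by (rule finite_E)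
  fix e assume e: "e \<in> E"
  then show "finite e" using set_es by auto
  show "card e \<le> rank E" using e finite_E by (auto simp: rank_def)
next
  show "inj_on idx (\<Union>E)" unfolding set_L[symmetric] by (metis inj_onI nth_idx)
  fix v assume "v \<in> \<Union>E"
  then show "idx v < Suc (length L)" unfolding set_L[symmetric] by (simp add: less_SucI)
qed (rule K_pos)

lemma length_edge: "e \<in> set es \<Longrightarrow> length e \<le> rank E"
proof -
  assume "e \<in> set es"
  then have "set e \<in> E" "distinct e" using set_es enum by (auto simp: enumerates_def)
  then show ?thesis using card_le distinct_card by metis
qed

text \<open>Digit \<open>a\<close> of round \<open>t\<close>. For \<open>c < pw t 0\<close> and
  \<open>a \<le> length L\<close>, the address \<open>c + pw t a\<close> determines \<open>c\<close>
  and \<open>a\<close> and lies between \<open>pw t 0\<close> and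
  \<open>pw (Suc t) 0\<close>.\<close>

definition pw :: "nat \<Rightarrow> nat \<Rightarrow> nat" where
  "pw t a = 2 ^ (t * Suc (length L) + a)"

lemma pw_inj:
  assumes "c < pw t 0" "c' < pw t 0"
  shows "c + pw t a = c' + pw t b \<longleftrightarrow> c = c' \<and> a = b"
  using add_mult_cancel_less[of c "pw t 0" c' "2 ^ a" "2 ^ b"] assms
  by (auto simp: pw_def power_add)

lemma pw_inj_int:
  assumes "c < pw t 0" "c' < pw t 0"
  shows "int c + int (pw t a) = int c' + int (pw t b) \<longleftrightarrow> c = c' \<and> a = b"
  using pw_inj[OF assms, of a b] by (metis of_nat_add of_nat_eq_iff)

lemma pw_Suc: "pw (Suc t) 0 = pw t (length L) + pw t (length L)"
  by (simp add: pw_def power_add algebra_simps)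

lemma pw_less:
  assumes "c < pw t 0" "a \<le> length L" shows "c + pw t a < pw (Suc t) 0"
proof -
  have "pw t a \<le> pw t (length L)" "pw t 0 \<le> pw t (length L)" using assms(2)
    by (auto simp: pw_def intro: power_increasing)
  then show ?thesis using assms(1) by (simp add: pw_Suc)
qed

lemma code_less_pw [simp]: "e \<in> E \<Longrightarrow> g t e < pw t 0"
  using code_less[of e t] by (simp add: pw_def)

definition found :: "nat \<Rightarrow> nat set" where
  "found t = (\<Union>t'<t. \<Union>e\<in>E. e \<inter> hv t' e)"

lemma found_Suc: "found (Suc t) = found t \<union> (\<Union>e\<in>E. e \<inter> hv t e)"
  by (auto simp: found_def lessThan_Suc)

definition base :: "state \<Rightarrow> bool" where
  "base s \<longleftrightarrow> reg s ''n'' = int (length L) \<and> (\<forall>a<length L. arr s VL (int a) = int (L ! a)) \<and>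
     (\<forall>i\<in>{6..11}. \<forall>a\<ge>0. arr s i a = 0) \<and> reg s ''nt'' = 0 \<and> reg s ''nu'' = 0 \<and> reg s ''answer'' = 0"

lemma base_upd [simp]: "x \<notin> {''n'', ''nt'', ''nu'', ''answer''} \<Longrightarrow> base (upd s x v) = base s"
  unfolding base_def by auto

lemma base_put [simp]: "i \<in> {0, 1, 3, 4, 5} \<Longrightarrow> base (put s i a v) = base s"
  unfolding base_def by auto

definition powers_ok :: "nat \<Rightarrow> state \<Rightarrow> bool" where
  "powers_ok t s \<longleftrightarrow> (\<forall>v\<in>set L. arr s PW (int v) = int (pw t (idx v)))"

lemma powers_ok_upd [simp]: "powers_ok t (upd s x v) = powers_ok t s"
  by (simp add: powers_ok_def)

lemma powers_ok_put [simp]: "i \<in> {1..15} \<Longrightarrow> powers_ok t (put s i a v) = powers_ok t s"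
  by (simp add: powers_ok_def)

text \<open>\<open>GE\<close> is overwritten in place, so the first \<open>i\<close> hyperedges
  already carry their new code. This is safe because the counts of the round are complete by
  then.\<close>

definition codes_ok :: "nat \<Rightarrow> nat \<Rightarrow> state \<Rightarrow> bool" where
  "codes_ok t i s \<longleftrightarrow> (\<forall>j<length es. arr s GE (int j) = int (g (if j < i then Suc t else t) (set (es ! j))))"

lemma codes_ok_upd [simp]: "codes_ok t i (upd s x v) = codes_ok t i s"
  by (simp add: codes_ok_def)

lemma codes_ok_put [simp]: "j \<in> {0, 1, 2, 4, 5} \<Longrightarrow> codes_ok t i (put s j a v) = codes_ok t i s"
  by (auto simp: codes_ok_def)

definition marks_ok :: "nat set \<Rightarrow> state \<Rightarrow> bool" where
  "marks_ok X s \<longleftrightarrow> (\<forall>v\<in>set L. arr s INU (int v) = of_bool (v \<in> X))"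

lemma marks_ok_upd [simp]: "marks_ok X (upd s x v) = marks_ok X s"
  by (simp add: marks_ok_def)

lemma marks_ok_put [simp]: "i \<in> {0} \<union> {2..15} \<Longrightarrow> marks_ok X (put s i a v) = marks_ok X s"
  by (auto simp: marks_ok_def)

text \<open>All addresses used so far lie below \<open>b\<close>, so the next round finds its part
  of \<open>DICT\<close> still zero.\<close>

definition dict_zero :: "nat \<Rightarrow> state \<Rightarrow> bool" where
  "dict_zero b s \<longleftrightarrow> (\<forall>a\<ge>int b. arr s DICT a = 0)"

lemma dict_zero_upd [simp]: "dict_zero b (upd s x v) = dict_zero b s"
  by (simp add: dict_zero_def)

lemma dict_zero_put [simp]: "i \<in> {0..4} \<union> {6..15} \<Longrightarrow> dict_zero b (put s i a v) = dict_zero b s"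
  by (auto simp: dict_zero_def)

lemma dict_zero_put_DICT: "dict_zero b s \<Longrightarrow> a < int b \<Longrightarrow> dict_zero b (put s DICT a v)"
  by (auto simp: dict_zero_def)

definition round_inv :: "nat \<Rightarrow> state \<Rightarrow> bool" where
  "round_inv t s \<longleftrightarrow> inp s \<and> base s \<and> (0 < t \<longrightarrow> powers_ok (t - 1) s) \<and> codes_ok t 0 s \<and>
     marks_ok (found t) s \<and> dict_zero (pw t 0) s \<and> reg s ''cur'' = int (pw t 0)"

definition tables :: "nat \<Rightarrow> nat set set \<Rightarrow> (nat \<Rightarrow> nat \<Rightarrow> nat) \<Rightarrow> state \<Rightarrow> bool" where
  "tables t D f s \<longleftrightarrow> dict_zero (pw (Suc t) 0) s \<and>
     (\<forall>c<pw t 0. arr s DICT (int c + int (pw t (length L))) = int (card {e\<in>D. g t e = c}) \<and>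
       (\<forall>v\<in>set L. arr s DICT (int c + int (pw t (idx v))) = int (2 * K * f c v)))"

lemma tables_upd [simp]: "tables t D f (upd s x v) = tables t D f s"
  by (simp add: tables_def)

lemma tables_put [simp]: "i \<in> {0..4} \<Longrightarrow> tables t D f (put s i a v) = tables t D f s"
  by (auto simp: tables_def)

section \<open>Correctness of the refinement rounds\<close>

lemma run_assign_powers:
  assumes "inp s" "base s" "codes_ok t 0 s" "marks_ok X s" "dict_zero b s" "reg s ''cur'' = int (pw t 0)"
     "reg s ''t'' = x"
  shows "run assign_powers s (\<lambda>u s'. u \<le> length L * 600 + 5 \<and> inp s' \<and> base s' \<and> codes_ok t 0 s' \<and>
    marks_ok X s' \<and> dict_zero b s' \<and> reg s' ''cur'' = int (pw t (length L)) \<and> powers_ok t s' \<and> reg s' ''t'' = x)"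
proof -
  let ?I = "\<lambda>i s. inp s \<and> base s \<and> codes_ok t 0 s \<and> marks_ok X s \<and> dict_zero b s \<and> reg s ''t'' = x \<and>
     reg s ''cur'' = int (pw t i) \<and> (\<forall>l<i. l < length L \<longrightarrow> arr s PW (int (L ! l)) = int (pw t l))"
  have "run assign_powers s (\<lambda>u s'. u \<le> length L * (570 + atime (Reg ''n'') + 6) + atime (Reg ''n'') + 4 \<and>
     ?I (length L) s')"
    unfolding assign_powers_def
  proof (rule run_for_upto[where I = ?I])
    fix i s assume i: "i < length L" "?I i s" "reg s ''i'' = int i"
    then have v: "arr s VL (int i) = int (L ! i)" by (simp add: base_def)
    have "L ! l \<noteq> L ! i" if "l < i" for l using that i dist_L by (simp add: nth_eq_iff_index_eq)
    then show "run assign_power s (\<lambda>u s'. u \<le> 570 \<and> ?I (Suc i) s' \<and> reg s' ''i'' = int i)"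
      using i v by (auto simp: assign_power_def less_Suc_eq pw_def)
  qed (use assms in \<open>auto simp: base_def\<close>)
  then show ?thesis
  proof (rule run_mono, goal_cases)
    case (1 u s')
    then have "arr s' PW (int v) = int (pw t (idx v))" if "v \<in> set L" for v
      using idx_less_length[OF that] nth_idx[OF that] by metis
    then show ?case using 1 by (simp add: powers_ok_def algebra_simps)
  qed
qed

definition prefix :: "nat \<Rightarrow> nat set set" where
  "prefix i = set (take i (map set es))"

lemma card_prefix_Suc: "i < length es \<Longrightarrow>
  card {e\<in>prefix (Suc i). P e} = card {e\<in>prefix i. P e} + of_bool (P (set (es ! i)))"
  unfolding prefix_def using card_filter_take_Suc[OF dist_es, of i P] by simp

lemma prefix_0 [simp]: "prefix 0 = {}" and prefix_all [simp]: "prefix (length es) = E"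
  using set_es by (simp_all add: prefix_def)

text \<open>The count halfway through the double loop, made so that the end of hyperedge
  \<open>i\<close> coincides with the start of the next one (\<open>incidences_end\<close>).\<close>

definition incidences :: "nat \<Rightarrow> nat \<Rightarrow> nat \<Rightarrow> nat \<Rightarrow> nat \<Rightarrow> nat" where
  "incidences t i l c v = card {e\<in>prefix i. g t e = c \<and> v \<in> e} +
     of_bool (i < length es \<and> g t (set (es ! i)) = c \<and> v \<in> set (take l (es ! i)))"

lemma incidences_Suc: "i < length es \<Longrightarrow> l < length (es ! i) \<Longrightarrow>
   incidences t i (Suc l) c v = incidences t i l c v + of_bool (g t (set (es ! i)) = c \<and> v = es ! i ! l)"
  using dist_edge[of i] by (auto simp: incidences_def take_Suc_conv_app_nth in_set_conv_nth nth_eq_iff_index_eq)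

lemma incidences_end: "i < length es \<Longrightarrow> incidences t i (length (es ! i)) c v = incidences t (Suc i) 0 c v"
  by (simp add: incidences_def card_prefix_Suc)

lemma run_count_classes:
  assumes s: "inp s" "base s" "codes_ok t 0 s" "marks_ok X s" "powers_ok t s" "dict_zero (pw t 0) s"
     "reg s ''cur'' = int (pw (Suc t) 0)" "reg s ''sz'' = int (pw t (length L))" "reg s ''t'' = x"
  shows "run count_classes s (\<lambda>u s'. u \<le> length es * (rank E * 2000 + 500) + 11 \<and>
    inp s' \<and> base s' \<and> codes_ok t 0 s' \<and> marks_ok X s' \<and> powers_ok t s' \<and>
    tables t E (\<lambda>c v. card {e\<in>E. g t e = c \<and> v \<in> e}) s' \<and>
    reg s' ''cur'' = int (pw (Suc t) 0) \<and> reg s' ''sz'' = int (pw t (length L)) \<and> reg s' ''t'' = x)"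
proof -
  let ?K = "\<lambda>s. base s \<and> codes_ok t 0 s \<and> marks_ok X s \<and> powers_ok t s \<and>
     reg s ''cur'' = int (pw (Suc t) 0) \<and> reg s ''sz'' = int (pw t (length L)) \<and> reg s ''t'' = x"
  let ?I = "\<lambda>i s. ?K s \<and> tables t (prefix i) (incidences t i 0) s"
  \<comment> \<open>The class size is increased before the entries are scanned, hence
    \<open>prefix (Suc i)\<close> next to \<open>incidences t i l\<close>.\<close>
  let ?J = "\<lambda>i l s. ?K s \<and> tables t (prefix (Suc i)) (incidences t i l) s \<and>
     reg s ''c'' = int (g t (set (es ! i)))"
  have "run count_classes s (\<lambda>u s'. u \<le> length es * (400 + rank E * (1900 + 7) + 1 + 20) + 11 \<and> inp s' \<and>
     ?I (length es) s')"
    unfolding count_classes_def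
  proof (rule run_for_edges[where I = ?I and J = ?J], goal_cases)
    case (1 i s)
    let ?c = "g t (set (es ! i))"
    have c: "arr s GE (int i) = int ?c" "?c < pw t 0" using 1 by (simp_all add: codes_ok_def)
    have lt: "int ?c + int (pw t (length L)) < int (pw (Suc t) 0)"
      using pw_less[OF c(2), of "length L"] by simp
    let ?s = "put (upd s ''c'' (int ?c)) DICT (int ?c + int (pw t (length L)))
           (arr s DICT (int ?c + int (pw t (length L))) + 1)"
    have "tables t (prefix (Suc i)) (incidences t i 0) ?s"
      unfolding tables_def
    proof (intro conjI allI impI ballI)
      show "dict_zero (pw (Suc t) 0) ?s"
        using 1 lt by (intro dict_zero_put_DICT) (simp_all add: tables_def)
    next
      fix c' assume "c' < pw t 0"
      then show "arr ?s DICT (int c' + int (pw t (length L))) =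
         int (card {e\<in>prefix (Suc i). g t e = c'})"
        using 1 c by (auto simp: tables_def card_prefix_Suc)
    next
      fix c' v assume "c' < pw t 0" "v \<in> set L"
      moreover have "idx v \<noteq> length L" using idx_less_length[OF \<open>v \<in> set L\<close>] by simp
      ultimately show "arr ?s DICT (int c' + int (pw t (idx v))) =
         int (2 * K * incidences t i 0 c' v)"
        using 1 c by (auto simp: tables_def pw_inj_int)
    qed
    then show ?case using 1 c by simp
  next
    case (2 i l s)
    let ?c = "g t (set (es ! i))" and ?v = "es ! i ! l"
    have v: "?v \<in> set L" using edge_subset_L 2 by simp
    have c: "?c < pw t 0" using 2 by simp
    have k: "mem s 0 = int K" using 2 by (simp add: inp_def)
    have p: "arr s PW (int ?v) = int (pw t (idx ?v))" using 2 v by (simp add: powers_ok_def)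
    let ?a = "int ?c + int (pw t (idx ?v))"
    have lt: "?a < int (pw (Suc t) 0)"
      using pw_less[OF c, of "idx ?v"] idx_less_length[OF v] by simp
    let ?s = "put s DICT ?a (arr s DICT ?a + (int K + int K))"
    have "tables t (prefix (Suc i)) (incidences t i (Suc l)) ?s"
      unfolding tables_def
    proof (intro conjI allI impI ballI)
      show "dict_zero (pw (Suc t) 0) ?s"
        using 2 lt by (intro dict_zero_put_DICT) (simp_all add: tables_def)
    next
      fix c' assume "c' < pw t 0"
      moreover have "idx ?v \<noteq> length L" using idx_less_length[OF v] by simp
      ultimately show "arr ?s DICT (int c' + int (pw t (length L))) = int (card {e\<in>prefix (Suc i). g t e = c'})"
        using 2 c by (auto simp: tables_def pw_inj_int)
    next
      fix c' v' assume *: "c' < pw t 0" "v' \<in> set L"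
      have "idx v' = idx ?v \<longleftrightarrow> v' = ?v" using * v by (metis nth_idx)
      then have "arr ?s DICT (int c' + int (pw t (idx v'))) =
          int (2 * K * incidences t i l c' v') + (if ?c = c' \<and> v' = ?v then 2 * int K else 0)"
        using 2 c * by (auto simp: tables_def pw_inj_int)
      then show "arr ?s DICT (int c' + int (pw t (idx v'))) = int (2 * K * incidences t i (Suc l) c' v')"
        using 2 by (simp add: incidences_Suc distrib_left)
    qed
    then show ?case using 2 k p by simp
  next
    case (3 i s)
    have "incidences t i (length (es ! i)) = incidences t (Suc i) 0"
      using 3 incidences_end by blast
    then show ?case using 3 by simp
  next
    case 10
    have "arr s DICT (int c + int (pw t a)) = 0" for c a
    proof -
      have "pw t 0 \<le> pw t a" by (simp add: pw_def)
      then show ?thesis using s(6) by (simp add: dict_zero_def)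
    qed
    moreover have "pw t 0 \<le> pw (Suc t) 0" unfolding pw_def by (rule power_increasing) simp_all
    then have "dict_zero (pw (Suc t) 0) s" using s(6) by (simp add: dict_zero_def)
    ultimately show ?case using s by (simp add: tables_def incidences_def)
  qed (use s length_edge in simp_all)
  then show ?thesis
    by (rule run_mono) (auto simp: algebra_simps incidences_def[abs_def])
qed

lemma heavy_iff: "i < length es \<Longrightarrow> v \<in> hv t (set (es ! i)) \<longleftrightarrow>
   card {e\<in>E. g t e = g t (set (es ! i))} \<le> 2 * K * card {e\<in>E. g t e = g t (set (es ! i)) \<and> v \<in> e}"
proof -
  assume "i < length es"
  then have "cls t (set (es ! i)) \<noteq> {}" using cls_self[OF edge_in_E, of i t] by blast
  then show ?thesis by (simp add: heavy_def edge_class_def conj_assoc)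
qed

lemma marks_ok_insert:
  "marks_ok X s \<Longrightarrow> marks_ok (insert v X) (put s INU (int v) 1)"
  by (auto simp: marks_ok_def)

lemma codes_ok_step:
  "codes_ok t i s \<Longrightarrow> i < length es \<Longrightarrow> v = int (g (Suc t) (set (es ! i))) \<Longrightarrow>
     codes_ok t (Suc i) (put s GE (int i) v)"
  by (auto simp: codes_ok_def less_Suc_eq)

lemma codes_ok_end: "codes_ok t (length es) s \<Longrightarrow> codes_ok (Suc t) 0 s"
  by (simp add: codes_ok_def)

text \<open>A hyperedge lists no vertex twice and \<open>idx\<close> separates vertices, so a new
  entry sets a digit that was still 0. Codes can therefore be built by addition.\<close>

lemma pw_encode_take_Suc:
  assumes i: "i < length es" and l: "l < length (es ! i)"
  shows "pw t 0 * set_encode (idx ` (set (take (Suc l) (es ! i)) \<inter> H)) =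
    pw t 0 * set_encode (idx ` (set (take l (es ! i)) \<inter> H)) + (if es ! i ! l \<in> H then pw t (idx (es ! i ! l)) else 0)"
proof -
  let ?v = "es ! i ! l" and ?Y = "set (take l (es ! i))"
  have v: "?v \<in> set L" using edge_subset_L i l .
  have take_Suc: "set (take (Suc l) (es ! i)) = insert ?v ?Y"
    using l by (simp add: take_Suc_conv_app_nth)
  have "?v \<notin> ?Y" using i l dist_edge[of i] by (auto simp: in_set_conv_nth nth_eq_iff_index_eq)
  moreover have "?Y \<subseteq> set L" unfolding set_L
    using edge_in_E[OF i] set_take_subset[of l "es ! i"] by blast
  ultimately have "idx ?v \<noteq> idx v'" if "v' \<in> ?Y" for v'
    using that v nth_idx by (metis subsetD)
  then have "idx ?v \<notin> idx ` (?Y \<inter> H)" by blast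
  then have "set_encode (insert (idx ?v) (idx ` (?Y \<inter> H))) = 2 ^ idx ?v + set_encode (idx ` (?Y \<inter> H))"
    by (intro set_encode_insert) auto
  then show ?thesis unfolding take_Suc by (simp add: pw_def power_add distrib_left)
qed

lemma run_refine_classes:
  assumes s: "inp s" "base s" "codes_ok t 0 s" "marks_ok (found t) s" "powers_ok t s"
     "tables t E (\<lambda>c v. card {e\<in>E. g t e = c \<and> v \<in> e}) s"
     "reg s ''cur'' = int (pw (Suc t) 0)" "reg s ''sz'' = int (pw t (length L))" "reg s ''t'' = x"
  shows "run refine_classes s (\<lambda>u s'. u \<le> length es * (rank E * 2000 + 500) + 11 \<and>
    inp s' \<and> base s' \<and> codes_ok (Suc t) 0 s' \<and> marks_ok (found (Suc t)) s' \<and> powers_ok t s' \<and>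
    dict_zero (pw (Suc t) 0) s' \<and> reg s' ''cur'' = int (pw (Suc t) 0) \<and> reg s' ''t'' = x)"
proof -
  let ?K = "\<lambda>s. base s \<and> powers_ok t s \<and> tables t E (\<lambda>c v. card {e\<in>E. g t e = c \<and> v \<in> e}) s \<and>
     reg s ''cur'' = int (pw (Suc t) 0) \<and> reg s ''sz'' = int (pw t (length L)) \<and> reg s ''t'' = x"
  let ?M = "\<lambda>i. found t \<union> (\<Union>e\<in>prefix i. e \<inter> hv t e)"
  let ?I = "\<lambda>i s. ?K s \<and> codes_ok t i s \<and> marks_ok (?M i) s"
  let ?X = "\<lambda>i l. set (take l (es ! i)) \<inter> hv t (set (es ! i))"
  let ?J = "\<lambda>i l s. ?K s \<and> codes_ok t i s \<and> marks_ok (?M i \<union> ?X i l) s \<and>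
     reg s ''c'' = int (g t (set (es ! i))) \<and>
     reg s ''g'' = int (g t (set (es ! i)) + pw t 0 * set_encode (idx ` ?X i l))"
  have "run refine_classes s (\<lambda>u s'. u \<le> length es * (100 + rank E * (1900 + 7) + 100 + 20) + 11 \<and> inp s' \<and>
     ?I (length es) s')"
    unfolding refine_classes_def
  proof (rule run_for_edges[where I = ?I and J = ?J], goal_cases)
    case (1 i s)
    then have "arr s GE (int i) = int (g t (set (es ! i)))" by (simp add: codes_ok_def)
    then show ?case using 1 by simp
  next
    case (2 i l s)
    let ?e = "set (es ! i)" and ?v = "es ! i ! l"
    let ?c = "g t ?e"
    have v: "?v \<in> set L" using edge_subset_L 2 by simp
    have c: "?c < pw t 0" using 2 by simp
    have p: "arr s PW (int ?v) = int (pw t (idx ?v))" using 2 v by (simp add: powers_ok_def)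
    have d: "arr s DICT (int ?c + int (pw t (length L))) = int (card {e\<in>E. g t e = ?c})"
      "arr s DICT (int ?c + int (pw t (idx ?v))) = int (2 * K * card {e\<in>E. g t e = ?c \<and> ?v \<in> e})"
      using 2 c v by (simp_all add: tables_def)
    have take_Suc: "set (take (Suc l) (es ! i)) = insert ?v (set (take l (es ! i)))"
      using 2 by (simp add: take_Suc_conv_app_nth)
    show ?case
    proof (cases "?v \<in> hv t ?e")
      case True
      then have "card {e\<in>E. g t e = ?c} \<le> 2 * K * card {e\<in>E. g t e = ?c \<and> ?v \<in> e}"
        using heavy_iff 2 by blast
      then have b: "\<not> arr s DICT (int ?c + int (pw t (idx ?v))) < arr s DICT (int ?c + int (pw t (length L)))"
        unfolding d by linarith
      have X: "?X i (Suc l) = insert ?v (?X i l)" using take_Suc True by auto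
      have enc: "pw t 0 * set_encode (idx ` ?X i (Suc l)) = pw t 0 * set_encode (idx ` ?X i l) + pw t (idx ?v)"
        using pw_encode_take_Suc 2 True by simp
      let ?y = "reg s ''g'' + int (pw t (idx ?v))"
      let ?s = "put (upd s ''g'' ?y) INU (int ?v) 1"
      have "?M i \<union> ?X i (Suc l) = insert ?v (?M i \<union> ?X i l)" unfolding X by auto
      then have M: "marks_ok (?M i \<union> ?X i (Suc l)) ?s"
        using marks_ok_insert[of "?M i \<union> ?X i l" "upd s ''g'' ?y" ?v] 2 by simp
      have y: "?y = int (g t ?e + pw t 0 * set_encode (idx ` ?X i (Suc l)))"
        unfolding enc using 2 by simp
      have J: "?J i (Suc l) ?s" using M y 2 by (intro conjI) simp_all
      have "run refine_vertex s (\<lambda>u s'. u \<le> 1900 \<and> s' = ?s)"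
        using 2 p b by (simp add: refine_vertex_def)
      then show ?thesis by (rule run_mono) (use J 2 in simp)
    next
      case False
      then have "\<not> card {e\<in>E. g t e = ?c} \<le> 2 * K * card {e\<in>E. g t e = ?c \<and> ?v \<in> e}"
        using heavy_iff 2 by blast
      then have b: "arr s DICT (int ?c + int (pw t (idx ?v))) < arr s DICT (int ?c + int (pw t (length L)))"
        unfolding d by linarith
      have X: "?X i (Suc l) = ?X i l" using take_Suc False by auto
      show ?thesis unfolding X using 2 p b by (simp add: refine_vertex_def)
    qed
  next
    case (3 i s)
    have "prefix (Suc i) = insert (set (es ! i)) (prefix i)"
      using 3 by (simp add: prefix_def take_Suc_conv_app_nth)
    then have "?M (Suc i) = ?M i \<union> ?X i (length (es ! i))" by auto
    moreover have "g (Suc t) (set (es ! i)) = g t (set (es ! i)) +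
        pw t 0 * set_encode (idx ` ?X i (length (es ! i)))" by (simp add: pw_def)
    then have "reg s ''g'' = int (g (Suc t) (set (es ! i)))" using 3 by metis
    then have "codes_ok t (Suc i) (put s GE (int i) (reg s ''g''))"
      using 3 by (intro codes_ok_step) auto
    ultimately show ?case using 3 by simp
  qed (use s length_edge in simp_all)
  then show ?thesis
    by (rule run_mono) (auto simp: algebra_simps tables_def found_Suc codes_ok_end)
qed

lemma run_refinement_rounds:
  assumes s: "inp s" "base s" "\<And>i a. i \<in> {0, 1, 3, 4, 5} \<Longrightarrow> 0 \<le> a \<Longrightarrow> arr s i a = 0"
  shows "run refinement_rounds s (\<lambda>u s'.
     u \<le> K * (length L * 600 + length es * (rank E * 4000 + 1000) + 50) + 10 \<and> round_inv K s')"
proof -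
  have "run refinement_rounds s (\<lambda>u s'. u \<le> 2 +
     (K * ((length L * 600 + length es * (rank E * 4000 + 1000) + 40) + atime (Load (Const 0)) + 6)
       + atime (Load (Const 0)) + 4) \<and> round_inv K s')"
    unfolding refinement_rounds_def run_Seq run_Assign
  proof (rule run_mono, rule run_for_upto[where I = round_inv and N = K
        and T = "length L * 600 + length es * (rank E * 4000 + 1000) + 40"])
    fix t s assume t: "t < K" "round_inv t s" "reg s ''t'' = int t"
    show "run refinement_round s (\<lambda>u s'. u \<le> length L * 600 + length es * (rank E * 4000 + 1000) + 40 \<and>
        round_inv (Suc t) s' \<and> reg s' ''t'' = int t)"
      unfolding refinement_round_def run_Seq run_Assign
    proof (rule run_mono[OF run_assign_powers[of s t "found t" "pw t 0" "int t"]], goal_cases)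
      case (8 t1 s1)
      let ?s = "upd (upd s1 ''sz'' (reg s1 ''cur'')) ''cur'' (reg s1 ''cur'' + reg s1 ''cur'')"
      have "run count_classes ?s (\<lambda>u s'. u \<le> length es * (rank E * 2000 + 500) + 11 \<and>
        inp s' \<and> base s' \<and> codes_ok t 0 s' \<and> marks_ok (found t) s' \<and> powers_ok t s' \<and>
        tables t E (\<lambda>c v. card {e\<in>E. g t e = c \<and> v \<in> e}) s' \<and>
        reg s' ''cur'' = int (pw (Suc t) 0) \<and> reg s' ''sz'' = int (pw t (length L)) \<and> reg s' ''t'' = int t)"
        by (rule run_count_classes) (use 8 in \<open>simp_all add: pw_Suc\<close>)
      then have "run (Seq count_classes refine_classes) ?s (\<lambda>u s'.
          u \<le> length es * (rank E * 2000 + 500) + 11 + (length es * (rank E * 2000 + 500) + 11) \<and>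
          round_inv (Suc t) s' \<and> reg s' ''t'' = int t)"
        unfolding run_Seq
      proof (rule run_mono, goal_cases)
        case (1 t3 s3)
        show ?case
          by (rule run_mono[OF run_refine_classes[of s3 t "int t"]]) (use 1 in \<open>auto simp: round_inv_def\<close>)
      qed
      then show ?case unfolding run_Seq
        by (auto elim!: run_mono simp: algebra_simps intro: order.trans) (use 8 in linarith)
    qed (use t in \<open>auto simp: round_inv_def\<close>)
  next
    show "round_inv 0 (upd s ''cur'' (aval (Const 1) s))"
      using s by (simp add: round_inv_def codes_ok_def marks_ok_def found_def dict_zero_def pw_def)
  qed (auto simp: round_inv_def inp_def)
  then show ?thesis by (rule run_mono) (auto simp: algebra_simps)
qed

end

section \<open>Merging edges\<close>

definition collect_if_frequent :: com where
  "collect_if_frequent = com.If (Less (Const 0) (Arr INU (Arr VL (Reg ''i''))))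
     (Seq (Put UL (Reg ''nu'') (Arr VL (Reg ''i''))) (Inc ''nu'')) Skip"

definition collect_frequent :: com where
  "collect_frequent = for_upto ''i'' (Reg ''n'') collect_if_frequent"

text \<open>A multiplicity that is still 0 reveals a new trace, so traces are never compared.
  \<open>GE\<close> can be overwritten since the class codes have served their purpose.\<close>

definition collect_traces :: com where
  "collect_traces = for_edges
     (Seq (Assign ''g'' (Reg ''cur'')) (Assign ''a'' (Reg ''p'')))
     (com.If (Less (Const 0) (Arr INU Vtx)) (Assign ''g'' (Add (Reg ''g'') (Arr PW Vtx))) Skip)
     (Seq (com.If (Less (Arr DICT (Reg ''g'')) (Const 1))
         (Seq (Put GE (Reg ''nt'') (Reg ''a'')) (Seq (Put HE (Reg ''nt'') (Reg ''g'')) (Inc ''nt''))) Skip)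
       (Put DICT (Reg ''g'') (Add (Arr DICT (Reg ''g'')) (Const 1))))"

context program
begin

definition us :: "nat list" where
  "us = filter (\<lambda>v. v \<in> frequent) L"

lemma set_us: "set us = frequent"
  using frequent_subset set_L by (auto simp: us_def)

lemma distinct_us: "distinct us"
  by (simp add: us_def dist_L)

definition zeros :: "state \<Rightarrow> bool" where
  "zeros s \<longleftrightarrow> (\<forall>i\<in>{6..11}. \<forall>a\<ge>0. arr s i a = 0) \<and> reg s ''answer'' = 0"

lemma zeros_upd [simp]: "x \<noteq> ''answer'' \<Longrightarrow> zeros (upd s x v) = zeros s"
  by (simp add: zeros_def)

lemma zeros_put [simp]: "i \<in> {0..5} \<union> {12..15} \<Longrightarrow> zeros (put s i a v) = zeros s"
  by (auto simp: zeros_def)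

definition frequent_ok :: "state \<Rightarrow> bool" where
  "frequent_ok s \<longleftrightarrow> reg s ''nu'' = int (length us) \<and> (\<forall>a<length us. arr s UL (int a) = int (us ! a))"

lemma frequent_ok_upd [simp]: "x \<noteq> ''nu'' \<Longrightarrow> frequent_ok (upd s x v) = frequent_ok s"
  by (simp add: frequent_ok_def)

lemma frequent_ok_put [simp]: "i \<in> {0..12} \<Longrightarrow> frequent_ok (put s i a v) = frequent_ok s"
  by (auto simp: frequent_ok_def)

definition kernel_ok :: "state \<Rightarrow> bool" where
  "kernel_ok s \<longleftrightarrow> zeros s \<and> powers_ok (K - 1) s \<and> marks_ok frequent s \<and> reg s ''cur'' = int (pw K 0)"

lemma kernel_ok_upd [simp]: "x \<notin> {''cur'', ''answer''} \<Longrightarrow> kernel_ok (upd s x v) = kernel_ok s"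
  by (auto simp: kernel_ok_def)

lemma kernel_ok_put [simp]: "i \<in> {2..5} \<union> {12..15} \<Longrightarrow> kernel_ok (put s i a v) = kernel_ok s"
  by (auto simp: kernel_ok_def)

lemma run_collect_frequent:
  assumes s: "round_inv K s"
  shows "run collect_frequent s (\<lambda>u s'. u \<le> length L * 1500 + 5 \<and> inp s' \<and> kernel_ok s' \<and>
    dict_zero (pw K 0) s' \<and> reg s' ''nt'' = 0 \<and> frequent_ok s')"
proof -
  let ?f = "\<lambda>i. filter (\<lambda>v. v \<in> frequent) (take i L)"
  let ?I = "\<lambda>i s. inp s \<and> kernel_ok s \<and> dict_zero (pw K 0) s \<and> reg s ''nt'' = 0 \<and>
     reg s ''n'' = int (length L) \<and> (\<forall>a<length L. arr s VL (int a) = int (L ! a)) \<and>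
     reg s ''nu'' = int (length (?f i)) \<and> (\<forall>a<length (?f i). arr s UL (int a) = int (?f i ! a))"
  have "run collect_frequent s (\<lambda>u s'. u \<le> length L * (1400 + atime (Reg ''n'') + 6) + atime (Reg ''n'') + 4 \<and>
     ?I (length L) s')"
    unfolding collect_frequent_def
  proof (rule run_for_upto[where I = ?I])
    fix i s assume i: "i < length L" "?I i s" "reg s ''i'' = int i"
    then have v: "arr s VL (int i) = int (L ! i)" by simp
    have m: "arr s INU (int (L ! i)) = of_bool (L ! i \<in> frequent)"
      using i by (simp add: kernel_ok_def marks_ok_def)
    show "run collect_if_frequent s (\<lambda>u s'. u \<le> 1400 \<and> ?I (Suc i) s' \<and> reg s' ''i'' = int i)"
      using i v m by (auto simp: collect_if_frequent_def take_Suc_conv_app_nth nth_append less_Suc_eq)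
  next
    show "?I 0 s"
      using s K_pos by (auto simp: round_inv_def base_def kernel_ok_def zeros_def found_def frequent_def)
  qed auto
  then show ?thesis by (rule run_mono) (auto simp: frequent_ok_def us_def)
qed

text \<open>\<open>PW\<close> still holds the powers of the last round, hence the factor
  \<open>pw (K - 1) 0\<close>. The offset \<open>pw K 0\<close> moves the codes beyond every
  \<open>DICT\<close> address used by the rounds.\<close>

definition tcode :: "nat set \<Rightarrow> nat" where
  "tcode X = pw K 0 + pw (K - 1) 0 * set_encode (idx ` X)"

lemma tcode_inj: "X \<subseteq> frequent \<Longrightarrow> Y \<subseteq> frequent \<Longrightarrow> tcode X = tcode Y \<longleftrightarrow> X = Y"
  using enc_inj[of X Y] frequent_subset by (auto simp: tcode_def pw_def)

abbreviation tr :: "nat \<Rightarrow> nat set" where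
  "tr j \<equiv> set (es ! j) \<inter> frequent"

definition weights_ok :: "nat \<Rightarrow> state \<Rightarrow> bool" where
  "weights_ok i s \<longleftrightarrow> (\<forall>X. X \<subseteq> frequent \<longrightarrow>
     arr s DICT (int (tcode X)) = int (card {e\<in>prefix i. e \<inter> frequent = X}))"

lemma weights_ok_upd [simp]: "weights_ok i (upd s x v) = weights_ok i s"
  by (simp add: weights_ok_def)

lemma weights_ok_put [simp]: "j \<in> {0..4} \<union> {6..15} \<Longrightarrow> weights_ok i (put s j a v) = weights_ok i s"
  by (auto simp: weights_ok_def)

lemma weights_ok_Suc:
  assumes "weights_ok i s" "i < length es" "a = int (tcode (tr i))" "v = arr s DICT a + 1"
  shows "weights_ok (Suc i) (put s DICT a v)"
  using assms by (auto simp: weights_ok_def card_prefix_Suc tcode_inj)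

definition reps_ok :: "nat \<Rightarrow> nat list \<Rightarrow> state \<Rightarrow> bool" where
  "reps_ok i rs s \<longleftrightarrow> length rs \<le> i \<and> reg s ''nt'' = int (length rs) \<and> distinct (map tr rs) \<and>
     tr ` set rs = tr ` {..<i} \<and> (\<forall>l<length rs. rs ! l < length es \<and>
       arr s GE (int l) = eaddr (rs ! l) \<and> arr s HE (int l) = int (tcode (tr (rs ! l))))"

lemma reps_ok_upd [simp]: "x \<noteq> ''nt'' \<Longrightarrow> reps_ok i rs (upd s x v) = reps_ok i rs s"
  by (simp add: reps_ok_def)

lemma reps_ok_put [simp]: "j \<in> {0..2} \<union> {5..15} \<Longrightarrow> reps_ok i rs (put s j a v) = reps_ok i rs s"
  by (auto simp: reps_ok_def)

lemma card_prefix_eq_0: "i \<le> length es \<Longrightarrow>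
  card {e\<in>prefix i. e \<inter> frequent = X} = 0 \<longleftrightarrow> X \<notin> tr ` {..<i}"
proof -
  assume "i \<le> length es"
  then have "prefix i = (\<lambda>j. set (es ! j)) ` {..<i}"
    by (simp add: prefix_def take_map nth_image[symmetric] image_image atLeast0LessThan)
  then have "{e\<in>prefix i. e \<inter> frequent = X} = {} \<longleftrightarrow> X \<notin> tr ` {..<i}" by auto
  moreover have "finite {e\<in>prefix i. e \<inter> frequent = X}" by (simp add: prefix_def)
  ultimately show ?thesis by (simp only: card_0_eq)
qed

lemma run_collect_traces:
  assumes s: "inp s" "kernel_ok s" "dict_zero (pw K 0) s" "reg s ''nt'' = 0" "frequent_ok s"
  shows "run collect_traces s (\<lambda>u s'. u \<le> length es * (rank E * 1000 + 1000) + 11 \<and> inp s' \<and>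
    zeros s' \<and> frequent_ok s' \<and> weights_ok (length es) s' \<and> (\<exists>rs. reps_ok (length es) rs s'))"
proof -
  let ?K = "\<lambda>i s. kernel_ok s \<and> frequent_ok s \<and> weights_ok i s \<and> (\<exists>rs. reps_ok i rs s)"
  let ?X = "\<lambda>i l. set (take l (es ! i)) \<inter> frequent"
  let ?J = "\<lambda>i l s. ?K i s \<and> reg s ''a'' = eaddr i \<and> reg s ''g'' = int (tcode (?X i l))"
  have "run collect_traces s (\<lambda>u s'. u \<le> length es * (10 + rank E * (500 + 7) + 500 + 20) + 11 \<and> inp s' \<and>
     ?K (length es) s')"
    unfolding collect_traces_def
  proof (rule run_for_edges[where I = ?K and J = ?J], goal_cases)
    case (1 i s)
    then show ?case by (simp add: kernel_ok_def tcode_def)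
  next
    case (2 i l s)
    let ?v = "es ! i ! l"
    have v: "?v \<in> set L" using edge_subset_L 2 by simp
    have m: "arr s INU (int ?v) = of_bool (?v \<in> frequent)" "arr s PW (int ?v) = int (pw (K - 1) (idx ?v))"
      using 2 v by (simp_all add: kernel_ok_def marks_ok_def powers_ok_def)
    have "tcode (?X i (Suc l)) = tcode (?X i l) + (if ?v \<in> frequent then pw (K - 1) (idx ?v) else 0)"
      using pw_encode_take_Suc[of i l "K - 1" frequent] 2 by (simp add: tcode_def)
    then show ?case using 2 m by simp
  next
    case (3 i s)
    then obtain rs where rs: "reps_ok i rs s" by blast
    have g: "reg s ''g'' = int (tcode (tr i))" using 3 by simp
    have d: "arr s DICT (int (tcode (tr i))) = int (card {e\<in>prefix i. e \<inter> frequent = tr i})"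
      using 3 by (simp add: weights_ok_def)
    have c: "card {e\<in>prefix i. e \<inter> frequent = tr i} = 0 \<longleftrightarrow> tr i \<notin> tr ` {..<i}"
      using 3 by (intro card_prefix_eq_0) simp
    let ?w = "int (card {e\<in>prefix i. e \<inter> frequent = tr i}) + 1"
    show ?case
    proof (cases "tr i \<in> tr ` {..<i}")
      case True
      let ?s = "put s DICT (int (tcode (tr i))) ?w"
      have "tr ` {..<Suc i} = tr ` {..<i}" using True by (auto simp: lessThan_Suc)
      then have "reps_ok (Suc i) rs s" using rs by (simp add: reps_ok_def)
      then have r: "reps_ok (Suc i) rs ?s" by simp
      have w: "weights_ok (Suc i) ?s" using 3 d by (intro weights_ok_Suc) simp_all
      show ?thesis using 3 True c d g r w by auto
    next
      case False
      let ?l = "int (length rs)"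
      let ?s1 = "upd (put (put s GE ?l (eaddr i)) HE ?l (int (tcode (tr i)))) ''nt'' (?l + 1)"
      let ?s = "put ?s1 DICT (int (tcode (tr i))) ?w"
      have "reps_ok (Suc i) (rs @ [i]) ?s1"
        unfolding reps_ok_def
      proof (intro conjI allI impI)
        show "distinct (map tr (rs @ [i]))" using rs False by (auto simp: reps_ok_def)
        show "tr ` set (rs @ [i]) = tr ` {..<Suc i}" using rs by (auto simp: reps_ok_def lessThan_Suc)
      qed (use rs 3 in \<open>auto simp: reps_ok_def nth_append less_Suc_eq\<close>)
      then have r: "reps_ok (Suc i) (rs @ [i]) ?s" by simp
      have w: "weights_ok (Suc i) ?s" using 3 d by (intro weights_ok_Suc) simp_all
      have nt: "reg s ''nt'' = ?l" using rs by (simp add: reps_ok_def)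
      show ?thesis using 3 False c d g r w nt by auto
    qed
  next
    case 10
    have "tcode X \<ge> pw K 0" for X by (simp add: tcode_def)
    then have "weights_ok 0 s" using s by (simp add: weights_ok_def dict_zero_def)
    moreover have "reps_ok 0 [] s" using s by (simp add: reps_ok_def)
    ultimately show ?case using s by blast
  qed (use s length_edge in simp_all)
  then show ?thesis by (rule run_mono) (auto simp: algebra_simps kernel_ok_def)
qed

end

section \<open>Searching\<close>

definition load_trace :: com where
  "load_trace = Seq (Assign ''p'' (Arr GE (Reg ''i''))) (Assign ''q'' (Add (Reg ''p'') (Load (Reg ''p''))))"

definition record_trace :: com where
  "record_trace = Seq (Put HIT (Add (Reg ''fr'') (Reg ''i'')) (Reg ''h''))
     (com.If (Less (Reg ''h'') (Const 1))
       (Seq (Assign ''z'' (Arr DICT (Arr HE (Reg ''i'')))) (Seq (Assign ''M'' (Add (Reg ''M'') (Reg ''z'')))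
         (Seq load_trace (scan (Put DEG Vtx (Add (Arr DEG Vtx) (Reg ''z'')))))))
       Skip)"

text \<open>Whether a node hits a trace follows from the parent's block and the node's last vertex
  \<open>u\<close>. As \<open>u\<close> is heavy, it lies in the representative iff it lies in the
  trace.\<close>

definition score_trace :: com where
  "score_trace = Seq load_trace (Seq (Assign ''h'' (Arr HIT (Add (Reg ''b'') (Reg ''i''))))
     (Seq (scan (com.If (And (Not (Less (Reg ''u'') Vtx)) (Not (Less Vtx (Reg ''u'')))) (Assign ''h'' (Const 1)) Skip))
       record_trace))"

text \<open>The product of the gain and \<open>k\<close> minus the depth, by repeated addition; this
  is the factor \<open>K\<close> per heavy vertex in \<open>node_time\<close>.\<close>

definition multiply_gain :: com where
  "multiply_gain = While (Less (Reg ''e'') (Load (Const 0)))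
     (Seq (Assign ''z'' (Add (Reg ''z'') (Arr DEG (Reg ''v'')))) (Inc ''e''))"

definition enqueue :: com where
  "enqueue = com.If (And (Less (Const 0) (Reg ''M'')) (Not (Less (Reg ''z'') (Reg ''M''))))
     (Seq (Put QV (Reg ''y'') (Reg ''v'')) (Seq (Put QB (Reg ''y'') (Reg ''fr''))
       (Seq (Put QD (Reg ''y'') (Add (Reg ''d'') (Const 1))) (Seq (Put QC (Reg ''y'') (Reg ''c'')) (Inc ''y'')))))
     Skip"

text \<open>Clearing \<open>DEG\<close> here prepares it for the next node. The cells of vertices
  outside \<open>UL\<close> keep growing, but no test of \<open>enqueue\<close> depends on
  them.\<close>

definition push_child :: com where
  "push_child = Seq (Assign ''v'' (Arr UL (Reg ''i''))) (Seq (Assign ''z'' (Const 0)) (Seq (Assign ''e'' (Reg ''d''))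
     (Seq multiply_gain (Seq (Put DEG (Reg ''v'') (Const 0)) enqueue))))"

text \<open>\<open>M\<close> is the residual, so every child has cost \<open>c + M\<close> whichever
  vertex is appended, and one value serves them all.\<close>

definition process_node :: com where
  "process_node = Seq (Assign ''u'' (Arr QV (Reg ''x''))) (Seq (Assign ''b'' (Arr QB (Reg ''x'')))
     (Seq (Assign ''d'' (Arr QD (Reg ''x''))) (Seq (Assign ''c'' (Arr QC (Reg ''x''))) (Seq (Assign ''M'' (Const 0))
     (Seq (for_upto ''i'' (Reg ''nt'') score_trace)
     (Seq (com.If (Less (Reg ''M'') (Const 1))
         (com.If (Less (Load (Const 1)) (Reg ''c'')) Skip (Assign ''answer'' (Const 1))) Skip)
     (Seq (Assign ''c'' (Add (Reg ''c'') (Reg ''M'')))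
     (Seq (for_upto ''i'' (Reg ''nu'') push_child)
     (Seq (Assign ''fr'' (Add (Reg ''fr'') (Reg ''nt''))) (Inc ''x''))))))))))"

text \<open>The root gets the last vertex \<open>-1\<close>, which names no vertex, and as its
  parent's block the zeros at offset 0. Blocks of processed nodes start at \<open>nt\<close>, just
  above them.\<close>

definition search_queue :: com where
  "search_queue = Seq (Assign ''fr'' (Reg ''nt'')) (Seq (Put QV (Const 0) (Const (-1)))
     (Seq (Assign ''x'' (Const 0)) (Seq (Assign ''y'' (Const 1))
       (While (Less (Reg ''x'') (Reg ''y'')) process_node))))"

abbreviation same_except :: "string set \<Rightarrow> state \<Rightarrow> state \<Rightarrow> bool" where
  "same_except X s' s \<equiv> \<forall>x. x \<notin> X \<longrightarrow> reg s' x = reg s x"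

section \<open>Weighted representatives and correctness of the search\<close>

locale search = program +
  fixes rs :: "nat list"
  assumes dist_rs: "distinct (map tr rs)" and tr_rs: "tr ` set rs = tr ` {..<length es}"
    and rs_less: "l < length rs \<Longrightarrow> rs ! l < length es"
begin

abbreviation "N \<equiv> length rs"
abbreviation "tree \<equiv> search_tree K E us"
abbreviation "children \<equiv> expand K E us"
abbreviation "no_gains s \<equiv> \<forall>v\<in>frequent. arr s DEG (int v) = 0"
abbreviation "rep l \<equiv> set (es ! (rs ! l))"

definition weight :: "nat \<Rightarrow> nat" where
  "weight l = card {e\<in>E. e \<inter> frequent = tr (rs ! l)}"

lemma E_eq: "E = (\<lambda>j. set (es ! j)) ` {..<length es}"
proof -
  have "set es = (!) es ` {..<length es}"
    using nth_image[of "length es" es] by (simp add: atLeast0LessThan)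
  then show ?thesis unfolding set_es[symmetric] set_map by (simp only: image_image)
qed

lemma N_eq: "N = card ((\<lambda>e. e \<inter> frequent) ` E)"
proof -
  have "set (map tr rs) = (\<lambda>e. e \<inter> frequent) ` E" using tr_rs by (auto simp: E_eq image_image)
  then show ?thesis using distinct_card[OF dist_rs] by simp
qed

lemma N_pos: "es \<noteq> [] \<Longrightarrow> 0 < N"
  using tr_rs by fastforce

text \<open>Every frequent vertex lies in one of the \<open>N\<close> traces. Hence the loop over
  the heavy vertices is charged to the incidences of the merged edges.\<close>

lemma frequent_le: "card frequent \<le> rank E * N"
proof -
  have "frequent = (\<Union>l<N. tr (rs ! l))"
  proof
    show "frequent \<subseteq> (\<Union>l<N. tr (rs ! l))"
    proof
      fix v assume v: "v \<in> frequent"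
      then obtain j where j: "j < length es" "v \<in> tr j"
        using frequent_subset by (auto simp: E_eq)
      then have "tr j \<in> tr ` set rs" using tr_rs by auto
      then obtain i where i: "i \<in> set rs" "tr j = tr i" by blast
      then obtain l where "l < N" "rs ! l = i" by (auto simp: in_set_conv_nth)
      then have "l < N" "v \<in> tr (rs ! l)" using i(2) j(2) by simp_all
      then show "v \<in> (\<Union>l<N. tr (rs ! l))" by (intro UN_I[of l]) simp_all
    qed
  qed blast
  then have "card frequent \<le> (\<Sum>l<N. card (tr (rs ! l)))" using card_UN_le[of "{..<N}" "\<lambda>l. tr (rs ! l)"] by simp
  also have "\<dots> \<le> (\<Sum>l<N. rank E)"
  proof (rule sum_mono)
    fix l assume "l \<in> {..<N}"
    then have "rep l \<in> E" using rs_less by simp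
    then show "card (tr (rs ! l)) \<le> rank E"
      using card_mono[OF fine, of "rep l" "tr (rs ! l)"] card_le[of "rep l"] by simp
  qed
  finally show ?thesis by (simp add: mult.commute)
qed

text \<open>A predicate that depends on the trace only is constant on each group of merged edges, so
  the representative decides for its whole weight.\<close>

lemma sum_weights:
  assumes P: "\<And>e e'. e \<inter> frequent = e' \<inter> frequent \<Longrightarrow> P e = P e'"
  shows "(\<Sum>l<N. if P (rep l) then weight l else 0) = card {e\<in>E. P e}"
proof -
  let ?T = "\<lambda>e. e \<inter> frequent"
  have PT: "P e = P (?T e)" for e by (rule P) blast
  have "(\<Sum>l<N. if P (rep l) then weight l else 0) =
      sum_list (map (\<lambda>X. if P X then card {e\<in>E. ?T e = X} else 0) (map tr rs))"
    unfolding sum_list_sum_nth by (intro sum.cong) (auto simp: weight_def PT[of "rep _"])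
  also have "\<dots> = (\<Sum>X\<in>set (map tr rs). if P X then card {e\<in>E. ?T e = X} else 0)"
    by (rule sum_list_distinct_conv_sum_set[OF dist_rs])
  also have "set (map tr rs) = ?T ` E" using tr_rs by (auto simp: E_eq image_image)
  also have "(\<Sum>X\<in>?T ` E. if P X then card {e\<in>E. ?T e = X} else 0) = (\<Sum>X\<in>?T ` E. card {e\<in>E. P e \<and> ?T e = X})"
  proof (rule sum.cong)
    fix X
    have "{e\<in>E. P e \<and> ?T e = X} = (if P X then {e\<in>E. ?T e = X} else {})" using PT by auto
    then show "(if P X then card {e\<in>E. ?T e = X} else 0) = card {e\<in>E. P e \<and> ?T e = X}" by simp
  qed simp
  also have "\<dots> = card (\<Union>X\<in>?T ` E. {e\<in>E. P e \<and> ?T e = X})"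
    using finite_E by (intro card_UN_disjoint[symmetric]) auto
  also have "(\<Union>X\<in>?T ` E. {e\<in>E. P e \<and> ?T e = X}) = {e\<in>E. P e}" by blast
  finally show ?thesis .
qed

definition resid_upto :: "nat \<Rightarrow> nat set \<Rightarrow> nat" where
  "resid_upto i A = (\<Sum>l<i. if rep l \<inter> A = {} then weight l else 0)"

definition gain_upto :: "nat \<Rightarrow> nat set \<Rightarrow> nat \<Rightarrow> nat" where
  "gain_upto i A v = (\<Sum>l<i. if rep l \<inter> A = {} \<and> v \<in> rep l then weight l else 0)"

lemma resid_upto_N: "A \<subseteq> frequent \<Longrightarrow> resid_upto N A = residual E A"
  unfolding resid_upto_def residual_def by (rule sum_weights) blast

lemma gain_upto_N: "A \<subseteq> frequent \<Longrightarrow> v \<in> frequent \<Longrightarrow> gain_upto N A v = gain E A v"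
  unfolding gain_upto_def gain_def by (rule sum_weights) blast

definition static :: "state \<Rightarrow> bool" where
  "static s \<longleftrightarrow> inp s \<and> frequent_ok s \<and> reg s ''nt'' = int N \<and> (\<forall>l<N. arr s GE (int l) = eaddr (rs ! l) \<and>
     arr s DICT (arr s HE (int l)) = int (weight l))"

lemma static_upd [simp]: "x \<notin> {''nt'', ''nu''} \<Longrightarrow> static (upd s x v) = static s"
  by (auto simp: static_def)

lemma static_put [simp]: "i \<in> {6..11} \<Longrightarrow> 0 \<le> a \<Longrightarrow> static (put s i a v) = static s"
  by (auto simp: static_def)

lemma static_inp: "static s \<Longrightarrow> inp s"
  by (simp add: static_def)

definition hits_ok :: "nat \<Rightarrow> nat \<Rightarrow> nat set \<Rightarrow> state \<Rightarrow> bool" where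
  "hits_ok b n B s \<longleftrightarrow> (\<forall>l<n. arr s HIT (int b + int l) = of_bool (rep l \<inter> B \<noteq> {}))"

lemma hits_ok_upd [simp]: "hits_ok b n B (upd s x v) = hits_ok b n B s"
  by (simp add: hits_ok_def)

lemma hits_ok_put [simp]: "i \<in> {0..5} \<union> {7..15} \<Longrightarrow> hits_ok b n B (put s i a v) = hits_ok b n B s"
  by (auto simp: hits_ok_def)

lemma hits_ok_put_HIT: "int b + int n \<le> a \<Longrightarrow> hits_ok b n B (put s HIT a v) = hits_ok b n B s"
  by (auto simp: hits_ok_def)

text \<open>A node refers to the block of its parent, hence \<open>butlast\<close>; for the root
  this gives the block of zeros. All referenced blocks end at or below \<open>f\<close>, where the
  next one is written.\<close>

definition queue_ok :: "nat list list \<Rightarrow> nat \<Rightarrow> state \<Rightarrow> bool" where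
  "queue_ok Q f s \<longleftrightarrow> (\<forall>i<length Q. arr s QV (int i) = (if Q ! i = [] then - 1 else int (last (Q ! i))) \<and>
     arr s QD (int i) = int (length (Q ! i)) \<and> arr s QC (int i) = int (prefix_cost E (Q ! i)) \<and>
     (\<exists>b. arr s QB (int i) = int b \<and> b + N \<le> f \<and> hits_ok b N (set (butlast (Q ! i))) s))"

lemma queue_ok_upd [simp]: "queue_ok Q f (upd s x v) = queue_ok Q f s"
  by (simp add: queue_ok_def)

lemma queue_ok_put [simp]: "i \<in> {0..5} \<union> {7} \<union> {12..15} \<Longrightarrow> queue_ok Q f (put s i a v) = queue_ok Q f s"
  by (auto simp: queue_ok_def)

lemma queue_ok_put_HIT:
  assumes "queue_ok Q f s" "int f \<le> a" shows "queue_ok Q f (put s HIT a v)"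
proof -
  have "hits_ok b N B (put s HIT a v) = hits_ok b N B s" if "b + N \<le> f" for b B
    using that assms(2) by (intro hits_ok_put_HIT) linarith
  then show ?thesis using assms(1) unfolding queue_ok_def by (auto 0 4)
qed

lemma queue_ok_mono: "queue_ok Q f s \<Longrightarrow> f \<le> f' \<Longrightarrow> queue_ok Q f' s"
  unfolding queue_ok_def by (meson le_trans)

lemma queue_ok_push:
  assumes "queue_ok Q f' s" "hits_ok f N (set A) s" "f + N \<le> f'" "c = prefix_cost E A + residual E (set A)"
  shows "queue_ok (Q @ [A @ [v]]) f'
    (put (put (put (put s QV (int (length Q)) (int v)) QB (int (length Q)) (int f))
       QD (int (length Q)) (int (length A) + 1)) QC (int (length Q)) (int c))"
  using assms unfolding queue_ok_def
  by (auto simp: less_Suc_eq nth_append prefix_cost_def)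

lemma run_load_trace:
  assumes "static s" "reg s ''i'' = int l" "l < N"
  shows "run load_trace s Q \<longleftrightarrow>
    Q 40 (upd (upd s ''p'' (eaddr (rs ! l))) ''q'' (eaddr (rs ! l) + int (length (es ! (rs ! l)))))"
proof -
  have "arr s GE (int l) = eaddr (rs ! l)" "mem s (eaddr (rs ! l)) = int (length (es ! (rs ! l)))"
    using assms rs_less by (auto simp: static_def inp_def)
  then show ?thesis using assms(2) by (simp add: load_trace_def)
qed

text \<open>\<open>B\<close> is the vertex set of the parent. Describing the last vertex by
  \<open>{v. int v = reg s ''u''}\<close> includes the root, where this set is empty.\<close>

lemma run_score_trace:
  assumes s: "static s" "queue_ok Q f s" "reg s ''i'' = int i" "i < N" "reg s ''fr'' = int f"
    and b: "reg s ''b'' = int b" "b + N \<le> f" "hits_ok b N B s"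
    and hits: "hits_ok f i A s" and A: "A = B \<union> {v. int v = reg s ''u''}"
    and M: "reg s ''M'' = int (resid_upto i A)"
    and deg: "\<forall>v\<in>frequent. arr s DEG (int v) = int (gain_upto i A v)"
  shows "run score_trace s (\<lambda>t s'. t \<le> rank E * 500 + 1500 \<and> static s' \<and> queue_ok Q f s' \<and>
    hits_ok b N B s' \<and> hits_ok f (Suc i) A s' \<and> reg s' ''M'' = int (resid_upto (Suc i) A) \<and>
    (\<forall>v\<in>frequent. arr s' DEG (int v) = int (gain_upto (Suc i) A v)) \<and>
    same_except {''p'', ''q'', ''h'', ''z'', ''M''} s' s)" (is "run _ s ?R")
proof -
  let ?j = "rs ! i"
  let ?e = "es ! ?j"
  have j: "?j < length es" using rs_less s(4) by simp
  have len: "length ?e \<le> rank E" using length_edge j by simp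
  let ?F = "\<lambda>s'. same_except {''p'', ''q'', ''h'', ''z'', ''M''} s' s"
  let ?s1 = "upd (upd (upd s ''p'' (eaddr ?j)) ''q'' (eaddr ?j + int (length ?e))) ''h'' (of_bool (set ?e \<inter> B \<noteq> {}))"
  let ?J = "\<lambda>l s'. ?F s' \<and> arr s' = arr s \<and> reg s' ''M'' = reg s ''M'' \<and> static s' \<and> queue_ok Q f s' \<and>
      hits_ok b N B s' \<and> hits_ok f i A s' \<and>
      reg s' ''h'' = of_bool (set ?e \<inter> B \<noteq> {} \<or> (\<exists>v\<in>set (take l ?e). int v = reg s ''u''))"
  let ?c1 = "com.If (And (Not (Less (Reg ''u'') Vtx)) (Not (Less Vtx (Reg ''u'')))) (Assign ''h'' (Const 1)) Skip"
  have h1: "arr s HIT (int b + int i) = of_bool (set ?e \<inter> B \<noteq> {})"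
    using b(3) s(4) by (simp add: hits_ok_def)
  have scan1: "run (scan ?c1) ?s1 (\<lambda>t s'. t \<le> length ?e * (20 + 7) + 3 \<and> inp s' \<and> ?J (length ?e) s' \<and>
     reg s' ''p'' = eaddr ?j + int (length ?e))"
  proof (rule run_scan[where J = ?J])
    fix l s' assume *: "l < length ?e" "inp s'" "0 \<le> reg s' ''p''" "mem s' (reg s' ''p'') = int (?e ! l)" "?J l s'"
    have "(\<exists>v\<in>set (take (Suc l) ?e). int v = reg s ''u'') \<longleftrightarrow>
       int (?e ! l) = reg s ''u'' \<or> (\<exists>v\<in>set (take l ?e). int v = reg s ''u'')"
      using *(1) by (simp add: take_Suc_conv_app_nth)
    moreover have "reg s' ''u'' = reg s ''u''" using *(5) by simp
    ultimately show "run ?c1 s' (\<lambda>t s''. t \<le> 20 \<and> inp s'' \<and> ?J (Suc l) s'' \<and>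
        reg s'' ''p'' = reg s' ''p'' \<and> reg s'' ''q'' = reg s' ''q'')"
      using * by (cases "int (?e ! l) = reg s ''u''") auto
  qed (use s b hits j static_inp in auto)
  have hit_iff: "(set ?e \<inter> B \<noteq> {} \<or> (\<exists>v\<in>set (take (length ?e) ?e). int v = reg s ''u'')) \<longleftrightarrow> set ?e \<inter> A \<noteq> {}"
    unfolding A by auto
  let ?c2 = "Put DEG Vtx (Add (Arr DEG Vtx) (Reg ''z''))"
  have fin: "run record_trace s1
    (\<lambda>t s'. t \<le> rank E * 120 + 1000 \<and> static s' \<and> queue_ok Q f s' \<and>
    hits_ok b N B s' \<and> hits_ok f (Suc i) A s' \<and> reg s' ''M'' = int (resid_upto (Suc i) A) \<and>
    (\<forall>v\<in>frequent. arr s' DEG (int v) = int (gain_upto (Suc i) A v)) \<and> ?F s')"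
    (is "run ?c s1 ?Q") if s1: "?J (length ?e) s1" for s1
  proof -
    let ?h = "of_bool (set ?e \<inter> A \<noteq> {}) :: int"
    let ?s2 = "put s1 HIT (int f + int i) ?h"
    have h: "reg s1 ''h'' = ?h" using s1 hit_iff by simp
    have r: "reg s1 ''fr'' = int f" "reg s1 ''i'' = int i" "reg s1 ''M'' = int (resid_upto i A)"
      using s1 s M by simp_all
    have c: "static s1" "queue_ok Q f s1" "hits_ok b N B s1" "hits_ok f i A s1" "?F s1" "arr s1 = arr s"
      using s1 by blast+
    have s2: "static ?s2" "queue_ok Q f ?s2" "?F ?s2" using c(1,2,5) by (simp_all add: queue_ok_put_HIT)
    have "int b + int N \<le> int f + int i" using b(2) by linarith
    then have "hits_ok b N B ?s2" using c(3) by (simp only: hits_ok_put_HIT)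
    note s2 = s2(1,2) this s2(3)
    have hf: "hits_ok f (Suc i) A ?s2"
      using c(4) by (auto simp: hits_ok_def less_Suc_eq)
    show ?thesis
    proof (cases "set ?e \<inter> A = {}")
      case False
      then have "resid_upto (Suc i) A = resid_upto i A" "gain_upto (Suc i) A v = gain_upto i A v" for v
        by (simp_all add: resid_upto_def gain_upto_def)
      moreover have "reg ?s2 ''M'' = int (resid_upto i A)" "arr ?s2 DEG = arr s DEG"
        using r c(6) by (simp_all add: fun_eq_iff)
      ultimately have "?Q 71 ?s2" using s2 hf deg by (intro conjI) simp_all
      moreover have "run ?c s1 Q' \<longleftrightarrow> Q' 71 ?s2" for Q'
        using False h r(1,2) by (simp add: record_trace_def)
      ultimately show ?thesis by blast
    next
      case True
      have z: "arr s1 DICT (arr s1 HE (int i)) = int (weight i)" using c(1) s(4) by (simp add: static_def)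
      let ?s3 = "upd (upd ?s2 ''z'' (int (weight i))) ''M'' (int (resid_upto i A) + int (weight i))"
      let ?s4 = "upd (upd ?s3 ''p'' (eaddr ?j)) ''q'' (eaddr ?j + int (length ?e))"
      have M': "resid_upto (Suc i) A = resid_upto i A + weight i" using True by (simp add: resid_upto_def)
      have G: "gain_upto (Suc i) A v = gain_upto i A v + (if v \<in> set ?e then weight i else 0)" for v
        using True by (simp add: gain_upto_def)
      let ?H = "\<lambda>l s'. ?F s' \<and> reg s' ''M'' = int (resid_upto (Suc i) A) \<and> static s' \<and> queue_ok Q f s' \<and>
          hits_ok b N B s' \<and> hits_ok f (Suc i) A s' \<and> reg s' ''z'' = int (weight i) \<and>
          (\<forall>v\<in>frequent. arr s' DEG (int v) = int (gain_upto i A v) + of_bool (v \<in> set (take l ?e)) * int (weight i))"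
      have "run (scan ?c2) ?s4 (\<lambda>t s'. t \<le> length ?e * (110 + 7) + 3 \<and> inp s' \<and> ?H (length ?e) s' \<and>
         reg s' ''p'' = eaddr ?j + int (length ?e))"
      proof (rule run_scan[where J = ?H])
        fix l s' assume *: "l < length ?e" "inp s'" "0 \<le> reg s' ''p''" "mem s' (reg s' ''p'') = int (?e ! l)" "?H l s'"
        let ?p = "put s' DEG (int (?e ! l)) (arr s' DEG (int (?e ! l)) + int (weight i))"
        have "?e ! l \<notin> set (take l ?e)"
          using *(1) dist_edge[OF j] by (auto simp: in_set_conv_nth nth_eq_iff_index_eq)
        moreover have "set (take (Suc l) ?e) = insert (?e ! l) (set (take l ?e))"
          using *(1) by (simp add: take_Suc_conv_app_nth)
        moreover have H: "?F s'" "reg s' ''M'' = int (resid_upto (Suc i) A)" "static s'" "queue_ok Q f s'"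
            "hits_ok b N B s'" "hits_ok f (Suc i) A s'" "reg s' ''z'' = int (weight i)"
            "\<forall>v\<in>frequent. arr s' DEG (int v) = int (gain_upto i A v) + of_bool (v \<in> set (take l ?e)) * int (weight i)"
          using *(5) by blast+
        ultimately have H2: "?H (Suc l) ?p" by (intro conjI) simp_all
        have eq: "run ?c2 s' Q' \<longleftrightarrow> Q' 102 ?p" for Q' using *(4) H(7) by simp
        have "inp ?p" "reg ?p = reg s'" using *(2) by simp_all
        then have "102 \<le> (110 :: nat) \<and> inp ?p \<and> ?H (Suc l) ?p \<and> reg ?p ''p'' = reg s' ''p'' \<and> reg ?p ''q'' = reg s' ''q''"
          using H2 by (intro conjI) (assumption | simp)+
        then show "run ?c2 s' (\<lambda>t s''. t \<le> 110 \<and> inp s'' \<and> ?H (Suc l) s'' \<and>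
            reg s'' ''p'' = reg s' ''p'' \<and> reg s'' ''q'' = reg s' ''q'')"
          unfolding eq .
      next
        have "arr ?s4 DEG = arr s DEG" using c(6) by (simp add: fun_eq_iff)
        then show "?H 0 ?s4" using s2 hf deg M' by (intro conjI) simp_all
      next
        show "?H l (upd s' ''p'' v)" if "?H l s'" for l s' v
          using that by (elim conjE, intro conjI) simp_all
        show "inp ?s4" using static_inp[OF s2(1)] by simp
      qed (use j in simp_all)
      then have "run (scan ?c2) ?s4 (\<lambda>t s'. t \<le> rank E * 117 + 3 \<and> ?H (length ?e) s')"
        by (rule run_mono) (use mult_le_mono1[OF len, of 117] in auto)
      then have *: "run (scan ?c2) ?s4 (\<lambda>t s'. ?Q (677 + t) s')"
      proof (rule run_mono, goal_cases)
        case (1 t s')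
        then show ?case by (intro conjI) (simp_all add: G)
      qed
      have "run load_trace ?s3 Q' \<longleftrightarrow> Q' 40 ?s4" for Q'
        using s2(1) r s(4) by (intro run_load_trace) simp_all
      then have "run ?c s1 Q' \<longleftrightarrow> run (scan ?c2) ?s4 (\<lambda>t. Q' (677 + t))" for Q'
        using True h r z by (simp add: record_trace_def)
      then show ?thesis using * by blast
    qed
  qed
  have "run load_trace s Q' \<longleftrightarrow> Q' 40 (upd (upd s ''p'' (eaddr ?j)) ''q'' (eaddr ?j + int (length ?e)))" for Q'
    using s by (intro run_load_trace) simp_all
  then have "run score_trace s Q' \<longleftrightarrow> run (scan ?c1) ?s1 (\<lambda>t1 s1. run record_trace s1 (\<lambda>t. Q' (107 + (t1 + t))))" for Q'
    unfolding score_trace_def using s(3) b(1) h1 by (simp add: add.assoc)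
  moreover have "run (scan ?c1) ?s1 (\<lambda>t1 s1. run record_trace s1 (\<lambda>t s'. ?R (107 + (t1 + t)) s'))"
  proof (rule run_mono[OF scan1])
    fix t1 s1 assume *: "t1 \<le> length ?e * (20 + 7) + 3 \<and> inp s1 \<and> ?J (length ?e) s1 \<and>
       reg s1 ''p'' = eaddr ?j + int (length ?e)"
    have t1: "t1 \<le> length ?e * 27 + 3" using * by simp
    have J: "?J (length ?e) s1" using conjunct1[OF conjunct2[OF conjunct2[OF *]]] .
    have "length ?e * 27 \<le> rank E * 27" using len by simp
    show "run record_trace s1 (\<lambda>t s'. ?R (107 + (t1 + t)) s')"
    proof (rule run_mono[OF fin[OF J]])
      fix t s' assume "?Q t s'"
      then show "?R (107 + (t1 + t)) s'" using t1 \<open>length ?e * 27 \<le> rank E * 27\<close>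
        by (elim conjE, intro conjI) (linarith | assumption)+
    qed
  qed
  ultimately show ?thesis by blast
qed

end

lemma upd_same [simp]: "upd (upd s x v) x v' = upd s x v'"
  by (simp add: upd_def)

lemma upd_reg: "reg s x = v \<Longrightarrow> upd s x v = s"
  by (auto simp: upd_def)

lemma upd_twist: "x \<noteq> y \<Longrightarrow> upd (upd s x a) y b = upd (upd s y b) x a"
  by (simp add: upd_def fun_upd_twist)

lemma run_enqueue:
  "0 < reg s ''M'' \<Longrightarrow> \<not> reg s ''z'' < reg s ''M'' \<Longrightarrow> run enqueue s Q \<longleftrightarrow>
     Q 154 (upd (put (put (put (put s QV (reg s ''y'') (reg s ''v'')) QB (reg s ''y'') (reg s ''fr''))
       QD (reg s ''y'') (reg s ''d'' + 1)) QC (reg s ''y'') (reg s ''c'')) ''y'' (reg s ''y'' + 1))"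
  "\<not> (0 < reg s ''M'' \<and> \<not> reg s ''z'' < reg s ''M'') \<Longrightarrow> run enqueue s Q \<longleftrightarrow> Q 9 s"
  by (simp add: enqueue_def) (auto simp: enqueue_def numeral_eq_Suc)

context search
begin

lemma run_multiply_gain:
  assumes s: "inp s" "reg s ''z'' = 0" "reg s ''e'' = int a" "a \<le> K" "arr s DEG (reg s ''v'') = int dg"
  shows "run multiply_gain s (\<lambda>t s'. t \<le> K * 45 + 4 \<and>
     s' = upd (upd s ''z'' (int (dg * (K - a)))) ''e'' (int K))"
proof -
  let ?I = "\<lambda>n s'. s' = upd (upd s ''z'' (int (n * dg))) ''e'' (int (a + n)) \<and> n \<le> K - a"
  let ?b = "Less (Reg ''e'') (Load (Const 0))"
  have k: "mem s 0 = int K" using s(1) by (simp add: inp_def)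
  have "run multiply_gain s (\<lambda>t s'. t \<le> K * (41 + btime ?b) + btime ?b \<and> (\<exists>n. ?I n s' \<and> \<not> bval ?b s'))"
    unfolding multiply_gain_def
  proof (rule run_While)
    fix n s' assume I: "?I n s'" and b: "bval ?b s'"
    then have n: "a + n < K" using k by simp
    have "upd (upd s' ''z'' (int (n * dg) + int dg)) ''e'' (int (a + n) + 1) =
        upd (upd s ''z'' (int (Suc n * dg))) ''e'' (int (a + Suc n))"
      using I by (simp add: upd_twist[of "''e''" "''z''"] algebra_simps)
    then show "n < K \<and> run (Seq (Assign ''z'' (Add (Reg ''z'') (Arr DEG (Reg ''v'')))) (Inc ''e'')) s'
        (\<lambda>t s'. t \<le> 41 \<and> ?I (Suc n) s')"
      using I n s(5) by simp
  next
    show "?I 0 s" using s by (simp add: upd_reg)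
  qed
  then show ?thesis
  proof (rule run_mono)
    fix t s' assume *: "t \<le> K * (41 + btime ?b) + btime ?b \<and> (\<exists>n. ?I n s' \<and> \<not> bval ?b s')"
    then obtain n where n: "?I n s'" "\<not> bval ?b s'" by blast
    then have "n = K - a" "a + n = K" using k s(4) by auto
    then show "t \<le> K * 45 + 4 \<and> s' = upd (upd s ''z'' (int (dg * (K - a)))) ''e'' (int K)"
      using * n by (simp add: mult.commute)
  qed
qed

definition is_child :: "nat list \<Rightarrow> nat \<Rightarrow> bool" where
  "is_child A v \<longleftrightarrow> 0 < residual E (set A) \<and> residual E (set A) \<le> gain E (set A) v * (K - length A)"

definition children_upto :: "nat \<Rightarrow> nat list \<Rightarrow> nat list list" where
  "children_upto i A = map (\<lambda>v. A @ [v]) (filter (is_child A) (take i us))"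

lemma children_upto_all: "children_upto (length us) A = children A"
  by (simp add: children_upto_def expand_def is_child_def[abs_def])

lemma children_upto_Suc: "i < length us \<Longrightarrow>
  children_upto (Suc i) A = children_upto i A @ (if is_child A (us ! i) then [A @ [us ! i]] else [])"
  by (simp add: children_upto_def take_Suc_conv_app_nth)

definition gains_ok :: "nat \<Rightarrow> nat set \<Rightarrow> state \<Rightarrow> bool" where
  "gains_ok i A s \<longleftrightarrow> (\<forall>j<length us. arr s DEG (int (us ! j)) = (if j < i then 0 else int (gain E A (us ! j))))"

lemma gains_ok_upd [simp]: "gains_ok i A (upd s x v) = gains_ok i A s"
  by (simp add: gains_ok_def)

lemma gains_ok_put [simp]: "j \<in> {8..11} \<Longrightarrow> gains_ok i A (put s j a v) = gains_ok i A s"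
  by (auto simp: gains_ok_def)

lemma gains_ok_Suc: "gains_ok i A s \<Longrightarrow> i < length us \<Longrightarrow> gains_ok (Suc i) A (put s DEG (int (us ! i)) 0)"
  using distinct_us by (auto simp: gains_ok_def nth_eq_iff_index_eq less_Suc_eq)

lemma run_push_child:
  assumes s: "static s" "queue_ok (Q @ children_upto i A) (f + N) s" "hits_ok f N (set A) s" "gains_ok i (set A) s"
    and i: "i < length us" "reg s ''i'' = int i" and len: "length A \<le> K"
    and regs: "reg s ''y'' = int (length (Q @ children_upto i A))" "reg s ''M'' = int (residual E (set A))"
      "reg s ''d'' = int (length A)" "reg s ''c'' = int (prefix_cost E A + residual E (set A))" "reg s ''fr'' = int f"
  shows "run push_child s (\<lambda>t s'. t \<le> K * 45 + 300 \<and> static s' \<and>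
    queue_ok (Q @ children_upto (Suc i) A) (f + N) s' \<and> hits_ok f N (set A) s' \<and> gains_ok (Suc i) (set A) s' \<and>
    reg s' ''y'' = int (length (Q @ children_upto (Suc i) A)) \<and>
    same_except {''v'', ''z'', ''e'', ''y''} s' s)" (is "run _ s ?R")
proof -
  let ?v = "us ! i" and ?a = "length A"
  let ?dg = "gain E (set A) ?v"
  let ?s1 = "upd (upd (upd s ''v'' (int ?v)) ''z'' 0) ''e'' (int ?a)"
  let ?s2 = "upd (upd ?s1 ''z'' (int (?dg * (K - ?a)))) ''e'' (int K)"
  let ?s3 = "put ?s2 DEG (int ?v) 0"
  let ?y = "int (length (Q @ children_upto i A))"
  let ?c = "prefix_cost E A + residual E (set A)"
  let ?s4 = "upd (put (put (put (put ?s3 QV ?y (int ?v)) QB ?y (int f)) QD ?y (int ?a + 1)) QC ?y (int ?c)) ''y'' (?y + 1)"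
  have v: "arr s UL (int i) = int ?v" using s(1) i by (simp add: static_def frequent_ok_def)
  have dg: "arr s DEG (int ?v) = int ?dg" using s(4) i by (simp add: gains_ok_def)
  have mult: "run multiply_gain ?s1 (\<lambda>t s'. t \<le> K * 45 + 4 \<and> s' = ?s2)"
    using s(1) len dg static_inp by (intro run_multiply_gain) simp_all
  have child: "is_child A ?v \<longleftrightarrow> 0 < reg ?s3 ''M'' \<and> \<not> reg ?s3 ''z'' < reg ?s3 ''M''"
    unfolding is_child_def using regs(2) by (simp flip: of_nat_mult) linarith
  have r3: "reg ?s3 ''y'' = ?y" "reg ?s3 ''v'' = int ?v" "reg ?s3 ''fr'' = int f"
      "reg ?s3 ''d'' = int ?a" "reg ?s3 ''c'' = int ?c"
    using regs by simp_all
  have g: "gains_ok (Suc i) (set A) ?s3" using s(4) i by (intro gains_ok_Suc) simp_all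
  have q: "queue_ok (Q @ children_upto i A) (f + N) ?s3" using s(2) by simp
  have h: "hits_ok f N (set A) ?s3" using s(3) by simp
  have test: "run enqueue ?s3 (\<lambda>t s'. ?R (K * 45 + 110 + t) s')"
  proof (cases "is_child A ?v")
    case True
    then have b: "0 < reg ?s3 ''M''" "\<not> reg ?s3 ''z'' < reg ?s3 ''M''" using child by auto
    have Q: "Q @ children_upto (Suc i) A = (Q @ children_upto i A) @ [A @ [?v]]"
      using True children_upto_Suc[OF i(1)] by simp
    have q4: "queue_ok (Q @ children_upto (Suc i) A) (f + N) ?s4"
      unfolding Q queue_ok_upd by (rule queue_ok_push[OF q h]) simp_all
    have "?R (K * 45 + 110 + 154) ?s4"
    proof (intro conjI)
      show "static ?s4" using s(1) by simp
      show "queue_ok (Q @ children_upto (Suc i) A) (f + N) ?s4" by (rule q4)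
      show "hits_ok f N (set A) ?s4" using h by simp
      show "gains_ok (Suc i) (set A) ?s4" using g by simp
      show "reg ?s4 ''y'' = int (length (Q @ children_upto (Suc i) A))" unfolding Q by simp
    qed simp_all
    moreover have "run enqueue ?s3 Q' \<longleftrightarrow> Q' 154 ?s4" for Q'
      using run_enqueue(1)[OF b, unfolded r3] .
    ultimately show ?thesis by blast
  next
    case False
    then have b: "\<not> (0 < reg ?s3 ''M'' \<and> \<not> reg ?s3 ''z'' < reg ?s3 ''M'')" using child by blast
    have Q: "Q @ children_upto (Suc i) A = Q @ children_upto i A"
      using False children_upto_Suc[OF i(1)] by simp
    have "?R (K * 45 + 110 + 9) ?s3" unfolding Q
      using s(1) q h g regs(1) by (intro conjI) simp_all
    moreover have "run enqueue ?s3 Q' \<longleftrightarrow> Q' 9 ?s3" for Q'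
      by (rule run_enqueue(2)[OF b])
    ultimately show ?thesis by blast
  qed
  have "run push_child s Q' \<longleftrightarrow> run multiply_gain ?s1 (\<lambda>t s2. run enqueue (put s2 DEG (reg s2 ''v'') 0)
      (\<lambda>t'. Q' (39 + (t + (35 + t')))))" for Q'
    unfolding push_child_def using i(2) v regs(3) by (simp add: add.assoc)
  moreover have "run multiply_gain ?s1 (\<lambda>t s2. run enqueue (put s2 DEG (reg s2 ''v'') 0)
      (\<lambda>t' s'. ?R (39 + (t + (35 + t'))) s'))"
  proof (rule run_mono[OF mult])
    fix t s2 assume *: "t \<le> K * 45 + 4 \<and> s2 = ?s2"
    then have s2: "put s2 DEG (reg s2 ''v'') 0 = ?s3" by simp
    show "run enqueue (put s2 DEG (reg s2 ''v'') 0) (\<lambda>t' s'. ?R (39 + (t + (35 + t'))) s')"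
      unfolding s2
    proof (rule run_mono[OF test])
      fix t' s' assume R: "?R (K * 45 + 110 + t') s'"
      then have "39 + (t + (35 + t')) \<le> K * 45 + 300" using * by linarith
      then show "?R (39 + (t + (35 + t'))) s'" using R by blast
    qed
  qed
  ultimately show ?thesis by blast
qed

lemma run_score_all:
  assumes s: "static s" "queue_ok Q f s" "reg s ''fr'' = int f" "reg s ''b'' = int b" "b + N \<le> f"
      "hits_ok b N B s" and A: "A = B \<union> {v. int v = reg s ''u''}" "A \<subseteq> frequent"
    and M: "reg s ''M'' = 0" and deg: "no_gains s"
  shows "run (for_upto ''i'' (Reg ''nt'') score_trace) s (\<lambda>t s'. t \<le> N * (rank E * 500 + 1507) + 5 \<and>
    static s' \<and> queue_ok Q f s' \<and> hits_ok f N A s' \<and> reg s' ''M'' = int (residual E A) \<and>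
    (\<forall>v\<in>frequent. arr s' DEG (int v) = int (gain E A v)) \<and>
    same_except {''p'', ''q'', ''h'', ''z'', ''M'', ''i''} s' s)"
proof -
  let ?F = "\<lambda>s'. same_except {''p'', ''q'', ''h'', ''z'', ''M'', ''i''} s' s"
  let ?I = "\<lambda>i s'. static s' \<and> queue_ok Q f s' \<and> hits_ok b N B s' \<and> hits_ok f i A s' \<and>
    reg s' ''M'' = int (resid_upto i A) \<and> (\<forall>v\<in>frequent. arr s' DEG (int v) = int (gain_upto i A v)) \<and> ?F s'"
  have "run (for_upto ''i'' (Reg ''nt'') score_trace) s (\<lambda>t s'.
    t \<le> N * ((rank E * 500 + 1500) + atime (Reg ''nt'') + 6) + atime (Reg ''nt'') + 4 \<and> ?I N s')"
  proof (rule run_for_upto[where I = ?I])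
    fix i s' assume i: "i < N" and I: "?I i s'" and r: "reg s' ''i'' = int i"
    have c: "static s'" "queue_ok Q f s'" "hits_ok b N B s'" "hits_ok f i A s'" "?F s'"
        "reg s' ''M'' = int (resid_upto i A)" "\<forall>v\<in>frequent. arr s' DEG (int v) = int (gain_upto i A v)"
      using I by blast+
    have regs: "reg s' ''fr'' = int f" "reg s' ''b'' = int b" "reg s' ''u'' = reg s ''u''"
      using c(5) s(3,4) by simp_all
    show "run score_trace s' (\<lambda>t s''. t \<le> rank E * 500 + 1500 \<and> ?I (Suc i) s'' \<and> reg s'' ''i'' = int i)"
    proof (rule run_mono[OF run_score_trace[of s' Q f i b B A]], goal_cases)
      case (13 t s'')
      then have F: "same_except {''p'', ''q'', ''h'', ''z'', ''M''} s'' s'" by blast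
      then have "?F s''" using c(5) by simp
      moreover have "reg s'' ''i'' = int i" using F r by simp
      ultimately show ?case using 13 by blast
    qed (use c regs r i s(5) A in simp_all)
  next
    show "?I i (upd s' ''i'' v)" if "?I i s'" for i s' v
      using that by (elim conjE, intro conjI) simp_all
    show "aval (Reg ''nt'') s' = int N" if "?I i s'" for i s'
      using conjunct1[OF that] by (simp add: static_def)
    show "?I 0 s" using s M deg by (simp add: hits_ok_def resid_upto_def gain_upto_def)
  qed
  then show ?thesis
  proof (rule run_mono, goal_cases)
    case (1 t s')
    from conjunct1[OF 1] have "t \<le> N * (rank E * 500 + 1507) + 5" by (simp add: algebra_simps)
    moreover have "static s'" "queue_ok Q f s'" "hits_ok f N A s'" "reg s' ''M'' = int (residual E A)" "?F s'"
      using 1 unfolding resid_upto_N[OF A(2)] by blast+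
    moreover have "\<forall>v\<in>frequent. arr s' DEG (int v) = int (gain_upto N A v)" using 1 by blast
    then have "\<forall>v\<in>frequent. arr s' DEG (int v) = int (gain E A v)" using gain_upto_N[OF A(2)] by simp
    ultimately show ?case by blast
  qed
qed

lemma run_push_all:
  assumes s: "static s" "queue_ok Q (f + N) s" "hits_ok f N (set A) s" "gains_ok 0 (set A) s" "length A \<le> K"
    and regs: "reg s ''y'' = int (length Q)" "reg s ''M'' = int (residual E (set A))"
      "reg s ''d'' = int (length A)" "reg s ''c'' = int (prefix_cost E A + residual E (set A))" "reg s ''fr'' = int f"
  shows "run (for_upto ''i'' (Reg ''nu'') push_child) s (\<lambda>t s'. t \<le> length us * (K * 45 + 307) + 5 \<and>
    static s' \<and> queue_ok (Q @ children A) (f + N) s' \<and> gains_ok (length us) (set A) s' \<and>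
    reg s' ''y'' = int (length (Q @ children A)) \<and>
    same_except {''v'', ''z'', ''e'', ''y'', ''i''} s' s)"
proof -
  let ?F = "\<lambda>s'. same_except {''v'', ''z'', ''e'', ''y'', ''i''} s' s"
  let ?I = "\<lambda>i s'. static s' \<and> queue_ok (Q @ children_upto i A) (f + N) s' \<and> hits_ok f N (set A) s' \<and>
    gains_ok i (set A) s' \<and> reg s' ''y'' = int (length (Q @ children_upto i A)) \<and> ?F s'"
  have "run (for_upto ''i'' (Reg ''nu'') push_child) s (\<lambda>t s'.
    t \<le> length us * ((K * 45 + 300) + atime (Reg ''nu'') + 6) + atime (Reg ''nu'') + 4 \<and> ?I (length us) s')"
  proof (rule run_for_upto[where I = ?I])
    fix i s' assume i: "i < length us" and I: "?I i s'" and r: "reg s' ''i'' = int i"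
    have c: "static s'" "queue_ok (Q @ children_upto i A) (f + N) s'" "hits_ok f N (set A) s'"
        "gains_ok i (set A) s'" "reg s' ''y'' = int (length (Q @ children_upto i A))" "?F s'"
      using I by blast+
    have regs': "reg s' ''M'' = int (residual E (set A))" "reg s' ''d'' = int (length A)"
      "reg s' ''c'' = int (prefix_cost E A + residual E (set A))" "reg s' ''fr'' = int f"
      using c(6) regs by simp_all
    show "run push_child s' (\<lambda>t s''. t \<le> K * 45 + 300 \<and> ?I (Suc i) s'' \<and> reg s'' ''i'' = int i)"
    proof (rule run_mono[OF run_push_child[OF c(1-4) i r s(5) c(5) regs']], goal_cases)
      case (1 t s'')
      then have F: "same_except {''v'', ''z'', ''e'', ''y''} s'' s'" by blast
      then have "?F s''" using c(6) by simp
      moreover have "reg s'' ''i'' = int i" using F r by simp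
      ultimately show ?case using 1 by blast
    qed
  next
    show "?I i (upd s' ''i'' v)" if "?I i s'" for i s' v
      using that by (elim conjE, intro conjI) simp_all
    show "aval (Reg ''nu'') s' = int (length us)" if "?I i s'" for i s'
      using conjunct1[OF that] by (simp add: static_def frequent_ok_def)
    show "?I 0 s" using s regs(1) by (simp add: children_upto_def)
  qed
  then show ?thesis
    unfolding children_upto_all
  proof (rule run_mono, goal_cases)
    case (1 t s')
    from conjunct1[OF 1] have "t \<le> length us * (K * 45 + 307) + 5" by (simp add: algebra_simps)
    with 1 show ?case by blast
  qed
qed

abbreviation "solved A \<equiv> residual E (set A) = 0 \<and> int (prefix_cost E A) \<le> w"

definition node_time :: nat where
  "node_time = N * (rank E * 500 + 1507) + length us * (K * 45 + 307) + 200"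

lemma run_process_node:
  assumes s: "static s" "queue_ok Q f s" "reg s ''fr'' = int f" "reg s ''x'' = int n" "n < length Q"
      "reg s ''y'' = int (length Q)" "no_gains s"
    and A: "A = Q ! n" "A \<in> tree"
  shows "run process_node s (\<lambda>t s'. t \<le> node_time \<and> static s' \<and>
    queue_ok (Q @ children A) (f + N) s' \<and> reg s' ''fr'' = int (f + N) \<and> reg s' ''x'' = int (Suc n) \<and>
    reg s' ''y'' = int (length (Q @ children A)) \<and> no_gains s' \<and>
    reg s' ''answer'' = (if solved A then 1 else reg s ''answer''))" (is "run _ s ?R")
proof -
  let ?n = "N * (rank E * 500 + 1507)"
  let ?u = "if A = [] then - 1 else int (last A)"
  obtain b where q: "arr s QV (int n) = ?u" "arr s QD (int n) = int (length A)" "arr s QC (int n) = int (prefix_cost E A)"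
      "arr s QB (int n) = int b" "b + N \<le> f" "hits_ok b N (set (butlast A)) s"
    using s(2,5) A(1) unfolding queue_ok_def by blast
  have tree: "set A \<subseteq> frequent" "length A \<le> K"
    using search_tree_props[OF A(2)] set_us by auto
  let ?s1 = "upd (upd (upd (upd (upd s ''u'' ?u) ''b'' (int b)) ''d'' (int (length A))) ''c'' (int (prefix_cost E A))) ''M'' 0"
  have A_eq: "set A = set (butlast A) \<union> {v. int v = reg ?s1 ''u''}"
    by (cases A rule: rev_cases) auto
  have score: "run (for_upto ''i'' (Reg ''nt'') score_trace) ?s1 (\<lambda>t s'. t \<le> ?n + 5 \<and>
    static s' \<and> queue_ok Q f s' \<and> hits_ok f N (set A) s' \<and> reg s' ''M'' = int (residual E (set A)) \<and>
    (\<forall>v\<in>frequent. arr s' DEG (int v) = int (gain E (set A) v)) \<and>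
    same_except {''p'', ''q'', ''h'', ''z'', ''M'', ''i''} s' ?s1)"
    by (rule run_score_all[OF _ _ _ _ q(5) _ A_eq tree(1)]) (use s q in simp_all)
  let ?check = "com.If (Less (Reg ''M'') (Const 1))
         (com.If (Less (Load (Const 1)) (Reg ''c'')) Skip (Assign ''answer'' (Const 1))) Skip"
  let ?tail = "Seq (for_upto ''i'' (Reg ''nu'') push_child)
     (Seq (Assign ''fr'' (Add (Reg ''fr'') (Reg ''nt''))) (Inc ''x''))"
  let ?rest = "Seq ?check (Seq (Assign ''c'' (Add (Reg ''c'') (Reg ''M''))) ?tail)"
  have rest: "run ?rest s2 (\<lambda>t s'. ?R (?n + 150 + t) s')"
    if s2: "static s2" "queue_ok Q f s2" "hits_ok f N (set A) s2" "reg s2 ''M'' = int (residual E (set A))"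
      "\<forall>v\<in>frequent. arr s2 DEG (int v) = int (gain E (set A) v)"
      "same_except {''p'', ''q'', ''h'', ''z'', ''M'', ''i''} s2 ?s1" for s2
  proof -
    let ?ans = "if solved A then 1 else reg s ''answer''"
    let ?s3 = "upd (upd s2 ''answer'' ?ans) ''c'' (int (prefix_cost E A + residual E (set A)))"
    have w: "mem s2 1 = w" using static_inp[OF s2(1)] by (simp add: inp_def)
    have r: "reg s2 ''c'' = int (prefix_cost E A)" "reg s2 ''answer'' = reg s ''answer''"
        "reg s2 ''y'' = int (length Q)" "reg s2 ''d'' = int (length A)" "reg s2 ''fr'' = int f" "reg s2 ''x'' = int n"
      using s2(6) s(3,4,6) by simp_all
    have u: "upd s2 ''answer'' (reg s ''answer'') = s2" using r(2) by (rule upd_reg)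
    \<comment> \<open>The branches take different times. Keeping only a bound lets the rest treat
      them as a single assignment to \<open>answer\<close>.\<close>
    have check: "\<exists>t\<le>10. \<forall>Q'. run ?check s2 Q' = Q' t (upd s2 ''answer'' ?ans)"
    proof (cases "residual E (set A) = 0")
      case False
      then show ?thesis using s2(4) u by (intro exI[of _ 4]) (simp add: numeral_eq_Suc)
    next
      case True
      show ?thesis
      proof (cases "int (prefix_cost E A) \<le> w")
        case True
        then show ?thesis using s2(4) \<open>residual E (set A) = 0\<close> r(1) w by (intro exI[of _ 9]) (simp add: numeral_eq_Suc)
      next
        case False
        then show ?thesis using s2(4) \<open>residual E (set A) = 0\<close> r(1) w u by (intro exI[of _ 8]) (simp add: numeral_eq_Suc)
      qed
    qed
    have push: "run (for_upto ''i'' (Reg ''nu'') push_child) ?s3 (\<lambda>t s'. t \<le> length us * (K * 45 + 307) + 5 \<and>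
      static s' \<and> queue_ok (Q @ children A) (f + N) s' \<and> gains_ok (length us) (set A) s' \<and>
      reg s' ''y'' = int (length (Q @ children A)) \<and>
      same_except {''v'', ''z'', ''e'', ''y'', ''i''} s' ?s3)"
    proof (rule run_push_all)
      show "queue_ok Q (f + N) ?s3" using queue_ok_mono[OF s2(2)] by simp
      show "gains_ok 0 (set A) ?s3" using s2(5) set_us by (auto simp: gains_ok_def)
    qed (use s2 r tree in simp_all)
    have tail: "run ?tail ?s3
       (\<lambda>t s'. ?R (?n + 170 + t) s')"
      unfolding run_Seq
    proof (rule run_mono[OF push], goal_cases)
      case (1 t s4)
      then have c: "t \<le> length us * (K * 45 + 307) + 5" "static s4" "queue_ok (Q @ children A) (f + N) s4"
          "gains_ok (length us) (set A) s4" "reg s4 ''y'' = int (length (Q @ children A))"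
          "same_except {''v'', ''z'', ''e'', ''y'', ''i''} s4 ?s3"
        by blast+
      have r4: "reg s4 ''fr'' = int f" "reg s4 ''x'' = int n" "reg s4 ''answer'' = ?ans"
        using c(6) r by simp_all
      have nt: "reg s4 ''nt'' = int N" using c(2) by (simp add: static_def)
      let ?s5 = "upd (upd s4 ''fr'' (int f + int N)) ''x'' (int n + 1)"
      have "?R (?n + 170 + (t + 8)) ?s5"
      proof (intro conjI)
        show "?n + 170 + (t + 8) \<le> node_time" using c(1) unfolding node_time_def by linarith
        show "\<forall>v\<in>frequent. arr ?s5 DEG (int v) = 0"
          using c(4) unfolding set_us[symmetric] by (auto simp: gains_ok_def in_set_conv_nth)
      qed (use c r4 in simp_all)
      then show ?case using r4 nt by simp
    qed
    obtain t0 where t0: "t0 \<le> 10" "\<And>Q'. run ?check s2 Q' = Q' t0 (upd s2 ''answer'' ?ans)"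
      using check by blast
    have sum_c: "aval (Add (Reg ''c'') (Reg ''M'')) (upd s2 ''answer'' ?ans) = int (prefix_cost E A + residual E (set A))"
      using r(1) s2(4) by simp
    have "run ?rest s2 Q' \<longleftrightarrow> run ?tail ?s3 (\<lambda>t. Q' (t0 + (1 + (1 + 1 + 1) + t)))" for Q'
      by (simp only: run_Seq[of ?check] t0(2) run_Seq[of "Assign _ _"] run_Assign sum_c atime.simps)
    moreover have "run ?tail ?s3
       (\<lambda>t s'. ?R (?n + 150 + (t0 + (1 + (1 + 1 + 1) + t))) s')"
    proof (rule run_mono[OF tail])
      fix t s' assume R: "?R (?n + 170 + t) s'"
      then have "?n + 150 + (t0 + (1 + (1 + 1 + 1) + t)) \<le> node_time" using t0(1) by linarith
      then show "?R (?n + 150 + (t0 + (1 + (1 + 1 + 1) + t))) s'" using R by blast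
    qed
    ultimately show ?thesis by blast
  qed
  have "run process_node s Q' \<longleftrightarrow> run (for_upto ''i'' (Reg ''nt'') score_trace) ?s1
      (\<lambda>t s2. run ?rest s2 (\<lambda>t'. Q' (142 + (t + t'))))" for Q'
    unfolding process_node_def using s(4) q(1-4) by (simp add: add.assoc)
  moreover have "run (for_upto ''i'' (Reg ''nt'') score_trace) ?s1
      (\<lambda>t s2. run ?rest s2 (\<lambda>t' s'. ?R (142 + (t + t')) s'))"
  proof (rule run_mono[OF score], goal_cases)
    case (1 t s2)
    then have t: "t \<le> ?n + 5" by blast
    have "run ?rest s2 (\<lambda>t s'. ?R (?n + 150 + t) s')"
      using 1 by (intro rest) blast+
    then show ?case
    proof (rule run_mono)
      fix t' s' assume R: "?R (?n + 150 + t') s'"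
      then have "142 + (t + t') \<le> node_time" using t by linarith
      then show "?R (142 + (t + t')) s'" using R by blast
    qed
  qed
  ultimately show ?thesis by blast
qed

text \<open>\<open>Q\<close> lists all nodes ever enqueued, and the first \<open>n\<close> of them
  have been processed. That every other node than the root has a processed parent is what excludes
  duplicates: a child determines its parent by \<open>butlast\<close>.\<close>

definition explored :: "nat \<Rightarrow> nat list list \<Rightarrow> bool" where
  "explored n Q \<longleftrightarrow> n \<le> length Q \<and> distinct Q \<and> [] \<in> set Q \<and> set Q \<subseteq> tree \<and>
     (\<forall>B\<in>set Q. B = [] \<or> (\<exists>i<n. B \<in> set (children (Q ! i)))) \<and>
     (\<forall>i<n. set (children (Q ! i)) \<subseteq> set Q)"

lemma explored_step:
  assumes Q: "explored n Q" and n: "n < length Q"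
  shows "explored (Suc n) (Q @ children (Q ! n))"
proof -
  let ?X = "children (Q ! n)"
  have "distinct ?X" using distinct_us by (simp add: expand_def distinct_map inj_on_def)
  moreover have "set Q \<inter> set ?X = {}"
  proof (rule ccontr)
    assume "\<not> ?thesis"
    then obtain B where B: "B \<in> set Q" "B \<in> set ?X" by blast
    then have "B \<noteq> []" "butlast B = Q ! n" by (auto simp: expand_def)
    then obtain i where i: "i < n" "B \<in> set (children (Q ! i))"
      using Q B(1) unfolding explored_def by blast
    then have "Q ! i = Q ! n" using \<open>butlast B = Q ! n\<close> by (auto simp: expand_def)
    then show False using i(1) n Q by (simp add: explored_def nth_eq_iff_index_eq)
  qed
  moreover have "set ?X \<subseteq> tree"
    using Q n search_tree.child[of "Q ! n"] nth_mem[OF n] unfolding explored_def by blast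
  moreover have nth: "(Q @ ?X) ! i = Q ! i" if "i < Suc n" for i using that n by (simp add: nth_append)
  have "B = [] \<or> (\<exists>i<Suc n. B \<in> set (children ((Q @ ?X) ! i)))" if B: "B \<in> set (Q @ ?X)" for B
  proof (cases "B \<in> set ?X")
    case True
    then show ?thesis using nth[of n] by (intro disjI2 exI[of _ n]) simp
  next
    case False
    then have "B = [] \<or> (\<exists>i<n. B \<in> set (children (Q ! i)))" using Q B by (simp add: explored_def)
    then show ?thesis using nth less_SucI by metis
  qed
  moreover have "set (children ((Q @ ?X) ! i)) \<subseteq> set (Q @ ?X)" if i: "i < Suc n" for i
  proof (cases "i = n")
    case True
    then show ?thesis using nth[OF i] by simp
  next
    case False
    then have "set (children (Q ! i)) \<subseteq> set Q" using Q i by (simp add: explored_def)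
    then show ?thesis using nth[OF i] by auto
  qed
  ultimately show ?thesis using Q n unfolding explored_def by simp
qed

lemma explored_all:
  assumes "explored (length Q) Q" shows "set Q = tree"
proof
  show "set Q \<subseteq> tree" using assms by (simp add: explored_def)
  show "tree \<subseteq> set Q"
  proof
    fix A assume "A \<in> tree"
    then show "A \<in> set Q"
    proof induction
      case root
      then show ?case using assms by (simp add: explored_def)
    next
      case (child A B)
      then obtain i where "i < length Q" "Q ! i = A" by (auto simp: in_set_conv_nth)
      then show ?case using assms child unfolding explored_def by blast
    qed
  qed
qed

text \<open>The queue is a duplicate-free list of nodes of a finite tree, which bounds the
  iterations by the size of the tree. The search goes through the whole tree even after a solution
  has been found.\<close>

lemma run_search_queue:
  assumes s: "static s" "zeros s" "1 \<le> rank E"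
  shows "run search_queue s (\<lambda>t s'. t \<le> card (tree) * (node_time + 3) + 50 \<and>
    reg s' ''answer'' = of_bool (\<exists>A\<in>tree. solved A))"
proof -

  have fin: "finite tree" using card_search_tree[OF distinct_us s(3)] by blast
  let ?ans = "\<lambda>n Q. of_bool (\<exists>i<n. solved (Q ! i)) :: int"
  let ?C = "\<lambda>n Q f s. explored n Q \<and> static s \<and> queue_ok Q f s \<and> reg s ''fr'' = int f \<and> reg s ''x'' = int n \<and>
     reg s ''y'' = int (length Q) \<and> no_gains s \<and> reg s ''answer'' = ?ans n Q"
  let ?I = "\<lambda>n s. \<exists>Q f. ?C n Q f s"
  let ?b = "Less (Reg ''x'') (Reg ''y'')"
  let ?s = "upd (upd (put (upd s ''fr'' (int N)) QV 0 (- 1)) ''x'' 0) ''y'' 1"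
  have "run (While ?b process_node) ?s (\<lambda>t s'. t \<le> card tree * (node_time + btime ?b) + btime ?b \<and>
      (\<exists>n. ?I n s' \<and> \<not> bval ?b s'))"
  proof (rule run_While)
    fix n s' assume I: "?I n s'" and b: "bval ?b s'"
    then obtain Q f where Q: "explored n Q" "static s'" "queue_ok Q f s'" "reg s' ''fr'' = int f" "reg s' ''x'' = int n"
      "reg s' ''y'' = int (length Q)" "no_gains s'" "reg s' ''answer'' = ?ans n Q"
      by blast
    have n: "n < length Q" using b Q(5,6) by simp
    have "length Q = card (set Q)" using Q(1) by (simp add: explored_def distinct_card)
    also have "\<dots> \<le> card tree" using Q(1) fin by (intro card_mono) (simp_all add: explored_def)
    finally have lt: "n < card tree" using n by simp
    have tree: "Q ! n \<in> tree" using Q(1) nth_mem[OF n] unfolding explored_def by blast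
    have "run process_node s' (\<lambda>t s''. t \<le> node_time \<and> ?I (Suc n) s'')"
    proof (rule run_mono[OF run_process_node[OF Q(2-5) n Q(6,7) refl tree]])
      fix t s''
      let ?Q = "Q @ children (Q ! n)"
      assume *: "t \<le> node_time \<and> static s'' \<and> queue_ok ?Q (f + N) s'' \<and> reg s'' ''fr'' = int (f + N) \<and>
        reg s'' ''x'' = int (Suc n) \<and> reg s'' ''y'' = int (length ?Q) \<and> no_gains s'' \<and>
        reg s'' ''answer'' = (if solved (Q ! n) then 1 else reg s' ''answer'')"
      have nth: "?Q ! i = Q ! i" if "i < Suc n" for i using that n by (simp add: nth_append)
      have "(\<exists>i<Suc n. solved (?Q ! i)) \<longleftrightarrow> (\<exists>i<Suc n. solved (Q ! i))"
        using nth by metis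
      also have "\<dots> \<longleftrightarrow> solved (Q ! n) \<or> (\<exists>i<n. solved (Q ! i))"
        unfolding less_Suc_eq by blast
      finally have "reg s'' ''answer'' = ?ans (Suc n) ?Q" using * Q(8) by simp
      then have "?C (Suc n) ?Q (f + N) s''" using * explored_step[OF Q(1) n] by (elim conjE, intro conjI)
      then have "?I (Suc n) s''" by (intro exI)
      then show "t \<le> node_time \<and> ?I (Suc n) s''" using conjunct1[OF *] by (intro conjI)
    qed
    then show "n < card tree \<and> run process_node s' (\<lambda>t s''. t \<le> node_time \<and> ?I (Suc n) s'')"
      using lt by blast
  next
    have z: "arr s i a = 0" if "i \<in> {6..11}" "0 \<le> a" for i a
      using s(2) that by (simp add: zeros_def)
    have "explored 0 [[]]" by (simp add: explored_def search_tree.root)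
    moreover have "queue_ok [[]] N ?s"
      unfolding queue_ok_def using z by (auto simp: hits_ok_def prefix_cost_def intro!: exI[of _ 0])
    ultimately have "?C 0 [[]] N ?s" using s z by (simp add: zeros_def)
    then show "?I 0 ?s" by (intro exI)
  qed
  then have "run (While ?b process_node) ?s (\<lambda>t s'. 2 + (35 + (2 + (2 + t))) \<le> card tree * (node_time + 3) + 50 \<and>
    reg s' ''answer'' = of_bool (\<exists>A\<in>tree. solved A))"
  proof (rule run_mono)
    fix t s' assume *: "t \<le> card tree * (node_time + btime ?b) + btime ?b \<and> (\<exists>n. ?I n s' \<and> \<not> bval ?b s')"
    then obtain n Q f where Q: "?C n Q f s'" "\<not> bval ?b s'" by blast
    then have "n = length Q" by (simp add: explored_def)
    then have Q_eq: "explored (length Q) Q" "reg s' ''answer'' = ?ans (length Q) Q" using Q(1) by blast+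
    have "(\<exists>i<length Q. solved (Q ! i)) \<longleftrightarrow> (\<exists>A\<in>tree. solved A)"
      unfolding explored_all[OF Q_eq(1), symmetric] using in_set_conv_nth[of _ Q] by metis
    moreover have "t \<le> card tree * (node_time + 3) + 3" using conjunct1[OF *] by (simp add: algebra_simps)
    ultimately show "2 + (35 + (2 + (2 + t))) \<le> card tree * (node_time + 3) + 50 \<and>
       reg s' ''answer'' = of_bool (\<exists>A\<in>tree. solved A)" using Q_eq(2) by simp
  qed
  moreover have "reg s ''nt'' = int N" using s(1) by (simp add: static_def)
  ultimately show ?thesis unfolding search_queue_def
    by (auto elim!: run_mono)
qed

lemma node_time_le:
  assumes "1 \<le> rank E" "es \<noteq> []"
  shows "node_time \<le> 2600 * (rank E * K * N)"
proof -
  have "length us = card frequent" using distinct_card[OF distinct_us] set_us by simp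
  then have us: "length us \<le> rank E * N" using frequent_le by simp
  have one: "1 \<le> rank E * K" "1 \<le> rank E * K * N" "1 \<le> rank E" "rank E \<le> rank E * K"
    using assms K_pos N_pos by (simp_all add: Suc_le_eq)
  have "N * (rank E * 500 + 1507) \<le> N * (rank E * K * 2007)"
    using one by (intro mult_le_mono2) linarith
  moreover have "length us * (K * 45 + 307) \<le> rank E * N * (K * 352)"
    using us K_pos by (intro mult_le_mono) auto
  \<comment> \<open>\<open>2007 = 500 + 1507\<close> and \<open>352 = 45 + 307\<close>: additive
    constants are absorbed by factors that are at least 1.\<close>
  ultimately have "node_time \<le> N * (rank E * K * 2007) + rank E * N * (K * 352) + 200 * (rank E * K * N)"
    unfolding node_time_def using one by linarith
  also have "\<dots> = 2559 * (rank E * K * N)" by simp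
  finally show ?thesis by linarith
qed

end

section \<open>The complete program and its running time\<close>

definition main_search :: com where
  "main_search = Seq refinement_rounds (Seq collect_frequent (Seq collect_traces search_queue))"

text \<open>Without hyperedges the empty cover has cost 0, so only the signs of \<open>k\<close> and
  \<open>w\<close> matter. With hyperedges and \<open>k \<le> 0\<close> there is no cover, and
  \<open>answer\<close> keeps its initial 0.\<close>

definition min_sum_cover :: com where
  "min_sum_cover = com.If (Less (Const 0) (Load (Const 3)))
     (com.If (Less (Const 0) (Load (Const 0))) (Seq collect_vertices main_search) Skip)
     (com.If (And (Not (Less (Load (Const 0)) (Const 0))) (Not (Less (Load (Const 1)) (Const 0))))
       (Assign ''answer'' (Const 1)) Skip)"

context program
begin

lemma length_L_le: "length L \<le> length es * rank E"
proof -
  have "length L = card (\<Union>e\<in>E. e)" using distinct_card[OF dist_L] set_L by simp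
  also have "\<dots> \<le> (\<Sum>e\<in>E. card e)" using card_UN_le[OF finite_E, of "\<lambda>e. e"] .
  also have "\<dots> \<le> (\<Sum>e\<in>E. rank E)" by (intro sum_mono card_le)
  finally show ?thesis by (simp add: card_E)
qed

definition kernel_time :: nat where
  "kernel_time = K * (length L * 600 + length es * (rank E * 4000 + 1000) + 50) + 10 + (length L * 1500 + 5) +
     (length es * (rank E * 1000 + 1000) + 11)"

lemma kernel_time_le:
  assumes "1 \<le> rank E" "es \<noteq> []"
  shows "kernel_time \<le> 10000 * (K * rank E * length es)"
proof -
  let ?x = "length es * rank E"
  have x: "length es \<le> ?x" "1 \<le> ?x" using assms by (simp_all add: Suc_le_eq)
  have eq: "length es * (rank E * a + 1000) = a * ?x + 1000 * length es" for a by (simp add: distrib_left)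
  have "length L * 600 + length es * (rank E * 4000 + 1000) + 50 \<le> 5650 * ?x"
    unfolding eq using length_L_le x by linarith
  then have "K * (length L * 600 + length es * (rank E * 4000 + 1000) + 50) \<le> K * (5650 * ?x)"
    by (rule mult_le_mono2)
  moreover have "10 + (length L * 1500 + 5) + (length es * (rank E * 1000 + 1000) + 11) \<le> 3600 * ?x"
    unfolding eq using length_L_le x by linarith
  moreover have "?x \<le> K * ?x" using K_pos by simp
  ultimately have "kernel_time \<le> 10000 * (K * ?x)"
    unfolding kernel_time_def by linarith
  then show ?thesis by (simp add: ac_simps)
qed

text \<open>\<open>10050\<close> is 10000 for the preprocessing and 50 for setting up the queue;
  \<open>2603\<close> is 2600 for a node and 3 for the test of the loop.\<close>

lemma run_main_search:
  assumes s: "inp s" "fresh s" "reg s ''n'' = int (length L)" "\<forall>a<length L. arr s VL (int a) = int (L ! a)"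
    and ne: "es \<noteq> []" and r: "1 \<le> rank E"
    and C: "\<And>N. N \<le> length es \<Longrightarrow> N \<le> (2 * rank E * K * K + 1) ^ ((rank E + 1) * rank E) \<Longrightarrow>
     (K + 1) * (rank E ^ K * fact K) * (rank E * K * N) \<le> C * time_bound (rank E) K (length es)"
  shows "run main_search s (\<lambda>t s'.
     t \<le> (10050 + 2603 * C) * time_bound (rank E) K (length es) \<and>
     reg s' ''answer'' = of_bool (has_cheap_cover V E (int K) w))" (is "run _ _ ?R")
proof -
  let ?TB = "time_bound (rank E) K (length es)"
  have b: "base s" using s by (simp add: base_def fresh_def)
  have z: "arr s i a = 0" if "i \<in> {0, 1, 3, 4, 5}" "0 \<le> a" for i a
    using s(2) that by (auto simp: fresh_def)
  have kt: "kernel_time \<le> 10000 * ?TB"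
    using kernel_time_le[OF r ne] linear_le_time_bound[OF r K_pos, of "length es"] by linarith
  have search: "run search_queue s3 (\<lambda>t s'. ?R (kernel_time + t) s')"
    if s3: "inp s3" "zeros s3" "frequent_ok s3" "weights_ok (length es) s3" "reps_ok (length es) rs s3" for s3 rs
  proof -
    interpret S: search K w vs es V E L rs
      by unfold_locales (use s3(5) in \<open>auto simp: reps_ok_def\<close>)
    have st: "S.static s3"
      using s3 by (auto simp: S.static_def reps_ok_def weights_ok_def S.weight_def)
    let ?T = "search_tree K E us"
    have T: "card ?T \<le> (K + 1) * (rank E ^ K * fact K)"
      using card_search_tree[OF distinct_us r] by blast
    have N: "length rs \<le> length es"
      unfolding S.N_eq using card_image_le[OF finite_E, of "\<lambda>e. e \<inter> frequent"] card_E by simp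
    have N2: "length rs \<le> (2 * rank E * K * K + 1) ^ ((rank E + 1) * rank E)"
      unfolding S.N_eq by (rule card_traces)
    have "1 \<le> rank E * K * length rs" using r K_pos S.N_pos[OF ne] by (simp add: Suc_le_eq)
    then have "S.node_time + 3 \<le> 2603 * (rank E * K * length rs)" using S.node_time_le[OF r ne] by linarith
    then have "card ?T * (S.node_time + 3) \<le>
        (K + 1) * (rank E ^ K * fact K) * (2603 * (rank E * K * length rs))"
      using T by (intro mult_le_mono)
    also have "\<dots> = 2603 * ((K + 1) * (rank E ^ K * fact K) * (rank E * K * length rs))" by simp
    also have "\<dots> \<le> 2603 * (C * ?TB)" using C[OF N N2] by (rule mult_le_mono2)
    finally have "card ?T * (S.node_time + 3) + 50 + kernel_time \<le> (10050 + 2603 * C) * ?TB"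
      using kt time_bound_pos[of "rank E" K "length es"] by (simp add: distrib_right)
    moreover have "has_cheap_cover V E (int K) w \<longleftrightarrow> (\<exists>A\<in>?T. residual E (set A) = 0 \<and> int (prefix_cost E A) \<le> w)"
      by (rule has_cheap_cover_iff_search_tree[OF hyper set_us])
    ultimately show ?thesis
      by (intro run_mono[OF S.run_search_queue[OF st s3(2) r]]) auto
  qed
  show ?thesis
    unfolding main_search_def run_Seq
  proof (rule run_mono[OF run_refinement_rounds[OF s(1) b z]], simp_all only:, goal_cases)
    case (1 t1 s1)
    show ?case
    proof (rule run_mono[OF run_collect_frequent[of s1]], goal_cases)
      case (2 t2 s2)
      show ?case
      proof (rule run_mono[OF run_collect_traces[of s2]], goal_cases)
        case (6 t3 s3)
        then obtain rs where rs: "reps_ok (length es) rs s3" by blast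
        have "t1 + (t2 + t3) \<le> kernel_time" using 1 2 6 unfolding kernel_time_def by linarith
        then show ?case
          by (intro run_mono[OF search[of s3 rs]]) (use 6 rs in auto)
      qed (use 2 in auto)
    qed (use 1 in auto)
  qed
qed

end

theorem theorem4:
  "\<exists>(c :: com) (C :: nat).
     \<forall>(V :: nat set) (E :: nat set set) (k :: int) (w :: int) (vs :: nat list) (es :: nat list list).
       hypergraph V E \<longrightarrow> enumerates vs es V E \<longrightarrow>
       (\<exists>t s. exec c (initial_state (input_word k w vs es)) t s \<and>
              reg s ''answer'' = (if has_cheap_cover V E k w then 1 else 0) \<and>
              t \<le> C * time_bound (rank E) (nat k) (card E))"
proof -
  obtain C where C: "\<And>r k m N. 1 \<le> r \<Longrightarrow> 1 \<le> k \<Longrightarrow> N \<le> m \<Longrightarrow> N \<le> (2 * r * k * k + 1) ^ ((r + 1) * r) \<Longrightarrow>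
     (k + 1) * (r ^ k * fact k) * (r * k * N) \<le> C * time_bound r k m"
    using search_time_le by blast
  \<comment> \<open>\<open>10300 = 250 + 10050\<close>: 250 for branching and for collecting the
    vertices, the rest, with \<open>2603 * C\<close>, for \<open>main_search\<close>.\<close>
  define D where "D = 10300 + 2603 * C"
  have "run min_sum_cover (initial_state (input_word k w vs es)) (\<lambda>t s.
      reg s ''answer'' = (if has_cheap_cover V E k w then 1 else 0) \<and>
      t \<le> D * time_bound (rank E) (nat k) (card E))" (is "run _ ?s ?Q")
    if H: "hypergraph V E" and en: "enumerates vs es V E" for V E k w vs es
  proof -
    interpret input k w vs es .
    have inp: "inp ?s" by (rule inp_initial)
    have m: "mem ?s 0 = k" "mem ?s 1 = w" "mem ?s 3 = int (length es)" using inp by (simp_all add: inp_def)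
    have r0: "reg ?s x = 0" for x by (simp add: initial_state_def)
    have a0: "arr ?s i a = 0" if "0 \<le> a" for i a using that by (simp add: initial_state_def arr_def loc_def)
    have E: "set (map set es) = E" "distinct (map set es)" using en by (auto simp: enumerates_def)
    have cE: "card E = length es" using distinct_card[OF E(2)] unfolding E(1) by simp
    have finE: "finite E" using E(1) by (metis List.finite_set)
    have small: "t \<le> D * time_bound (rank E) (nat k) (card E)" if "t \<le> 50" for t
    proof -
      have "50 * 1 \<le> D * time_bound (rank E) (nat k) (card E)"
        using time_bound_pos by (intro mult_le_mono) (auto simp: D_def)
      then show ?thesis using that by linarith
    qed
    consider (empty) "es = []" | (nonpos) "es \<noteq> []" "k \<le> 0" | (main) "es \<noteq> []" "1 \<le> k" by linarith
    then show ?thesis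
    proof cases
      case empty
      then have "E = {}" using E(1) by simp
      then have "has_cheap_cover V E k w \<longleftrightarrow> 0 \<le> k \<and> 0 \<le> w"
        by (auto simp: has_cheap_cover_def set_cover_def ordering_cost_def bij_betw_def intro!: exI[of _ "{}"])
      then show ?thesis unfolding min_sum_cover_def using m empty r0 small by auto
    next
      case nonpos
      have "\<not> has_cheap_cover V E k w"
      proof
        assume "has_cheap_cover V E k w"
        then obtain S where S: "set_cover V E S" "int (card S) \<le> k" by (auto simp: has_cheap_cover_def)
        then have "finite S" "card S = 0" using H nonpos finite_subset by (auto simp: set_cover_def hypergraph_def)
        then have "S = {}" by simp
        then show False using S(1) nonpos E(1) by (auto simp: set_cover_def)
      qed
      then show ?thesis unfolding min_sum_cover_def using m nonpos r0 small by auto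
    next
      case main
      define K where "K = nat k"
      have k: "k = int K" "1 \<le> K" using main by (auto simp: K_def)
      have len: "length e \<le> rank E" if "e \<in> set es" for e
      proof -
        have "set e \<in> E" "distinct e" using that en by (auto simp: enumerates_def)
        moreover have "card (set e) \<le> rank E" using finE \<open>set e \<in> E\<close> by (auto simp: rank_def)
        ultimately show ?thesis by (simp add: distinct_card)
      qed
      have r: "1 \<le> rank E"
      proof -
        obtain e where e: "e \<in> set es" using main(1) by (cases es) auto
        then have "set e \<noteq> {}" using H E(1) by (auto simp: hypergraph_def)
        then have "length e \<ge> 1" by (cases e) auto
        then show ?thesis using len[OF e] by linarith
      qed
      have fr: "fresh ?s" unfolding fresh_def using r0 a0 by simp
      let ?TB = "time_bound (rank E) (nat k) (card E)"
      have lin: "length es * (rank E * 200 + 30) + 20 \<le> 250 * ?TB"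
      proof -
        have "1 * (rank E * length es) \<le> K * (rank E * length es)" using k(2) by (rule mult_le_mono1)
        also have "\<dots> \<le> ?TB"
          using linear_le_time_bound[OF r k(2), of "length es"] unfolding cE K_def by (simp only: mult.assoc)
        finally have "rank E * length es \<le> ?TB" by (simp only: mult_1)
        moreover have "length es \<le> rank E * length es" "1 \<le> rank E * length es" using r main(1) by (simp_all add: Suc_le_eq)
        moreover have "length es * (rank E * 200 + 30) = 200 * (rank E * length es) + 30 * length es"
          by (simp add: distrib_left)
        ultimately show ?thesis by linarith
      qed
      have "run (Seq collect_vertices main_search) ?s (\<lambda>t s. ?Q (8 + t) s)"
        unfolding run_Seq
      proof (rule run_mono[OF run_collect_vertices[OF inp fr _ r0 len]], goal_cases)
        case (3 t1 s1)
        then obtain L where L: "distinct L" "set L = (\<Union>e\<in>set es. set e)" "reg s1 ''n'' = int (length L)"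
          "\<forall>a<length L. arr s1 VL (int a) = int (L ! a)" by blast
        interpret P: program K w vs es V E L
          by unfold_locales (use H en k L E(1) in auto)
        have "run main_search s1 (\<lambda>t s'.
           t \<le> (10050 + 2603 * C) * time_bound (rank E) K (length es) \<and>
           reg s' ''answer'' = of_bool (has_cheap_cover V E (int K) w))"
          using 3 L main(1) r C[OF r k(2)] unfolding k(1) by (intro P.run_main_search) auto
        then show ?case
        proof (rule run_mono, goal_cases)
          case (1 t s')
          then have "t \<le> (10050 + 2603 * C) * ?TB" by (simp add: K_def cE)
          moreover have "t1 \<le> length es * (rank E * 200 + 30) + 11" using 3 by blast
          moreover have "D * ?TB = 250 * ?TB + (10050 + 2603 * C) * ?TB" by (simp add: D_def distrib_right)
          ultimately have "8 + (t1 + t) \<le> D * ?TB" using lin by linarith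
          then show ?case using 1 k(1) by simp
        qed
      qed (use a0 in simp)
      then show ?thesis unfolding min_sum_cover_def using m main by (auto elim: run_mono simp del: run_Seq)
    qed
  qed
  then show ?thesis unfolding run_def by blast
qed

end
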